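(* Let $N\hookrightarrow M$ be a Frobenius extension of rings of finite depth (that is, of depth $k$ for some integer $k>1$), with Jones tower $N=M_{-1}\hookrightarrow M=M_0\hookrightarrow M_1\hookrightarrow M_2\hookrightarrow\cdots$. Then $N\hookrightarrow M$ embeds into a depth two extension of $N$ in an iterated endomorphism ring: there is an $n$ such that the composite $N\hookrightarrow M\hookrightarrow M_n$ is a depth two extension $M_n\,|\,N$.
   Context: Rings are unital. A ring extension $N\to M$ is a Frobenius extension if there are an $N$-$N$-bimodule map $E:M\to N$ and finitely many $x_i,y_i\in M$ with $\sum_iE(ax_i)y_i=a=\sum_ix_iE(y_ia)$ for all $a\in M$. The Jones tower of $N\hookrightarrow M$ is given by $M_{-1}=N$, $M_0=M$, and $M_{i+1}=\operatorname{End}(M_i)_{M_{i-1}}$ (right $M_{i-1}$-linear endomorphisms of $M_i$) for $i\ge0$, with $M_i\to M_{i+1}$ the left regular map $x\mapsto\lambda_x$. A tower of rings $A\,|\,B\,|\,C$ (ring homomorphisms $C\to B\to A$) is right (respectively left) depth three if, as $A$-$C$-bimodules (respectively $C$-$A$-bimodules), $A\otimes_BA$ is isomorphic to a direct summand of $A^r$ for some positive integer $r$. The Frobenius extension $N\hookrightarrow M$ is of depth $k>1$ if the tower $M_{k-2}\,|\,M_{k-3}\,|\,M_{-1}$ is right or left depth three. A ring extension $A\,|\,C$ is depth two if $A\otimes_CA$ is isomorphic to a direct summand of some $A^r$ both as $A$-$C$-bimodules and as $C$-$A$-bimodules. *)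

theory Defs
  imports "HOL-Algebra.Free_Abelian_Groups" "HOL-Algebra.Weak_Morphisms"
begin

section \<open>Bimodules over not necessarily commutative rings\<close>

text \<open>As for the module records of HOL-Algebra, the fields \<^term>\<open>mult\<close> and
  \<^term>\<open>one\<close> inherited from rings carry no meaning; only the additive part is used.\<close>

record ('l, 'r, 'm) bimodule = "'m ring" +
  lact :: "'l \<Rightarrow> 'm \<Rightarrow> 'm"
  ract :: "'m \<Rightarrow> 'r \<Rightarrow> 'm"

definition bimodule_hom ::
  "('l, 'c) ring_scheme \<Rightarrow> ('r, 'd) ring_scheme \<Rightarrow> ('l, 'r, 'm) bimodule \<Rightarrow> ('l, 'r, 'n) bimodule
    \<Rightarrow> ('m \<Rightarrow> 'n) set" where
  "bimodule_hom L R X Y =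
    {h \<in> hom (add_monoid X) (add_monoid Y).
       (\<forall>l\<in>carrier L. \<forall>x\<in>carrier X. h (lact X l x) = lact Y l (h x)) \<and>
       (\<forall>r\<in>carrier R. \<forall>x\<in>carrier X. h (ract X x r) = ract Y (h x) r)}"

definition subbimodule ::
  "('l, 'c) ring_scheme \<Rightarrow> ('r, 'd) ring_scheme \<Rightarrow> 'm set \<Rightarrow> ('l, 'r, 'm) bimodule \<Rightarrow> bool" where
  "subbimodule L R P X \<longleftrightarrow> subgroup P (add_monoid X) \<and>
     (\<forall>l\<in>carrier L. \<forall>x\<in>P. lact X l x \<in> P) \<and> (\<forall>r\<in>carrier R. \<forall>x\<in>P. ract X x r \<in> P)"

definition direct_summand ::
  "('l, 'c) ring_scheme \<Rightarrow> ('r, 'd) ring_scheme \<Rightarrow> 'm set \<Rightarrow> ('l, 'r, 'm) bimodule \<Rightarrow> bool" where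
  "direct_summand L R P X \<longleftrightarrow> subbimodule L R P X \<and>
     (\<exists>Q. subbimodule L R Q X \<and> P \<inter> Q = {\<zero>\<^bsub>X\<^esub>} \<and> P <+>\<^bsub>X\<^esub> Q = carrier X)"

definition iso_to_direct_summand ::
  "('l, 'c) ring_scheme \<Rightarrow> ('r, 'd) ring_scheme \<Rightarrow> ('l, 'r, 'm) bimodule \<Rightarrow> ('l, 'r, 'n) bimodule
    \<Rightarrow> bool" where
  "iso_to_direct_summand L R X Y \<longleftrightarrow>
     (\<exists>P. direct_summand L R P Y \<and> (\<exists>h\<in>bimodule_hom L R X Y. bij_betw h (carrier X) P))"

definition bimodule_power :: "nat \<Rightarrow> ('l, 'r, 'm) bimodule \<Rightarrow> ('l, 'r, nat \<Rightarrow> 'm) bimodule" where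
  "bimodule_power n X =
    \<lparr>carrier = {..<n} \<rightarrow>\<^sub>E carrier X, monoid.mult = undefined, one = undefined,
     zero = (\<lambda>i\<in>{..<n}. \<zero>\<^bsub>X\<^esub>), add = (\<lambda>u v. \<lambda>i\<in>{..<n}. u i \<oplus>\<^bsub>X\<^esub> v i),
     lact = (\<lambda>l u. \<lambda>i\<in>{..<n}. lact X l (u i)), ract = (\<lambda>u r. \<lambda>i\<in>{..<n}. ract X (u i) r)\<rparr>"

text \<open>The ring \<open>A\<close> as an \<open>L\<close>-\<open>R\<close>-bimodule by restriction of scalars along ring homomorphisms
  \<open>f : L \<rightarrow> A\<close> and \<open>g : R \<rightarrow> A\<close>.\<close>

definition regular_bimodule ::
  "('a, 'c) ring_scheme \<Rightarrow> ('l \<Rightarrow> 'a) \<Rightarrow> ('r \<Rightarrow> 'a) \<Rightarrow> ('l, 'r, 'a) bimodule" where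
  "regular_bimodule A f g =
    \<lparr>carrier = carrier A, monoid.mult = monoid.mult A, one = \<one>\<^bsub>A\<^esub>, zero = \<zero>\<^bsub>A\<^esub>, add = add A,
     lact = (\<lambda>l x. f l \<otimes>\<^bsub>A\<^esub> x), ract = (\<lambda>x r. x \<otimes>\<^bsub>A\<^esub> g r)\<rparr>"

section \<open>Tensor products\<close>

text \<open>\<open>X \<otimes>\<^sub>B Y\<close> is the free abelian group on \<open>X \<times> Y\<close> modulo the subgroup generated by the
  biadditivity and \<open>B\<close>-balancedness relations. Its elements are cosets; the outer actions are
  induced by \<open>(x, y) \<mapsto> (l x, y)\<close> and \<open>(x, y) \<mapsto> (x, y r)\<close>: the extension of such a map to the free
  group sends a coset into a single coset, which is recovered by adding the subgroup.\<close>

definition tensor_relations ::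
  "('b, 'c) ring_scheme \<Rightarrow> ('l, 'b, 'm) bimodule \<Rightarrow> ('b, 'r, 'n) bimodule
    \<Rightarrow> ('m \<times> 'n \<Rightarrow>\<^sub>0 int) set" where
  "tensor_relations B X Y = generate (free_Abelian_group (carrier X \<times> carrier Y))
    ({frag_of (x \<oplus>\<^bsub>X\<^esub> x', y) - frag_of (x, y) - frag_of (x', y) | x x' y.
        x \<in> carrier X \<and> x' \<in> carrier X \<and> y \<in> carrier Y} \<union>
     {frag_of (x, y \<oplus>\<^bsub>Y\<^esub> y') - frag_of (x, y) - frag_of (x, y') | x y y'.
        x \<in> carrier X \<and> y \<in> carrier Y \<and> y' \<in> carrier Y} \<union>
     {frag_of (ract X x b, y) - frag_of (x, lact Y b y) | x b y.
        x \<in> carrier X \<and> b \<in> carrier B \<and> y \<in> carrier Y})"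

definition tensor ::
  "('b, 'c) ring_scheme \<Rightarrow> ('l, 'b, 'm) bimodule \<Rightarrow> ('b, 'r, 'n) bimodule
    \<Rightarrow> ('l, 'r, ('m \<times> 'n \<Rightarrow>\<^sub>0 int) set) bimodule" where
  "tensor B X Y =
    (let F = free_Abelian_group (carrier X \<times> carrier Y); K = tensor_relations B X Y in
     \<lparr>carrier = carrier (F Mod K), monoid.mult = undefined, one = undefined,
      zero = \<one>\<^bsub>F Mod K\<^esub>, add = monoid.mult (F Mod K),
      lact = (\<lambda>l u. K <#>\<^bsub>F\<^esub> frag_extend (\<lambda>(x, y). frag_of (lact X l x, y)) ` u),
      ract = (\<lambda>u r. K <#>\<^bsub>F\<^esub> frag_extend (\<lambda>(x, y). frag_of (x, ract Y y r)) ` u)\<rparr>)"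

section \<open>Depth three towers and depth two extensions\<close>

text \<open>A tower \<open>A | B | C\<close> is given by \<open>\<beta> : B \<rightarrow> A\<close> and \<open>\<gamma> : C \<rightarrow> B\<close>.\<close>

definition right_depth_three ::
  "('a, 'd) ring_scheme \<Rightarrow> ('b, 'e) ring_scheme \<Rightarrow> ('c, 'f) ring_scheme
    \<Rightarrow> ('b \<Rightarrow> 'a) \<Rightarrow> ('c \<Rightarrow> 'b) \<Rightarrow> bool" where
  "right_depth_three A B C \<beta> \<gamma> \<longleftrightarrow> (\<exists>r>0. iso_to_direct_summand A C
     (tensor B (regular_bimodule A id \<beta>) (regular_bimodule A \<beta> (\<beta> \<circ> \<gamma>)))
     (bimodule_power r (regular_bimodule A id (\<beta> \<circ> \<gamma>))))"

definition left_depth_three ::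
  "('a, 'd) ring_scheme \<Rightarrow> ('b, 'e) ring_scheme \<Rightarrow> ('c, 'f) ring_scheme
    \<Rightarrow> ('b \<Rightarrow> 'a) \<Rightarrow> ('c \<Rightarrow> 'b) \<Rightarrow> bool" where
  "left_depth_three A B C \<beta> \<gamma> \<longleftrightarrow> (\<exists>r>0. iso_to_direct_summand C A
     (tensor B (regular_bimodule A (\<beta> \<circ> \<gamma>) \<beta>) (regular_bimodule A \<beta> id))
     (bimodule_power r (regular_bimodule A (\<beta> \<circ> \<gamma>) id)))"

definition depth_two ::
  "('a, 'd) ring_scheme \<Rightarrow> ('c, 'f) ring_scheme \<Rightarrow> ('c \<Rightarrow> 'a) \<Rightarrow> bool" where
  "depth_two A C \<alpha> \<longleftrightarrow> (\<exists>r>0.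
     iso_to_direct_summand A C
       (tensor C (regular_bimodule A id \<alpha>) (regular_bimodule A \<alpha> \<alpha>))
       (bimodule_power r (regular_bimodule A id \<alpha>)) \<and>
     iso_to_direct_summand C A
       (tensor C (regular_bimodule A \<alpha> \<alpha>) (regular_bimodule A \<alpha> id))
       (bimodule_power r (regular_bimodule A \<alpha> id)))"

section \<open>Frobenius extensions\<close>

definition frobenius_extension ::
  "('a, 'c) ring_scheme \<Rightarrow> ('b, 'd) ring_scheme \<Rightarrow> ('a \<Rightarrow> 'b) \<Rightarrow> bool" where
  "frobenius_extension N M \<iota> \<longleftrightarrow> ring_hom_ring N M \<iota> \<and>
    (\<exists>E\<in>bimodule_hom N N (regular_bimodule M \<iota> \<iota>) (regular_bimodule N id id).
     \<exists>(m::nat) x y. x \<in> {..<m} \<rightarrow> carrier M \<and> y \<in> {..<m} \<rightarrow> carrier M \<and>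
       (\<forall>a\<in>carrier M.
          (\<Oplus>\<^bsub>M\<^esub>i\<in>{..<m}. \<iota> (E (a \<otimes>\<^bsub>M\<^esub> x i)) \<otimes>\<^bsub>M\<^esub> y i) = a \<and>
          (\<Oplus>\<^bsub>M\<^esub>i\<in>{..<m}. x i \<otimes>\<^bsub>M\<^esub> \<iota> (E (y i \<otimes>\<^bsub>M\<^esub> a))) = a))"

section \<open>The Jones tower\<close>

text \<open>For \<open>f : A \<rightarrow> B\<close>, the ring of right \<open>A\<close>-linear endomorphisms of \<open>B\<close>; endomorphisms are
  extensional functions on the carrier of \<open>B\<close>.\<close>

definition right_End ::
  "('a, 'c) ring_scheme \<Rightarrow> ('b, 'd) ring_scheme \<Rightarrow> ('a \<Rightarrow> 'b) \<Rightarrow> ('b \<Rightarrow> 'b) ring" where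
  "right_End A B f =
    \<lparr>carrier = {h \<in> carrier B \<rightarrow>\<^sub>E carrier B.
       (\<forall>x\<in>carrier B. \<forall>y\<in>carrier B. h (x \<oplus>\<^bsub>B\<^esub> y) = h x \<oplus>\<^bsub>B\<^esub> h y) \<and>
       (\<forall>x\<in>carrier B. \<forall>a\<in>carrier A. h (x \<otimes>\<^bsub>B\<^esub> f a) = h x \<otimes>\<^bsub>B\<^esub> f a)},
     monoid.mult = compose (carrier B), one = (\<lambda>x\<in>carrier B. x),
     zero = (\<lambda>x\<in>carrier B. \<zero>\<^bsub>B\<^esub>), add = (\<lambda>g h. \<lambda>x\<in>carrier B. g x \<oplus>\<^bsub>B\<^esub> h x)\<rparr>"

definition left_regular :: "('b, 'd) ring_scheme \<Rightarrow> 'b \<Rightarrow> 'b \<Rightarrow> 'b" where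
  "left_regular B x = (\<lambda>y\<in>carrier B. x \<otimes>\<^bsub>B\<^esub> y)"

text \<open>The rings of the tower have growing function types, so each of them is replaced by an
  isomorphic copy in one common type, obtained by renaming every endomorphism injectively. In the
  situation of interest \<open>B\<close> is a finitely generated right \<open>A\<close>-module (by the \<open>x i\<close> of the Frobenius
  system, Frobenius extensions being stable under passing from \<open>A \<rightarrow> B\<close> to
  \<open>B \<rightarrow> End(B)\<^sub>A\<close>), so an endomorphism is determined by the list of its values on generators and a
  renaming exists: see \<open>endo_code_inj\<close> below.\<close>

datatype ('a, 'b) tower_elem = Base 'a | Ext 'b | Endo "('a, 'b) tower_elem list"

type_synonym ('a, 'b) tower_ring = "('a, 'b) tower_elem ring"

definition endo_code ::
  "('a, 'b) tower_ring \<Rightarrow> ('a, 'b) tower_ring \<Rightarrow> (('a, 'b) tower_elem \<Rightarrow> ('a, 'b) tower_elem)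
    \<Rightarrow> (('a, 'b) tower_elem \<Rightarrow> ('a, 'b) tower_elem) \<Rightarrow> ('a, 'b) tower_elem" where
  "endo_code A B f = (SOME c. inj_on c (carrier (right_End A B f)))"

lemma endo_code_inj:
  fixes A B :: "('a, 'b) tower_ring"
  assumes "ring_hom_ring A B f"
    and gen: "x \<in> {..<m::nat} \<rightarrow> carrier B"
      "\<And>b. b \<in> carrier B \<Longrightarrow>
        \<exists>a \<in> {..<m} \<rightarrow> carrier A. b = (\<Oplus>\<^bsub>B\<^esub>i\<in>{..<m}. x i \<otimes>\<^bsub>B\<^esub> f (a i))"
  shows "inj_on (endo_code A B f) (carrier (right_End A B f))"
proof -
  interpret ring_hom_ring A B f by fact
  have sum: "h (\<Oplus>\<^bsub>B\<^esub>i\<in>{..<k}. u i) = (\<Oplus>\<^bsub>B\<^esub>i\<in>{..<k}. h (u i))"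
    if h: "h \<in> carrier (right_End A B f)" and u: "u \<in> {..<k} \<rightarrow> carrier B" for h u and k :: nat
  proof -
    have hc: "h \<in> carrier B \<rightarrow> carrier B"
      and ha: "\<And>x y. x \<in> carrier B \<Longrightarrow> y \<in> carrier B \<Longrightarrow> h (x \<oplus>\<^bsub>B\<^esub> y) = h x \<oplus>\<^bsub>B\<^esub> h y"
      using h by (auto simp: right_End_def)
    have "h \<zero>\<^bsub>B\<^esub> \<oplus>\<^bsub>B\<^esub> h \<zero>\<^bsub>B\<^esub> = h \<zero>\<^bsub>B\<^esub>"
      using ha[of "\<zero>\<^bsub>B\<^esub>" "\<zero>\<^bsub>B\<^esub>"] by simp
    moreover have "h \<zero>\<^bsub>B\<^esub> \<in> carrier B" using hc by auto
    ultimately have h0: "h \<zero>\<^bsub>B\<^esub> = \<zero>\<^bsub>B\<^esub>" by (metis S.add.r_cancel_one)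
    show ?thesis
      using u
    proof (induction k)
      case 0
      show ?case by (simp add: h0)
    next
      case (Suc k)
      have uk: "u \<in> {..<k} \<rightarrow> carrier B" "u k \<in> carrier B" using Suc.prems by auto
      have "(\<lambda>i. h (u i)) \<in> {..<k} \<rightarrow> carrier B" "h (u k) \<in> carrier B" using uk hc by auto
      then show ?case
        using uk Suc.IH by (simp add: lessThan_Suc ha S.finsum_closed)
    qed
  qed
  have "inj_on (\<lambda>h. Endo (map (\<lambda>i. h (x i)) [0..<m])) (carrier (right_End A B f))"
  proof (rule inj_onI)
    fix g h
    assume g: "g \<in> carrier (right_End A B f)" and h: "h \<in> carrier (right_End A B f)"
      and "Endo (map (\<lambda>i. g (x i)) [0..<m]) = Endo (map (\<lambda>i. h (x i)) [0..<m])"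
    then have eq: "g (x i) = h (x i)" if "i < m" for i
      using that by (auto simp: map_eq_conv)
    have "g b = h b" if b: "b \<in> carrier B" for b
    proof -
      obtain a where a: "a \<in> {..<m} \<rightarrow> carrier A"
        and bs: "b = (\<Oplus>\<^bsub>B\<^esub>i\<in>{..<m}. x i \<otimes>\<^bsub>B\<^esub> f (a i))"
        using gen(2)[OF b] by blast
      have c: "x i \<in> carrier B" "a i \<in> carrier A" "f (a i) \<in> carrier B" if "i < m" for i
        using gen(1) a that by (auto intro: hom_closed)
      have xc: "k (x i) \<in> carrier B" if "k \<in> carrier (right_End A B f)" "i < m" for k i
        using that c by (auto simp: right_End_def)
      have val: "k b = (\<Oplus>\<^bsub>B\<^esub>i\<in>{..<m}. k (x i) \<otimes>\<^bsub>B\<^esub> f (a i))"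
        if k: "k \<in> carrier (right_End A B f)" for k
      proof -
        have "k b = (\<Oplus>\<^bsub>B\<^esub>i\<in>{..<m}. k (x i \<otimes>\<^bsub>B\<^esub> f (a i)))"
          unfolding bs by (rule sum[OF k]) (use c in auto)
        also have "\<dots> = (\<Oplus>\<^bsub>B\<^esub>i\<in>{..<m}. k (x i) \<otimes>\<^bsub>B\<^esub> f (a i))"
          by (rule S.finsum_cong') (use c xc[OF k] k in \<open>auto simp: right_End_def\<close>)
        finally show ?thesis .
      qed
      show ?thesis unfolding val[OF g] val[OF h]
        by (rule S.finsum_cong') (use c xc[OF h] eq in auto)
    qed
    then show "g = h"
      using g h by (intro extensionalityI[of _ "carrier B"]) (auto simp: right_End_def PiE_def)
  qed
  then show ?thesis
    unfolding endo_code_def by (rule someI[where P = "\<lambda>c. inj_on c (carrier (right_End A B f))"])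
qed

text \<open>One step of the tower turns \<open>f : A \<rightarrow> B\<close> into \<open>B \<rightarrow> End(B)\<^sub>A\<close>.\<close>

fun jones_step ::
  "('a, 'b) tower_ring \<times> ('a, 'b) tower_ring \<times> (('a, 'b) tower_elem \<Rightarrow> ('a, 'b) tower_elem)
    \<Rightarrow> ('a, 'b) tower_ring \<times> ('a, 'b) tower_ring \<times> (('a, 'b) tower_elem \<Rightarrow> ('a, 'b) tower_elem)"
  where
  "jones_step (A, B, f) =
    (B, image_ring (endo_code A B f) (right_End A B f), \<lambda>x. endo_code A B f (left_regular B x))"

text \<open>The index is shifted by one: \<open>jones_stage N M \<iota> j\<close> is \<open>(M\<^sub>j\<^sub>-\<^sub>1, M\<^sub>j, M\<^sub>j\<^sub>-\<^sub>1 \<rightarrow> M\<^sub>j)\<close>,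
  \<open>jones_ring N M \<iota> j\<close> is \<open>M\<^sub>j\<^sub>-\<^sub>1\<close>, and \<open>jones_embed N M \<iota> j\<close> is the composite map from \<open>N\<close> to
  \<open>M\<^sub>j\<^sub>-\<^sub>1\<close>.\<close>

primrec jones_stage ::
  "'a ring \<Rightarrow> 'b ring \<Rightarrow> ('a \<Rightarrow> 'b) \<Rightarrow> nat \<Rightarrow>
    ('a, 'b) tower_ring \<times> ('a, 'b) tower_ring \<times> (('a, 'b) tower_elem \<Rightarrow> ('a, 'b) tower_elem)"
  where
  "jones_stage N M \<iota> 0 = (image_ring Base N, image_ring Ext M, \<lambda>u. Ext (\<iota> (inv_into UNIV Base u)))"
| "jones_stage N M \<iota> (Suc j) = jones_step (jones_stage N M \<iota> j)"

definition jones_ring :: "'a ring \<Rightarrow> 'b ring \<Rightarrow> ('a \<Rightarrow> 'b) \<Rightarrow> nat \<Rightarrow> ('a, 'b) tower_ring" where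
  "jones_ring N M \<iota> j = fst (jones_stage N M \<iota> j)"

definition jones_map ::
  "'a ring \<Rightarrow> 'b ring \<Rightarrow> ('a \<Rightarrow> 'b) \<Rightarrow> nat \<Rightarrow> ('a, 'b) tower_elem \<Rightarrow> ('a, 'b) tower_elem" where
  "jones_map N M \<iota> j = snd (snd (jones_stage N M \<iota> j))"

primrec jones_embed ::
  "'a ring \<Rightarrow> 'b ring \<Rightarrow> ('a \<Rightarrow> 'b) \<Rightarrow> nat \<Rightarrow> 'a \<Rightarrow> ('a, 'b) tower_elem" where
  "jones_embed N M \<iota> 0 = Base"
| "jones_embed N M \<iota> (Suc j) = jones_map N M \<iota> j \<circ> jones_embed N M \<iota> j"

text \<open>Depth \<open>k > 1\<close>: the tower \<open>M\<^sub>k\<^sub>-\<^sub>2 | M\<^sub>k\<^sub>-\<^sub>3 | M\<^sub>-\<^sub>1\<close> is right or left depth three.\<close>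

definition has_depth :: "'a ring \<Rightarrow> 'b ring \<Rightarrow> ('a \<Rightarrow> 'b) \<Rightarrow> nat \<Rightarrow> bool" where
  "has_depth N M \<iota> k \<longleftrightarrow> k > 1 \<and>
    (right_depth_three (jones_ring N M \<iota> (k - 1)) (jones_ring N M \<iota> (k - 2)) N
       (jones_map N M \<iota> (k - 2)) (jones_embed N M \<iota> (k - 2)) \<or>
     left_depth_three (jones_ring N M \<iota> (k - 1)) (jones_ring N M \<iota> (k - 2)) N
       (jones_map N M \<iota> (k - 2)) (jones_embed N M \<iota> (k - 2)))"

end

theory Submission
  imports Defs
begin

text \<open>
  Let \<open>A | B\<close> be a Frobenius extension with homomorphism \<open>E\<close>, and let \<open>A | B | C\<close> be a
  tower of rings. A map of \<open>A\<close>-\<open>C\<close>-bimodules from the tensor square of \<open>A\<close> over \<open>B\<close> to \<open>A\<close> is determined by an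
  endomorphism \<open>f\<close> of \<open>A\<close>, its values on \<open>1 \<otimes> a\<close>; a bimodule map in the other direction is
  determined by a \<open>C\<close>-central tensor, and \<open>E\<close> turns such a tensor into another endomorphism \<open>g\<close>
  of \<open>A\<close>. If the tensor square is a direct summand of a power of \<open>A\<close>, then expressing the
  identity through these maps gives the product formula
    \<open>E (a b) = f\<^sub>1(a) g\<^sub>1(b) + \<dots> + f\<^sub>r(a) g\<^sub>r(b)\<close>
  with each \<open>f\<^sub>t\<close> linear over \<open>B\<close> on the left and \<open>C\<close> on the right, and each \<open>g\<^sub>t\<close> the other way
  round (\<open>splits_of_depth_three\<close>). The formula does not see the difference between right and left
  depth three: passing to opposite rings exchanges \<open>f\<close> and \<open>g\<close> (\<open>splits_of_left_depth_three\<close>). For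
  \<open>B = C = N\<close> the dual bases rebuild both splittings of the tensor square from the
  formula, so the formula for \<open>A | N\<close> gives depth two (\<open>depth_two_of_splits\<close>). Tensor products are
  therefore needed only at the two ends of the argument.

  What remains is to pass from the formula for \<open>A = M\<^sub>d\<close> over \<open>M\<^sub>d\<^sub>-\<^sub>1\<close>, where \<open>d = k - 2\<close>, to the
  formula for \<open>M\<^sub>d\<close> over \<open>N\<close>. Morally, \<open>M\<^sub>i\<close> is the tensor product over \<open>N\<close> of \<open>M\<^sub>i\<^sub>-\<^sub>1\<close> and \<open>M\<close>. So
  depth three at the top of the tower says that \<open>A \<otimes> M\<close> (over \<open>N\<close>) is a summand of a power of \<open>A\<close>;
  tensoring repeatedly with \<open>M\<close> shows that \<open>A \<otimes> M\<^sub>i\<close> is one for every \<open>i\<close>, in particular for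
  \<open>M\<^sub>i = A\<close>. In terms of elements, let \<open>e\<^sub>i\<close> be the element \<open>E\<^sub>i\<^sub>-\<^sub>1\<close> of the endomorphism ring \<open>M\<^sub>i\<close>
  and put \<open>v = e\<^sub>i \<dots> e\<^sub>1\<close> and \<open>w = e\<^sub>1 \<dots> e\<^sub>i\<close>. Both commute with \<open>N\<close>, they satisfy
  \<open>E\<^sub>i (v b w) = E\<^sub>0 b\<close> for \<open>b\<close> in \<open>M\<close>, and if \<open>x\<^sub>j\<close>, \<open>y\<^sub>j\<close> are dual bases of \<open>M | N\<close>, then \<open>x\<^sub>j w\<close> and
  \<open>v y\<^sub>j\<close> are dual with respect to \<open>E\<^sub>i\<close>. This is the locale \<open>ladder\<close>; it is carried one stage up by
  \<open>ladder_step\<close>. It has two uses.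

  \<^item> Putting \<open>v a\<close> and \<open>b w\<close> for the two arguments in the formula at the top gives the formula
    for \<open>E\<^sub>0\<close> on \<open>M\<close>, with factors taking their values in \<open>A\<close> (\<open>splits_base\<close>).

  \<^item> Expanding along the dual elements gives \<open>E\<^sub>i (a b)\<close> as a sum of terms
    \<open>a\<^sub>j E\<^sub>0(y\<^sub>j x\<^sub>l) b\<^sub>l\<close>. Hence formulas with values in \<open>A\<close> for \<open>E\<^sub>0\<close> and for a map \<open>F\<close> from \<open>M\<^sub>i\<^sub>-\<^sub>1\<close> to
    \<open>N\<close> combine to one for the composite of \<open>F\<close> and \<open>E\<^sub>i\<close> (\<open>splits_step\<close>).

  Climbing from \<open>M\<close> to \<open>M\<^sub>d\<close> with the second point proves the theorem with \<open>n = d\<close>.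
\<close>

section \<open>Finite sums and bimodule maps\<close>

lemma additive_finsum:
  assumes "abelian_group G" "abelian_group H" "h \<in> hom (add_monoid G) (add_monoid H)"
    and "finite I" "u \<in> I \<rightarrow> carrier G"
  shows "h (\<Oplus>\<^bsub>G\<^esub>i\<in>I. u i) = (\<Oplus>\<^bsub>H\<^esub>i\<in>I. h (u i))"
proof -
  interpret G: abelian_group G by fact
  interpret H: abelian_group H by fact
  interpret group_hom "add_monoid G" "add_monoid H" h
    using assms by (simp add: group_hom_def group_hom_axioms_def G.a_group H.a_group)
  have h: "h a \<in> carrier H" if "a \<in> carrier G" for a
    using hom_closed that by simp
  show ?thesis
    using assms(4,5)
  proof (induction I rule: finite_induct)
    case empty
    then show ?case using hom_one by simp
  next
    case (insert i I)
    then have "u i \<in> carrier G" "u \<in> I \<rightarrow> carrier G" "(\<lambda>i. h (u i)) \<in> I \<rightarrow> carrier H"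
      using h by auto
    then show ?case
      using insert hom_mult[of "u i" "\<Oplus>\<^bsub>G\<^esub>i\<in>I. u i"] h
      by (simp add: G.finsum_insert H.finsum_insert G.finsum_closed)
  qed
qed

lemma (in abelian_monoid) finsum_swap:
  assumes "finite I" "finite J" "\<And>i j. i \<in> I \<Longrightarrow> j \<in> J \<Longrightarrow> u i j \<in> carrier G"
  shows "(\<Oplus>i\<in>I. \<Oplus>j\<in>J. u i j) = (\<Oplus>j\<in>J. \<Oplus>i\<in>I. u i j)"
  using assms(1,3)
proof (induction I rule: finite_induct)
  case empty
  then show ?case by (simp add: finsum_zero)
next
  case (insert i I)
  have "(\<Oplus>k\<in>insert i I. u k j) = u i j \<oplus> (\<Oplus>k\<in>I. u k j)" if "j \<in> J" for j
    using insert that by (intro finsum_insert) auto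
  then have "(\<Oplus>j\<in>J. \<Oplus>k\<in>insert i I. u k j) = (\<Oplus>j\<in>J. u i j \<oplus> (\<Oplus>k\<in>I. u k j))"
    using insert.prems by (intro finsum_cong') (auto intro!: finsum_closed)
  also have "\<dots> = (\<Oplus>j\<in>J. u i j) \<oplus> (\<Oplus>j\<in>J. \<Oplus>k\<in>I. u k j)"
    using insert.prems by (intro finsum_addf) (auto intro!: finsum_closed)
  also have "\<dots> = (\<Oplus>k\<in>insert i I. \<Oplus>j\<in>J. u k j)"
    using insert by (subst finsum_insert) (auto intro!: finsum_closed)
  finally show ?case by simp
qed

text \<open>Families indexed by pairs are reindexed by a single number, because the summands in direct
  powers and the dual bases of a Frobenius extension are indexed by initial segments of the naturals.\<close>

lemma (in abelian_monoid) finsum_div_mod: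
  assumes u: "\<And>i j. i < r \<Longrightarrow> j < s \<Longrightarrow> u i j \<in> carrier G"
  shows "(\<Oplus>k\<in>{..<r * s}. u (k div s) (k mod s)) = (\<Oplus>i\<in>{..<r}. \<Oplus>j\<in>{..<(s::nat)}. u i j)"
  using u
proof (induction r)
  case 0
  then show ?case by simp
next
  case (Suc r)
  show ?case
  proof (cases "s = 0")
    case True
    then show ?thesis by (simp add: finsum_zero)
  next
    case False
    then have ds: "(r * s + j) div s = r" "(r * s + j) mod s = j" if "j < s" for j
      using that by (auto simp: div_mult_self3 add.commute)
    have split: "{..<Suc r * s} = {..<r * s} \<union> (\<lambda>j. r * s + j) ` {..<s}"
      by (simp add: lessThan_atLeast0 ivl_disj_un_two add.commute)
    have cl: "(\<lambda>k. u (k div s) (k mod s)) \<in> {..<r * s} \<rightarrow> carrier G"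
      using Suc.prems False by (auto simp: less_mult_imp_div_less less_Suc_eq)
    have cl2: "(\<lambda>k. u (k div s) (k mod s)) \<in> (\<lambda>j. r * s + j) ` {..<s} \<rightarrow> carrier G"
      using Suc.prems ds by auto
    have "(\<Oplus>k\<in>(\<lambda>j. r * s + j) ` {..<s}. u (k div s) (k mod s)) = (\<Oplus>j\<in>{..<s}. u r j)"
      using cl2 Suc.prems ds
      by (subst finsum_reindex) (auto simp: inj_on_def intro!: finsum_cong')
    moreover have "(\<Oplus>k\<in>{..<Suc r * s}. u (k div s) (k mod s)) =
        (\<Oplus>k\<in>{..<r * s}. u (k div s) (k mod s)) \<oplus>
        (\<Oplus>k\<in>(\<lambda>j. r * s + j) ` {..<s}. u (k div s) (k mod s))"
      unfolding split using cl cl2 by (intro finsum_Un_disjoint) auto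
    moreover have "(\<Oplus>k\<in>{..<r * s}. u (k div s) (k mod s)) = (\<Oplus>i\<in>{..<r}. \<Oplus>j\<in>{..<s}. u i j)"
      using Suc by auto
    moreover have "(\<Oplus>i\<in>{..<Suc r}. \<Oplus>j\<in>{..<s}. u i j) =
        (\<Oplus>j\<in>{..<s}. u r j) \<oplus> (\<Oplus>i\<in>{..<r}. \<Oplus>j\<in>{..<s}. u i j)"
      unfolding lessThan_Suc using Suc.prems by (subst finsum_insert) (auto intro!: finsum_closed)
    ultimately show ?thesis
      using Suc.prems by (simp add: a_comm finsum_closed Pi_def)
  qed
qed

lemma (in ring) finsum_mult_finsum:
  assumes "finite I" "finite J" "u \<in> I \<rightarrow> carrier R" "w \<in> J \<rightarrow> carrier R"
  shows "(\<Oplus>i\<in>I. u i) \<otimes> (\<Oplus>j\<in>J. w j) = (\<Oplus>i\<in>I. \<Oplus>j\<in>J. u i \<otimes> w j)"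
proof -
  have "(\<Oplus>i\<in>I. u i) \<otimes> (\<Oplus>j\<in>J. w j) = (\<Oplus>i\<in>I. u i \<otimes> (\<Oplus>j\<in>J. w j))"
    using assms by (intro finsum_ldistr) (auto intro: finsum_closed)
  also have "\<dots> = (\<Oplus>i\<in>I. \<Oplus>j\<in>J. u i \<otimes> w j)"
    using assms by (intro finsum_cong' finsum_rdistr) (auto intro!: finsum_closed simp: Pi_def)
  finally show ?thesis .
qed

abbreviation regular_hom where
  "regular_hom L R A p q D p' q' \<equiv> bimodule_hom L R (regular_bimodule A p q) (regular_bimodule D p' q')"

lemma regular_homI:
  assumes "\<And>x. x \<in> carrier A \<Longrightarrow> f x \<in> carrier D"
    and "\<And>x y. x \<in> carrier A \<Longrightarrow> y \<in> carrier A \<Longrightarrow> f (x \<oplus>\<^bsub>A\<^esub> y) = f x \<oplus>\<^bsub>D\<^esub> f y"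
    and "\<And>l x. l \<in> carrier L \<Longrightarrow> x \<in> carrier A \<Longrightarrow> f (p l \<otimes>\<^bsub>A\<^esub> x) = p' l \<otimes>\<^bsub>D\<^esub> f x"
    and "\<And>r x. r \<in> carrier R \<Longrightarrow> x \<in> carrier A \<Longrightarrow> f (x \<otimes>\<^bsub>A\<^esub> q r) = f x \<otimes>\<^bsub>D\<^esub> q' r"
  shows "f \<in> regular_hom L R A p q D p' q'"
  using assms by (auto simp: bimodule_hom_def regular_bimodule_def hom_def)

lemma regular_homD:
  assumes "f \<in> regular_hom L R A p q D p' q'"
  shows "x \<in> carrier A \<Longrightarrow> f x \<in> carrier D"
    and "x \<in> carrier A \<Longrightarrow> y \<in> carrier A \<Longrightarrow> f (x \<oplus>\<^bsub>A\<^esub> y) = f x \<oplus>\<^bsub>D\<^esub> f y"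
    and "l \<in> carrier L \<Longrightarrow> x \<in> carrier A \<Longrightarrow> f (p l \<otimes>\<^bsub>A\<^esub> x) = p' l \<otimes>\<^bsub>D\<^esub> f x"
    and "r \<in> carrier R \<Longrightarrow> x \<in> carrier A \<Longrightarrow> f (x \<otimes>\<^bsub>A\<^esub> q r) = f x \<otimes>\<^bsub>D\<^esub> q' r"
  using assms by (auto simp: bimodule_hom_def regular_bimodule_def hom_def)

lemma regular_hom_finsum:
  assumes "f \<in> regular_hom L R A p q D p' q'"
    and "ring A" "ring D" "finite I" "u \<in> I \<rightarrow> carrier A"
  shows "f (\<Oplus>\<^bsub>A\<^esub>i\<in>I. u i) = (\<Oplus>\<^bsub>D\<^esub>i\<in>I. f (u i))"
  using assms
  by (intro additive_finsum)
    (auto simp: bimodule_hom_def regular_bimodule_def hom_def ring_def)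

section \<open>Frobenius systems\<close>

locale frobenius_system = ring_hom_ring B A \<phi>
  for B :: "('b, 'd) ring_scheme" and A :: "('a, 'c) ring_scheme" (structure) and \<phi> +
  fixes E and m :: nat and x y
  assumes E_hom: "E \<in> regular_hom B B A \<phi> \<phi> B id id"
    and x_closed: "x \<in> {..<m} \<rightarrow> carrier A" and y_closed: "y \<in> {..<m} \<rightarrow> carrier A"
    and expand_y: "\<And>a. a \<in> carrier A \<Longrightarrow> (\<Oplus>i\<in>{..<m}. \<phi> (E (a \<otimes> x i)) \<otimes> y i) = a"
    and expand_x: "\<And>a. a \<in> carrier A \<Longrightarrow> (\<Oplus>i\<in>{..<m}. x i \<otimes> \<phi> (E (y i \<otimes> a))) = a"
begin

lemma E_closed [simp]: "a \<in> carrier A \<Longrightarrow> E a \<in> carrier B"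
  using regular_homD[OF E_hom] by auto

lemma E_add: "a \<in> carrier A \<Longrightarrow> b \<in> carrier A \<Longrightarrow> E (a \<oplus> b) = E a \<oplus>\<^bsub>B\<^esub> E b"
  using regular_homD[OF E_hom] by auto

lemma E_left: "b \<in> carrier B \<Longrightarrow> a \<in> carrier A \<Longrightarrow> E (\<phi> b \<otimes> a) = b \<otimes>\<^bsub>B\<^esub> E a"
  and E_right: "b \<in> carrier B \<Longrightarrow> a \<in> carrier A \<Longrightarrow> E (a \<otimes> \<phi> b) = E a \<otimes>\<^bsub>B\<^esub> b"
  using regular_homD[OF E_hom] by auto

lemma E_finsum:
  "finite I \<Longrightarrow> u \<in> I \<rightarrow> carrier A \<Longrightarrow> E (\<Oplus>i\<in>I. u i) = (\<Oplus>\<^bsub>B\<^esub>i\<in>I. E (u i))"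
  by (intro regular_hom_finsum[OF E_hom]) (auto intro: R.ring_axioms S.ring_axioms)

lemma x_in [simp]: "i < m \<Longrightarrow> x i \<in> carrier A" and y_in [simp]: "i < m \<Longrightarrow> y i \<in> carrier A"
  using x_closed y_closed by auto

lemma phi_closed [simp]: "b \<in> carrier B \<Longrightarrow> \<phi> b \<in> carrier A"
  using homh by (auto simp: ring_hom_def)

lemma phi_add: "b \<in> carrier B \<Longrightarrow> c \<in> carrier B \<Longrightarrow> \<phi> (b \<oplus>\<^bsub>B\<^esub> c) = \<phi> b \<oplus> \<phi> c"
  using homh by (auto simp: ring_hom_def)

lemma phi_finsum:
  "finite I \<Longrightarrow> u \<in> I \<rightarrow> carrier B \<Longrightarrow> \<phi> (\<Oplus>\<^bsub>B\<^esub>i\<in>I. u i) = (\<Oplus>i\<in>I. \<phi> (u i))"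
  by (rule additive_finsum) (auto intro: R.is_abelian_group S.is_abelian_group simp: hom_def phi_add)

end

section \<open>The basic construction\<close>

text \<open>The ring \<open>A'\<close> is a copy of the ring of right \<open>B\<close>-linear endomorphisms of \<open>A\<close>, given by its action
  on \<open>A\<close>. The elements of \<open>A'\<close> need not be functions, so that the renamed endomorphism rings
  of the Jones tower are covered as well.\<close>

locale basic_construction = frobenius_system B A \<phi> E m x y + T?: ring A'
  for B :: "('b, 'd) ring_scheme" and A :: "('a, 'c) ring_scheme" (structure) and \<phi>
    and E and m :: nat and x y and A' :: "('e, 'f) ring_scheme" +
  fixes \<phi>' act
  assumes act_closed [simp]: "f \<in> carrier A' \<Longrightarrow> a \<in> carrier A \<Longrightarrow> act f a \<in> carrier A"
    and act_add: "f \<in> carrier A' \<Longrightarrow> a \<in> carrier A \<Longrightarrow> b \<in> carrier A \<Longrightarrow>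
      act f (a \<oplus> b) = act f a \<oplus> act f b"
    and act_right: "f \<in> carrier A' \<Longrightarrow> a \<in> carrier A \<Longrightarrow> c \<in> carrier B \<Longrightarrow>
      act f (a \<otimes> \<phi> c) = act f a \<otimes> \<phi> c"
    and act_plus: "f \<in> carrier A' \<Longrightarrow> g \<in> carrier A' \<Longrightarrow> a \<in> carrier A \<Longrightarrow>
      act (f \<oplus>\<^bsub>A'\<^esub> g) a = act f a \<oplus> act g a"
    and act_mult: "f \<in> carrier A' \<Longrightarrow> g \<in> carrier A' \<Longrightarrow> a \<in> carrier A \<Longrightarrow>
      act (f \<otimes>\<^bsub>A'\<^esub> g) a = act f (act g a)"
    and act_one: "a \<in> carrier A \<Longrightarrow> act \<one>\<^bsub>A'\<^esub> a = a"
    and act_ext: "f \<in> carrier A' \<Longrightarrow> g \<in> carrier A' \<Longrightarrow>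
      (\<And>a. a \<in> carrier A \<Longrightarrow> act f a = act g a) \<Longrightarrow> f = g"
    and act_surj: "h \<in> carrier A \<rightarrow> carrier A \<Longrightarrow>
      (\<And>a b. a \<in> carrier A \<Longrightarrow> b \<in> carrier A \<Longrightarrow> h (a \<oplus> b) = h a \<oplus> h b) \<Longrightarrow>
      (\<And>a b. a \<in> carrier A \<Longrightarrow> b \<in> carrier B \<Longrightarrow> h (a \<otimes> \<phi> b) = h a \<otimes> \<phi> b) \<Longrightarrow>
      \<exists>f\<in>carrier A'. \<forall>a\<in>carrier A. act f a = h a"
    and phi'_closed [simp]: "a \<in> carrier A \<Longrightarrow> \<phi>' a \<in> carrier A'"
    and act_phi': "a \<in> carrier A \<Longrightarrow> b \<in> carrier A \<Longrightarrow> act (\<phi>' a) b = a \<otimes> b"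
begin

text \<open>The map \<open>\<phi> \<circ> E\<close>, seen as an endomorphism of \<open>A\<close>: the Jones idempotent, except that
  \<open>E\<close> is not assumed to send \<open>1\<close> to \<open>1\<close>, so that \<open>e\<close> need not be idempotent.\<close>

definition "e = (SOME f. f \<in> carrier A' \<and> (\<forall>a\<in>carrier A. act f a = \<phi> (E a)))"

text \<open>Under the isomorphism of \<open>A'\<close> with the tensor square of \<open>A\<close> over \<open>B\<close>, which sends \<open>a e b\<close> to
  \<open>a \<otimes> b\<close>, this is the multiplication map.\<close>

definition "E' f = (\<Oplus>i\<in>{..<m}. act f (x i) \<otimes> y i)"

lemma e_closed [simp]: "e \<in> carrier A'" and act_e: "a \<in> carrier A \<Longrightarrow> act e a = \<phi> (E a)"
proof -
  have "\<exists>f\<in>carrier A'. \<forall>a\<in>carrier A. act f a = \<phi> (E a)"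
    by (rule act_surj) (auto simp: E_add E_right phi_add)
  then have "\<exists>f. f \<in> carrier A' \<and> (\<forall>a\<in>carrier A. act f a = \<phi> (E a))"
    by blast
  from someI_ex[OF this]
  have "e \<in> carrier A' \<and> (\<forall>a\<in>carrier A. act e a = \<phi> (E a))"
    unfolding e_def .
  then show "e \<in> carrier A'" "a \<in> carrier A \<Longrightarrow> act e a = \<phi> (E a)"
    by auto
qed

lemma E'_closed [simp]: "f \<in> carrier A' \<Longrightarrow> E' f \<in> carrier A"
  unfolding E'_def by (auto intro!: S.finsum_closed)

lemma act_finsum_right:
  assumes "f \<in> carrier A'" "finite I" "u \<in> I \<rightarrow> carrier A"
  shows "act f (\<Oplus>i\<in>I. u i) = (\<Oplus>i\<in>I. act f (u i))"
  using assms
  by (intro additive_finsum) (auto intro: S.is_abelian_group simp: hom_def act_add)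

lemma act_finsum_left:
  assumes "a \<in> carrier A" "finite I" "u \<in> I \<rightarrow> carrier A'"
  shows "act (\<Oplus>\<^bsub>A'\<^esub>i\<in>I. u i) a = (\<Oplus>i\<in>I. act (u i) a)"
  using assms
  by (intro additive_finsum[where h = "\<lambda>f. act f a"])
    (auto intro: S.is_abelian_group T.is_abelian_group simp: hom_def act_plus)

lemma act_expand:
  assumes "f \<in> carrier A'" "a \<in> carrier A"
  shows "act f a = (\<Oplus>i\<in>{..<m}. act f (x i) \<otimes> \<phi> (E (y i \<otimes> a)))"
proof -
  have "act f a = act f (\<Oplus>i\<in>{..<m}. x i \<otimes> \<phi> (E (y i \<otimes> a)))"
    by (simp add: expand_x assms)
  also have "\<dots> = (\<Oplus>i\<in>{..<m}. act f (x i) \<otimes> \<phi> (E (y i \<otimes> a)))"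
    using assms by (subst act_finsum_right) (auto simp: act_right intro!: S.finsum_cong')
  finally show ?thesis .
qed

lemma phi'_hom: "ring_hom_ring A A' \<phi>'"
proof (intro ring_hom_ring.intro ring_hom_ring_axioms.intro S.ring_axioms T.ring_axioms)
  show "\<phi>' \<in> ring_hom A A'"
  proof (rule ring_hom_memI)
    fix a b assume ab: "a \<in> carrier A" "b \<in> carrier A"
    show "\<phi>' (a \<otimes> b) = \<phi>' a \<otimes>\<^bsub>A'\<^esub> \<phi>' b"
      by (rule act_ext) (simp_all add: ab act_phi' act_mult S.m_assoc)
    show "\<phi>' (a \<oplus> b) = \<phi>' a \<oplus>\<^bsub>A'\<^esub> \<phi>' b"
      by (rule act_ext) (simp_all add: ab act_phi' act_plus S.l_distr)
  next
    show "\<phi>' \<one> = \<one>\<^bsub>A'\<^esub>"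
      by (rule act_ext) (simp_all add: act_phi' act_one)
  qed simp
qed

lemma phi'_mult: "a \<in> carrier A \<Longrightarrow> b \<in> carrier A \<Longrightarrow> \<phi>' (a \<otimes> b) = \<phi>' a \<otimes>\<^bsub>A'\<^esub> \<phi>' b"
  by (rule ring_hom_mult[OF ring_hom_ring.homh[OF phi'_hom]])

lemma e_commutes: "b \<in> carrier B \<Longrightarrow> e \<otimes>\<^bsub>A'\<^esub> \<phi>' (\<phi> b) = \<phi>' (\<phi> b) \<otimes>\<^bsub>A'\<^esub> e"
  by (rule act_ext) (simp_all add: act_mult act_phi' act_e E_left)

lemma e_phi'_e: "a \<in> carrier A \<Longrightarrow> e \<otimes>\<^bsub>A'\<^esub> \<phi>' a \<otimes>\<^bsub>A'\<^esub> e = \<phi>' (\<phi> (E a)) \<otimes>\<^bsub>A'\<^esub> e"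
  by (rule act_ext) (simp_all add: act_mult act_phi' act_e E_right)

lemma E'_add: "f \<in> carrier A' \<Longrightarrow> g \<in> carrier A' \<Longrightarrow> E' (f \<oplus>\<^bsub>A'\<^esub> g) = E' f \<oplus> E' g"
proof -
  assume fg: "f \<in> carrier A'" "g \<in> carrier A'"
  have "E' (f \<oplus>\<^bsub>A'\<^esub> g) = (\<Oplus>i\<in>{..<m}. act f (x i) \<otimes> y i \<oplus> act g (x i) \<otimes> y i)"
    unfolding E'_def using fg by (intro S.finsum_cong') (auto simp: act_plus S.l_distr)
  also have "\<dots> = E' f \<oplus> E' g"
    unfolding E'_def using fg by (intro S.finsum_addf) auto
  finally show ?thesis .
qed

lemma E'_left: "a \<in> carrier A \<Longrightarrow> f \<in> carrier A' \<Longrightarrow> E' (\<phi>' a \<otimes>\<^bsub>A'\<^esub> f) = a \<otimes> E' f"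
  unfolding E'_def
  by (subst S.finsum_rdistr) (auto simp: act_mult act_phi' S.m_assoc intro!: S.finsum_cong')

text \<open>The value of \<open>E'\<close> is the image under multiplication of \<open>\<Sum> f(x\<^sub>i) \<otimes> y\<^sub>i\<close>, in which a
  factor \<open>a\<close> can be moved from the left of the \<open>x\<^sub>i\<close> to the right of the \<open>y\<^sub>i\<close>: expand \<open>a x\<^sub>i\<close> in
  terms of the \<open>x\<^sub>k\<close>, and collect the coefficients at the \<open>y\<^sub>i\<close>.\<close>

lemma E'_right:
  assumes a: "a \<in> carrier A" and f: "f \<in> carrier A'"
  shows "E' (f \<otimes>\<^bsub>A'\<^esub> \<phi>' a) = E' f \<otimes> a"
proof -
  let ?c = "\<lambda>i k. act f (x k) \<otimes> \<phi> (E (y k \<otimes> a \<otimes> x i)) \<otimes> y i"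
  have "E' (f \<otimes>\<^bsub>A'\<^esub> \<phi>' a) = (\<Oplus>i\<in>{..<m}. act f (a \<otimes> x i) \<otimes> y i)"
    unfolding E'_def using a f by (intro S.finsum_cong') (auto simp: act_mult act_phi')
  also have "\<dots> = (\<Oplus>i\<in>{..<m}. \<Oplus>k\<in>{..<m}. ?c i k)"
  proof (intro S.finsum_cong' refl)
    fix i assume i: "i \<in> {..<m}"
    have "act f (a \<otimes> x i) =
        (\<Oplus>k\<in>{..<m}. act f (x k) \<otimes> \<phi> (E (y k \<otimes> a \<otimes> x i)))"
      using a f i by (subst act_expand) (auto simp: S.m_assoc intro!: S.finsum_cong')
    also have "\<dots> \<otimes> y i = (\<Oplus>k\<in>{..<m}. ?c i k)"
      using a f i by (intro S.finsum_ldistr) auto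
    finally show "act f (a \<otimes> x i) \<otimes> y i = (\<Oplus>k\<in>{..<m}. ?c i k)" .
  qed (use a f in \<open>auto intro!: S.finsum_closed\<close>)
  also have "\<dots> = (\<Oplus>k\<in>{..<m}. \<Oplus>i\<in>{..<m}. ?c i k)"
    using a f by (intro S.finsum_swap) auto
  also have "\<dots> = (\<Oplus>k\<in>{..<m}. act f (x k) \<otimes> y k \<otimes> a)"
  proof (intro S.finsum_cong' refl)
    fix k assume k: "k \<in> {..<m}"
    have "(\<Oplus>i\<in>{..<m}. ?c i k) =
        act f (x k) \<otimes> (\<Oplus>i\<in>{..<m}. \<phi> (E (y k \<otimes> a \<otimes> x i)) \<otimes> y i)"
      using a f k by (subst S.finsum_rdistr) (auto simp: S.m_assoc intro!: S.finsum_cong')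
    also have "\<dots> = act f (x k) \<otimes> y k \<otimes> a"
      using a f k by (simp add: expand_y S.m_assoc)
    finally show "(\<Oplus>i\<in>{..<m}. ?c i k) = act f (x k) \<otimes> y k \<otimes> a" .
  qed (use a f in auto)
  also have "\<dots> = E' f \<otimes> a"
    unfolding E'_def using a f by (intro S.finsum_ldistr[symmetric]) auto
  finally show ?thesis .
qed

lemma E'_e: "E' e = \<one>"
proof -
  have "E' e = (\<Oplus>i\<in>{..<m}. \<phi> (E (\<one> \<otimes> x i)) \<otimes> y i)"
    unfolding E'_def by (intro S.finsum_cong') (auto simp: act_e)
  then show ?thesis using expand_y[OF S.one_closed] by simp
qed

lemma E'_e_phi'_e: "a \<in> carrier A \<Longrightarrow> E' (e \<otimes>\<^bsub>A'\<^esub> \<phi>' a \<otimes>\<^bsub>A'\<^esub> e) = \<phi> (E a)"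
  by (simp add: e_phi'_e E'_left E'_e)

text \<open>Multiplied by \<open>e\<close>, every element of \<open>A'\<close> agrees with an element of \<open>A\<close>: the endomorphism
  \<open>f e\<close> is \<open>E\<close> followed by left multiplication by \<open>f(1)\<close>.\<close>

lemma absorb_right:
  assumes f: "f \<in> carrier A'"
  shows "\<phi>' (E' (f \<otimes>\<^bsub>A'\<^esub> e)) \<otimes>\<^bsub>A'\<^esub> e = f \<otimes>\<^bsub>A'\<^esub> e"
proof (rule act_ext)
  fix a assume a: "a \<in> carrier A"
  have "act f (\<phi> (E b)) = act f \<one> \<otimes> \<phi> (E b)" if "b \<in> carrier A" for b
    using act_right[OF f S.one_closed, of "E b"] that by simp
  moreover have "(\<Oplus>i\<in>{..<m}. act f \<one> \<otimes> \<phi> (E (x i)) \<otimes> y i) =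
      act f \<one> \<otimes> (\<Oplus>i\<in>{..<m}. \<phi> (E (\<one> \<otimes> x i)) \<otimes> y i)"
    using f by (subst S.finsum_rdistr) (auto simp: S.m_assoc intro!: S.finsum_cong')
  moreover have "E' (f \<otimes>\<^bsub>A'\<^esub> e) = (\<Oplus>i\<in>{..<m}. act f (\<phi> (E (x i))) \<otimes> y i)"
    unfolding E'_def using f by (intro S.finsum_cong') (auto simp: act_e act_mult)
  moreover have "(\<Oplus>i\<in>{..<m}. act f (\<phi> (E (x i))) \<otimes> y i) =
      (\<Oplus>i\<in>{..<m}. act f \<one> \<otimes> \<phi> (E (x i)) \<otimes> y i)"
    using f calculation(1) by (intro S.finsum_cong') auto
  ultimately have "E' (f \<otimes>\<^bsub>A'\<^esub> e) = act f \<one>"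
    using f expand_y[OF S.one_closed] by simp
  then show "act (\<phi>' (E' (f \<otimes>\<^bsub>A'\<^esub> e)) \<otimes>\<^bsub>A'\<^esub> e) a = act (f \<otimes>\<^bsub>A'\<^esub> e) a"
    using a f act_right[OF f S.one_closed, of "E a"] by (simp add: act_mult act_phi' act_e)
qed (use f in auto)

lemma absorb_left:
  assumes f: "f \<in> carrier A'"
  shows "e \<otimes>\<^bsub>A'\<^esub> \<phi>' (E' (e \<otimes>\<^bsub>A'\<^esub> f)) = e \<otimes>\<^bsub>A'\<^esub> f"
proof (rule act_ext)
  fix a assume a: "a \<in> carrier A"
  have "E' (e \<otimes>\<^bsub>A'\<^esub> f) \<otimes> a = (\<Oplus>i\<in>{..<m}. \<phi> (E (act f (x i))) \<otimes> y i) \<otimes> a"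
    unfolding E'_def using f
    by (intro arg_cong[where f = "\<lambda>z. z \<otimes> a"] S.finsum_cong') (auto simp: act_e act_mult)
  also have "\<dots> = (\<Oplus>i\<in>{..<m}. \<phi> (E (act f (x i))) \<otimes> (y i \<otimes> a))"
    using f a by (subst S.finsum_ldistr) (auto simp: S.m_assoc intro!: S.finsum_cong')
  finally have "E (E' (e \<otimes>\<^bsub>A'\<^esub> f) \<otimes> a) =
      (\<Oplus>\<^bsub>B\<^esub>i\<in>{..<m}. E (act f (x i)) \<otimes>\<^bsub>B\<^esub> E (y i \<otimes> a))"
    using f a by (simp, subst E_finsum) (auto simp: E_left intro!: R.finsum_cong')
  also have "\<dots> = E (act f a)"
    using f a by (subst act_expand[of f a], simp_all, subst E_finsum)
      (auto simp: E_right intro!: R.finsum_cong')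
  finally show "act (e \<otimes>\<^bsub>A'\<^esub> \<phi>' (E' (e \<otimes>\<^bsub>A'\<^esub> f))) a = act (e \<otimes>\<^bsub>A'\<^esub> f) a"
    using f a by (simp add: act_mult act_e act_phi')
qed (use f in auto)

text \<open>Dual families for \<open>E\<close> write the identity endomorphism as an element of \<open>A e A\<close>.\<close>

lemma sum_e_eq_one:
  assumes "p \<in> {..<r::nat} \<rightarrow> carrier A" "q \<in> {..<r} \<rightarrow> carrier A"
    and "\<And>a. a \<in> carrier A \<Longrightarrow> (\<Oplus>i\<in>{..<r}. p i \<otimes> \<phi> (E (q i \<otimes> a))) = a"
  shows "(\<Oplus>\<^bsub>A'\<^esub>i\<in>{..<r}. \<phi>' (p i) \<otimes>\<^bsub>A'\<^esub> e \<otimes>\<^bsub>A'\<^esub> \<phi>' (q i)) = \<one>\<^bsub>A'\<^esub>"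
proof (rule act_ext)
  have pq: "p i \<in> carrier A" "q i \<in> carrier A" if "i < r" for i
    using assms(1,2) that by auto
  then show cl: "(\<Oplus>\<^bsub>A'\<^esub>i\<in>{..<r}. \<phi>' (p i) \<otimes>\<^bsub>A'\<^esub> e \<otimes>\<^bsub>A'\<^esub> \<phi>' (q i)) \<in> carrier A'"
    by (auto intro!: T.finsum_closed)
  fix a assume a: "a \<in> carrier A"
  have "act (\<Oplus>\<^bsub>A'\<^esub>i\<in>{..<r}. \<phi>' (p i) \<otimes>\<^bsub>A'\<^esub> e \<otimes>\<^bsub>A'\<^esub> \<phi>' (q i)) a =
      (\<Oplus>i\<in>{..<r}. p i \<otimes> \<phi> (E (q i \<otimes> a)))"
    using a pq by (subst act_finsum_left)
      (auto simp: act_mult act_phi' act_e intro!: S.finsum_cong')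
  then show "act (\<Oplus>\<^bsub>A'\<^esub>i\<in>{..<r}. \<phi>' (p i) \<otimes>\<^bsub>A'\<^esub> e \<otimes>\<^bsub>A'\<^esub> \<phi>' (q i)) a = act \<one>\<^bsub>A'\<^esub> a"
    using assms(3) a by (simp add: act_one)
qed auto

text \<open>Dual families for \<open>E\<close> yield dual families for \<open>E'\<close>: split the unit with \<open>sum_e_eq_one\<close> and absorb
  \<open>f\<close> into one of the factors. Besides the dual bases of \<open>A | B\<close>, this is applied to the families
  \<open>x\<^sub>i w\<close> and \<open>v y\<^sub>i\<close> of a ladder.\<close>

lemma expand_through_e:
  assumes pq: "p \<in> {..<r::nat} \<rightarrow> carrier A" "q \<in> {..<r} \<rightarrow> carrier A"
    and one: "\<And>a. a \<in> carrier A \<Longrightarrow> (\<Oplus>i\<in>{..<r}. p i \<otimes> \<phi> (E (q i \<otimes> a))) = a"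
    and f: "f \<in> carrier A'"
  shows "(\<Oplus>\<^bsub>A'\<^esub>i\<in>{..<r}. \<phi>' (p i) \<otimes>\<^bsub>A'\<^esub> e \<otimes>\<^bsub>A'\<^esub> \<phi>' (E' (e \<otimes>\<^bsub>A'\<^esub> \<phi>' (q i) \<otimes>\<^bsub>A'\<^esub> f))) = f"
    and "(\<Oplus>\<^bsub>A'\<^esub>i\<in>{..<r}. \<phi>' (E' (f \<otimes>\<^bsub>A'\<^esub> (\<phi>' (p i) \<otimes>\<^bsub>A'\<^esub> e))) \<otimes>\<^bsub>A'\<^esub> (e \<otimes>\<^bsub>A'\<^esub> \<phi>' (q i))) = f"
proof -
  let ?s = "\<lambda>i. \<phi>' (p i) \<otimes>\<^bsub>A'\<^esub> e \<otimes>\<^bsub>A'\<^esub> \<phi>' (q i)"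
  have c: "p i \<in> carrier A" "q i \<in> carrier A" if "i < r" for i
    using pq that by auto
  have "(\<Oplus>\<^bsub>A'\<^esub>i\<in>{..<r}. \<phi>' (p i) \<otimes>\<^bsub>A'\<^esub> e \<otimes>\<^bsub>A'\<^esub> \<phi>' (E' (e \<otimes>\<^bsub>A'\<^esub> \<phi>' (q i) \<otimes>\<^bsub>A'\<^esub> f))) =
      (\<Oplus>\<^bsub>A'\<^esub>i\<in>{..<r}. ?s i \<otimes>\<^bsub>A'\<^esub> f)"
  proof (intro T.finsum_cong' refl)
    fix i assume "i \<in> {..<r}"
    then show "\<phi>' (p i) \<otimes>\<^bsub>A'\<^esub> e \<otimes>\<^bsub>A'\<^esub> \<phi>' (E' (e \<otimes>\<^bsub>A'\<^esub> \<phi>' (q i) \<otimes>\<^bsub>A'\<^esub> f)) = ?s i \<otimes>\<^bsub>A'\<^esub> f"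
      using absorb_left[of "\<phi>' (q i) \<otimes>\<^bsub>A'\<^esub> f"] c f by (simp add: T.m_assoc)
  qed (use c f in auto)
  also have "\<dots> = (\<Oplus>\<^bsub>A'\<^esub>i\<in>{..<r}. ?s i) \<otimes>\<^bsub>A'\<^esub> f"
    using c f by (intro T.finsum_ldistr[symmetric]) auto
  finally show "(\<Oplus>\<^bsub>A'\<^esub>i\<in>{..<r}. \<phi>' (p i) \<otimes>\<^bsub>A'\<^esub> e \<otimes>\<^bsub>A'\<^esub> \<phi>' (E' (e \<otimes>\<^bsub>A'\<^esub> \<phi>' (q i) \<otimes>\<^bsub>A'\<^esub> f))) = f"
    using sum_e_eq_one[OF pq one] f by simp
  have "(\<Oplus>\<^bsub>A'\<^esub>i\<in>{..<r}. \<phi>' (E' (f \<otimes>\<^bsub>A'\<^esub> (\<phi>' (p i) \<otimes>\<^bsub>A'\<^esub> e))) \<otimes>\<^bsub>A'\<^esub> (e \<otimes>\<^bsub>A'\<^esub> \<phi>' (q i))) =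
      (\<Oplus>\<^bsub>A'\<^esub>i\<in>{..<r}. f \<otimes>\<^bsub>A'\<^esub> ?s i)"
  proof (intro T.finsum_cong' refl)
    fix i assume "i \<in> {..<r}"
    then show "\<phi>' (E' (f \<otimes>\<^bsub>A'\<^esub> (\<phi>' (p i) \<otimes>\<^bsub>A'\<^esub> e))) \<otimes>\<^bsub>A'\<^esub> (e \<otimes>\<^bsub>A'\<^esub> \<phi>' (q i)) = f \<otimes>\<^bsub>A'\<^esub> ?s i"
      using absorb_right[of "f \<otimes>\<^bsub>A'\<^esub> \<phi>' (p i)"] c f
        T.m_assoc[of "\<phi>' (E' (f \<otimes>\<^bsub>A'\<^esub> (\<phi>' (p i) \<otimes>\<^bsub>A'\<^esub> e)))" e "\<phi>' (q i)"]
      by (simp add: T.m_assoc)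
  qed (use c f in auto)
  also have "\<dots> = f \<otimes>\<^bsub>A'\<^esub> (\<Oplus>\<^bsub>A'\<^esub>i\<in>{..<r}. ?s i)"
    using c f by (intro T.finsum_rdistr[symmetric]) auto
  finally show "(\<Oplus>\<^bsub>A'\<^esub>i\<in>{..<r}. \<phi>' (E' (f \<otimes>\<^bsub>A'\<^esub> (\<phi>' (p i) \<otimes>\<^bsub>A'\<^esub> e))) \<otimes>\<^bsub>A'\<^esub> (e \<otimes>\<^bsub>A'\<^esub> \<phi>' (q i))) = f"
    using sum_e_eq_one[OF pq one] f by simp
qed

theorem frobenius_up:
  "frobenius_system A A' \<phi>' E' m (\<lambda>i. \<phi>' (x i) \<otimes>\<^bsub>A'\<^esub> e) (\<lambda>i. e \<otimes>\<^bsub>A'\<^esub> \<phi>' (y i))"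
proof (intro frobenius_system.intro frobenius_system_axioms.intro phi'_hom)
  show "E' \<in> regular_hom A A A' \<phi>' \<phi>' A id id"
    by (rule regular_homI) (auto simp: E'_add E'_left E'_right)
  fix f assume f: "f \<in> carrier A'"
  show "(\<Oplus>\<^bsub>A'\<^esub>i\<in>{..<m}. \<phi>' (E' (f \<otimes>\<^bsub>A'\<^esub> (\<phi>' (x i) \<otimes>\<^bsub>A'\<^esub> e))) \<otimes>\<^bsub>A'\<^esub> (e \<otimes>\<^bsub>A'\<^esub> \<phi>' (y i))) = f"
    by (rule expand_through_e(2)) (auto simp: expand_x f)
  show "(\<Oplus>\<^bsub>A'\<^esub>i\<in>{..<m}. \<phi>' (x i) \<otimes>\<^bsub>A'\<^esub> e \<otimes>\<^bsub>A'\<^esub> \<phi>' (E' (e \<otimes>\<^bsub>A'\<^esub> \<phi>' (y i) \<otimes>\<^bsub>A'\<^esub> f))) = f"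
    by (rule expand_through_e(1)) (auto simp: expand_x f)
qed auto

end

section \<open>Endomorphism rings\<close>

lemma (in ring_hom_ring) right_End_memD:
  assumes "g \<in> carrier (right_End R S h)"
  shows "x \<in> carrier S \<Longrightarrow> g x \<in> carrier S"
    and "x \<in> carrier S \<Longrightarrow> y \<in> carrier S \<Longrightarrow> g (x \<oplus>\<^bsub>S\<^esub> y) = g x \<oplus>\<^bsub>S\<^esub> g y"
    and "x \<in> carrier S \<Longrightarrow> a \<in> carrier R \<Longrightarrow> g (x \<otimes>\<^bsub>S\<^esub> h a) = g x \<otimes>\<^bsub>S\<^esub> h a"
    and "g \<in> extensional (carrier S)"
  using assms by (auto simp: right_End_def PiE_def)

lemma (in ring_hom_ring) right_End_memI:
  assumes "\<And>x. x \<in> carrier S \<Longrightarrow> g x \<in> carrier S"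
    and "\<And>x y. x \<in> carrier S \<Longrightarrow> y \<in> carrier S \<Longrightarrow> g (x \<oplus>\<^bsub>S\<^esub> y) = g x \<oplus>\<^bsub>S\<^esub> g y"
    and "\<And>x a. x \<in> carrier S \<Longrightarrow> a \<in> carrier R \<Longrightarrow> g (x \<otimes>\<^bsub>S\<^esub> h a) = g x \<otimes>\<^bsub>S\<^esub> h a"
    and "g \<in> extensional (carrier S)"
  shows "g \<in> carrier (right_End R S h)"
  using assms by (auto simp: right_End_def PiE_def)

lemma (in ring_hom_ring) right_End_ring: "ring (right_End R S h)"
proof (rule ringI)
  let ?T = "right_End R S h"
  note D = right_End_memD
  have hc: "a \<in> carrier R \<Longrightarrow> h a \<in> carrier S" for a by (rule hom_closed)
  have add: "f \<oplus>\<^bsub>?T\<^esub> g = (\<lambda>x\<in>carrier S. f x \<oplus>\<^bsub>S\<^esub> g x)" for f g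
    by (simp add: right_End_def)
  have mult: "f \<otimes>\<^bsub>?T\<^esub> g = (\<lambda>x\<in>carrier S. f (g x))" for f g
    by (simp add: right_End_def compose_def)
  have zero: "\<zero>\<^bsub>?T\<^esub> = (\<lambda>x\<in>carrier S. \<zero>\<^bsub>S\<^esub>)" and one: "\<one>\<^bsub>?T\<^esub> = (\<lambda>x\<in>carrier S. x)"
    by (simp_all add: right_End_def)
  have eqI: "f = g" if "f \<in> extensional (carrier S)" "g \<in> extensional (carrier S)"
    "\<And>x. x \<in> carrier S \<Longrightarrow> f x = g x" for f g :: "'c \<Rightarrow> 'c"
    using that by (rule extensionalityI)
  have add_closed: "f \<oplus>\<^bsub>?T\<^esub> g \<in> carrier ?T" if "f \<in> carrier ?T" "g \<in> carrier ?T" for f g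
    unfolding add using D[OF that(1)] D[OF that(2)] hc
    by (intro right_End_memI) (auto simp: S.l_distr S.a_ac)
  have zero_closed: "\<zero>\<^bsub>?T\<^esub> \<in> carrier ?T"
    unfolding zero using hc by (intro right_End_memI) auto
  have neg_closed: "(\<lambda>x\<in>carrier S. \<ominus>\<^bsub>S\<^esub> f x) \<in> carrier ?T" if "f \<in> carrier ?T" for f
    using D[OF that] hc by (intro right_End_memI) (auto simp: S.minus_add S.l_minus)
  have neg: "(\<lambda>x\<in>carrier S. \<ominus>\<^bsub>S\<^esub> f x) \<oplus>\<^bsub>?T\<^esub> f = \<zero>\<^bsub>?T\<^esub>" if "f \<in> carrier ?T" for f
    unfolding add zero by (rule eqI) (use D[OF that] in \<open>auto simp: S.l_neg\<close>)
  have ext: "f \<in> extensional (carrier S)" if "f \<in> carrier ?T" for f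
    using D(4)[OF that] .
  show "abelian_group ?T"
  proof (rule abelian_groupI)
    fix f g k
    assume f: "f \<in> carrier ?T" and g: "g \<in> carrier ?T"
    show "f \<oplus>\<^bsub>?T\<^esub> g \<in> carrier ?T" using add_closed[OF f g] .
    show "f \<oplus>\<^bsub>?T\<^esub> g = g \<oplus>\<^bsub>?T\<^esub> f"
      unfolding add by (rule eqI) (use D(1)[OF f] D(1)[OF g] in \<open>auto simp: S.a_comm\<close>)
    assume k: "k \<in> carrier ?T"
    show "f \<oplus>\<^bsub>?T\<^esub> g \<oplus>\<^bsub>?T\<^esub> k = f \<oplus>\<^bsub>?T\<^esub> (g \<oplus>\<^bsub>?T\<^esub> k)"
      unfolding add by (rule eqI) (use D(1)[OF f] D(1)[OF g] D(1)[OF k] in \<open>auto simp: S.a_assoc\<close>)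
  next
    fix f assume f: "f \<in> carrier ?T"
    show "\<zero>\<^bsub>?T\<^esub> \<oplus>\<^bsub>?T\<^esub> f = f"
      unfolding add zero by (rule eqI) (use D(1)[OF f] ext[OF f] in auto)
    show "\<exists>g\<in>carrier ?T. g \<oplus>\<^bsub>?T\<^esub> f = \<zero>\<^bsub>?T\<^esub>"
      using neg_closed[OF f] neg[OF f] by blast
  qed (rule zero_closed)
  show "monoid ?T"
  proof (rule monoidI)
    fix f g k
    assume f: "f \<in> carrier ?T" and g: "g \<in> carrier ?T"
    show "f \<otimes>\<^bsub>?T\<^esub> g \<in> carrier ?T"
      unfolding mult using D[OF f] D[OF g] hc by (intro right_End_memI) auto
    assume k: "k \<in> carrier ?T"
    show "f \<otimes>\<^bsub>?T\<^esub> g \<otimes>\<^bsub>?T\<^esub> k = f \<otimes>\<^bsub>?T\<^esub> (g \<otimes>\<^bsub>?T\<^esub> k)"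
      unfolding mult by (rule eqI) (use D(1)[OF f] D(1)[OF g] D(1)[OF k] in auto)
  next
    show "\<one>\<^bsub>?T\<^esub> \<in> carrier ?T"
      unfolding one using hc by (intro right_End_memI) auto
  next
    fix f assume f: "f \<in> carrier ?T"
    show "\<one>\<^bsub>?T\<^esub> \<otimes>\<^bsub>?T\<^esub> f = f" "f \<otimes>\<^bsub>?T\<^esub> \<one>\<^bsub>?T\<^esub> = f"
      unfolding mult one by (rule eqI; use D(1)[OF f] ext[OF f] in auto)+
  qed
  fix f g k
  assume f: "f \<in> carrier ?T" and g: "g \<in> carrier ?T" and k: "k \<in> carrier ?T"
  show "(f \<oplus>\<^bsub>?T\<^esub> g) \<otimes>\<^bsub>?T\<^esub> k = f \<otimes>\<^bsub>?T\<^esub> k \<oplus>\<^bsub>?T\<^esub> g \<otimes>\<^bsub>?T\<^esub> k"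
    unfolding add mult by (rule eqI) (use D(1)[OF k] in auto)
  show "k \<otimes>\<^bsub>?T\<^esub> (f \<oplus>\<^bsub>?T\<^esub> g) = k \<otimes>\<^bsub>?T\<^esub> f \<oplus>\<^bsub>?T\<^esub> k \<otimes>\<^bsub>?T\<^esub> g"
    unfolding add mult by (rule eqI) (use D(1)[OF f] D(1)[OF g] D(2)[OF k] in auto)
qed

text \<open>Any injective renaming of the endomorphism ring is allowed, since the inverse of the renaming
  restores the action.\<close>

theorem (in frobenius_system) basic_construction_right_End:
  assumes c: "inj_on c (carrier (right_End B A \<phi>))"
  shows "basic_construction B A \<phi> E m x y (image_ring c (right_End B A \<phi>))
    (\<lambda>a. c (left_regular A a)) (inv_into (carrier (right_End B A \<phi>)) c)"
proof -
  let ?R = "right_End B A \<phi>" let ?I = "image_ring c (right_End B A \<phi>)" let ?d = "inv_into (carrier ?R) c"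
  interpret End: ring ?R by (rule right_End_ring)
  have iso: "c \<in> ring_iso ?R ?I" by (rule inj_imp_image_ring_iso[OF c])
  have d: "?d \<in> ring_iso ?I ?R"
    by (rule ring_iso_set_sym[OF End.ring_axioms iso])
  have dc: "?d (c f) = f" if "f \<in> carrier ?R" for f
    using c that by (rule inv_into_f_f)
  note dE = ring_iso_memE[OF d]
  note D = right_End_memD
  have dinj: "f = g" if "f \<in> carrier ?I" "g \<in> carrier ?I" "?d f = ?d g" for f g
    using that by (auto simp: image_ring_carrier dc)
  have add: "f \<oplus>\<^bsub>?R\<^esub> g = (\<lambda>x\<in>carrier A. f x \<oplus> g x)"
    and mult: "f \<otimes>\<^bsub>?R\<^esub> g = (\<lambda>x\<in>carrier A. f (g x))"
    and one: "\<one>\<^bsub>?R\<^esub> = (\<lambda>x\<in>carrier A. x)" for f g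
    by (simp_all add: right_End_def compose_def)
  have lr: "left_regular A a \<in> carrier ?R" if "a \<in> carrier A" for a
    unfolding left_regular_def using that
    by (intro right_End_memI) (auto simp: S.r_distr S.m_assoc)
  show ?thesis
  proof (intro basic_construction.intro basic_construction_axioms.intro frobenius_system_axioms
      End.inj_imp_image_ring_is_ring c)
    fix f g a assume f: "f \<in> carrier ?I" and g: "g \<in> carrier ?I"
    show "(\<And>a. a \<in> carrier A \<Longrightarrow> ?d f a = ?d g a) \<Longrightarrow> f = g"
      by (rule dinj[OF f g], rule extensionalityI[of _ "carrier A"])
        (use D(4)[OF dE(1)[OF f]] D(4)[OF dE(1)[OF g]] in auto)
    assume a: "a \<in> carrier A"
    show "?d (f \<oplus>\<^bsub>?I\<^esub> g) a = ?d f a \<oplus> ?d g a"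
      using a by (simp add: dE(3)[OF f g] add)
    show "?d (f \<otimes>\<^bsub>?I\<^esub> g) a = ?d f (?d g a)"
      using a by (simp add: dE(2)[OF f g] mult)
  next
    fix f a assume f: "f \<in> carrier ?I" and a: "a \<in> carrier A"
    show "?d f a \<in> carrier A" using D(1)[OF dE(1)[OF f] a] .
    fix b assume b: "b \<in> carrier A"
    show "?d f (a \<oplus> b) = ?d f a \<oplus> ?d f b" using D(2)[OF dE(1)[OF f] a b] .
  next
    fix f a b assume f: "f \<in> carrier ?I" and a: "a \<in> carrier A" and b: "b \<in> carrier B"
    show "?d f (a \<otimes> \<phi> b) = ?d f a \<otimes> \<phi> b" using D(3)[OF dE(1)[OF f] a b] .
  next
    fix a assume "a \<in> carrier A"
    then show "?d \<one>\<^bsub>?I\<^esub> a = a" by (simp add: dE(4) one)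
  next
    fix h
    assume h: "h \<in> carrier A \<rightarrow> carrier A"
      "\<And>a b. a \<in> carrier A \<Longrightarrow> b \<in> carrier A \<Longrightarrow> h (a \<oplus> b) = h a \<oplus> h b"
      "\<And>a b. a \<in> carrier A \<Longrightarrow> b \<in> carrier B \<Longrightarrow> h (a \<otimes> \<phi> b) = h a \<otimes> \<phi> b"
    have "restrict h (carrier A) \<in> carrier ?R"
      using h by (intro right_End_memI) auto
    then show "\<exists>f\<in>carrier ?I. \<forall>a\<in>carrier A. ?d f a = h a"
      by (intro bexI[of _ "c (restrict h (carrier A))"]) (auto simp: dc image_ring_carrier)
  next
    fix a assume a: "a \<in> carrier A"
    show "c (left_regular A a) \<in> carrier ?I"
      using lr[OF a] by (simp add: image_ring_carrier)
    fix b assume "b \<in> carrier A"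
    then show "?d (c (left_regular A a)) b = a \<otimes> b"
      using lr[OF a] by (simp add: dc left_regular_def)
  qed
qed

section \<open>Opposite rings\<close>

definition op_ring :: "('a, 'c) ring_scheme \<Rightarrow> 'a ring" where
  "op_ring A = \<lparr>carrier = carrier A, monoid.mult = (\<lambda>x y. y \<otimes>\<^bsub>A\<^esub> x), one = \<one>\<^bsub>A\<^esub>,
    zero = \<zero>\<^bsub>A\<^esub>, add = add A\<rparr>"

lemma op_ring_simps [simp]:
  "carrier (op_ring A) = carrier A" "x \<otimes>\<^bsub>op_ring A\<^esub> y = y \<otimes>\<^bsub>A\<^esub> x" "\<one>\<^bsub>op_ring A\<^esub> = \<one>\<^bsub>A\<^esub>"
  "\<zero>\<^bsub>op_ring A\<^esub> = \<zero>\<^bsub>A\<^esub>" "add (op_ring A) = add A"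
  by (simp_all add: op_ring_def)

lemma finsum_op_ring [simp]: "finsum (op_ring A) = finsum A"
  by (simp add: finsum_def finprod_def fun_eq_iff)

lemma ring_op_ring: "ring A \<Longrightarrow> ring (op_ring A)"
proof -
  assume "ring A"
  then interpret ring A .
  have "abelian_group (op_ring A)"
    by (rule abelian_groupI) (auto simp: a_ac intro: bexI[of _ "\<ominus>\<^bsub>A\<^esub> _"] l_neg)
  moreover have "monoid (op_ring A)"
    by (rule monoidI) (auto simp: m_assoc)
  ultimately show ?thesis
    by (rule ringI) (auto simp: l_distr r_distr)
qed

lemma ring_hom_op_ring: "ring_hom_ring B A \<beta> \<Longrightarrow> ring_hom_ring (op_ring B) (op_ring A) \<beta>"
  by (auto simp: ring_hom_ring_def ring_hom_ring_axioms_def ring_op_ring ring_hom_def)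

lemma regular_hom_op_ring:
  "regular_hom (op_ring L) (op_ring R) (op_ring A) p q (op_ring D) p' q' =
    regular_hom R L A q p D q' p'"
  by (auto simp: bimodule_hom_def regular_bimodule_def hom_def)

lemma (in frobenius_system) frobenius_op_ring:
  "frobenius_system (op_ring B) (op_ring A) \<phi> E m y x"
proof (intro frobenius_system.intro frobenius_system_axioms.intro ring_hom_op_ring)
  show "ring_hom_ring B A \<phi>" by (rule is_ring_hom_ring)
qed (use E_hom x_closed y_closed expand_x expand_y in \<open>auto simp: regular_hom_op_ring\<close>)

section \<open>Composition and transport of Frobenius systems\<close>

text \<open>The coefficients along the dual bases of \<open>A | B\<close> are expanded in turn along
  those of \<open>B | C\<close>.\<close>

lemma frobenius_comp_expand:
  fixes A :: "('a, 'c) ring_scheme" (structure)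
  assumes "frobenius_system B A \<phi> E m x y" and "frobenius_system C B \<psi> F l u w" and a: "a \<in> carrier A"
  shows "(\<Oplus>k\<in>{..<m * l}. (\<phi> \<circ> \<psi>) ((F \<circ> E) (a \<otimes> (x (k div l) \<otimes> \<phi> (u (k mod l))))) \<otimes>
    (\<phi> (w (k mod l)) \<otimes> y (k div l))) = a"
proof -
  interpret E: frobenius_system B A \<phi> E m x y by fact
  interpret F: frobenius_system C B \<psi> F l u w by fact
  have "(\<Oplus>k\<in>{..<m * l}. (\<phi> \<circ> \<psi>) ((F \<circ> E) (a \<otimes> (x (k div l) \<otimes> \<phi> (u (k mod l))))) \<otimes>
        (\<phi> (w (k mod l)) \<otimes> y (k div l))) =
      (\<Oplus>i\<in>{..<m}. \<Oplus>j\<in>{..<l}. (\<phi> \<circ> \<psi>) ((F \<circ> E) (a \<otimes> (x i \<otimes> \<phi> (u j)))) \<otimes>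
        (\<phi> (w j) \<otimes> y i))"
    using a by (intro E.S.finsum_div_mod) auto
  also have "\<dots> = (\<Oplus>i\<in>{..<m}. \<phi> (E (a \<otimes> x i)) \<otimes> y i)"
  proof (intro E.S.finsum_cong' refl)
    fix i assume i: "i \<in> {..<m}"
    have E_pull: "E (a \<otimes> (x i \<otimes> \<phi> b)) = E (a \<otimes> x i) \<otimes>\<^bsub>B\<^esub> b"
      if "b \<in> carrier B" for b
      using a i that by (subst E.S.m_assoc[symmetric]) (simp_all add: E.E_right)
    have "(\<Oplus>j\<in>{..<l}. (\<phi> \<circ> \<psi>) ((F \<circ> E) (a \<otimes> (x i \<otimes> \<phi> (u j)))) \<otimes> (\<phi> (w j) \<otimes> y i)) =
        (\<Oplus>j\<in>{..<l}. \<phi> (\<psi> (F (E (a \<otimes> x i) \<otimes>\<^bsub>B\<^esub> u j)) \<otimes>\<^bsub>B\<^esub> w j) \<otimes> y i)"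
      using a i by (intro E.S.finsum_cong')
        (auto simp: E.S.m_assoc E_pull)
    also have "\<dots> = (\<Oplus>j\<in>{..<l}. \<phi> (\<psi> (F (E (a \<otimes> x i) \<otimes>\<^bsub>B\<^esub> u j)) \<otimes>\<^bsub>B\<^esub> w j)) \<otimes> y i"
      using a i by (intro E.S.finsum_ldistr[symmetric]) auto
    also have "(\<Oplus>j\<in>{..<l}. \<phi> (\<psi> (F (E (a \<otimes> x i) \<otimes>\<^bsub>B\<^esub> u j)) \<otimes>\<^bsub>B\<^esub> w j)) =
        \<phi> (\<Oplus>\<^bsub>B\<^esub>j\<in>{..<l}. \<psi> (F (E (a \<otimes> x i) \<otimes>\<^bsub>B\<^esub> u j)) \<otimes>\<^bsub>B\<^esub> w j)"
      using a i by (intro E.phi_finsum[symmetric]) auto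
    also have "\<dots> = \<phi> (E (a \<otimes> x i))"
      using a i by (simp add: F.expand_y)
    finally show "(\<Oplus>j\<in>{..<l}. (\<phi> \<circ> \<psi>) ((F \<circ> E) (a \<otimes> (x i \<otimes> \<phi> (u j)))) \<otimes> (\<phi> (w j) \<otimes> y i)) =
        \<phi> (E (a \<otimes> x i)) \<otimes> y i" .
  qed (use a in auto)
  also have "\<dots> = a" using a by (rule E.expand_y)
  finally show ?thesis .
qed

lemma frobenius_comp:
  fixes A :: "('a, 'c) ring_scheme" (structure)
  assumes "frobenius_system B A \<phi> E m x y" and "frobenius_system C B \<psi> F l u w"
  shows "frobenius_system C A (\<phi> \<circ> \<psi>) (F \<circ> E) (m * l)
    (\<lambda>k. x (k div l) \<otimes> \<phi> (u (k mod l))) (\<lambda>k. \<phi> (w (k mod l)) \<otimes> y (k div l))"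
proof -
  interpret E: frobenius_system B A \<phi> E m x y by fact
  interpret F: frobenius_system C B \<psi> F l u w by fact
  have kl: "k div l < m" "k mod l < l" if "k < m * l" for k
    using that by (auto simp: less_mult_imp_div_less) (metis less_nat_zero_code mod_less_divisor mult_is_0 neq0_conv)
  show ?thesis
  proof (intro frobenius_system.intro frobenius_system_axioms.intro)
    show "ring_hom_ring C A (\<phi> \<circ> \<psi>)"
      using E.homh F.homh
      by (intro ring_hom_ring.intro ring_hom_ring_axioms.intro F.R.ring_axioms E.S.ring_axioms ring_hom_trans)
    show "F \<circ> E \<in> regular_hom C C A (\<phi> \<circ> \<psi>) (\<phi> \<circ> \<psi>) C id id"
      by (rule regular_homI)
        (simp_all add: E.E_add F.E_add E.E_left F.E_left E.E_right F.E_right)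
    show "(\<lambda>k. x (k div l) \<otimes> \<phi> (u (k mod l))) \<in> {..<m * l} \<rightarrow> carrier A"
      "(\<lambda>k. \<phi> (w (k mod l)) \<otimes> y (k div l)) \<in> {..<m * l} \<rightarrow> carrier A"
      using kl by auto
    fix a assume a: "a \<in> carrier A"
    show "(\<Oplus>k\<in>{..<m * l}. (\<phi> \<circ> \<psi>) ((F \<circ> E) (a \<otimes> (x (k div l) \<otimes> \<phi> (u (k mod l))))) \<otimes>
    (\<phi> (w (k mod l)) \<otimes> y (k div l))) = a"
      using assms a by (rule frobenius_comp_expand)
    show "(\<Oplus>k\<in>{..<m * l}. x (k div l) \<otimes> \<phi> (u (k mod l)) \<otimes>
        (\<phi> \<circ> \<psi>) ((F \<circ> E) (\<phi> (w (k mod l)) \<otimes> y (k div l) \<otimes> a))) = a"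
      using frobenius_comp_expand[OF E.frobenius_op_ring F.frobenius_op_ring] a by simp
  qed
qed

lemma (in frobenius_system) frobenius_transport:
  assumes "ring B'" "ring A'" and g: "g \<in> ring_iso B B'" and h: "h \<in> ring_iso A A'"
    and \<phi>': "\<And>b. b \<in> carrier B \<Longrightarrow> \<phi>' (g b) = h (\<phi> b)"
  shows "frobenius_system B' A' \<phi>' (\<lambda>a. g (E (inv_into (carrier A) h a))) m (h \<circ> x) (h \<circ> y)"
proof -
  interpret B': ring B' by fact
  interpret A': ring A' by fact
  let ?k = "inv_into (carrier A) h"
  have k: "?k \<in> ring_iso A' A" by (rule ring_iso_set_sym[OF S.ring_axioms h])
  note G = ring_iso_memE[OF g] and H = ring_iso_memE[OF h] and K = ring_iso_memE[OF k]
  have kh: "?k (h a) = a" if "a \<in> carrier A" for a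
    using inv_into_f_f[of h "carrier A"] h that by (auto simp: ring_iso_def bij_betw_def)
  have B': "carrier B' = g ` carrier B" and A': "carrier A' = h ` carrier A"
    using g h by (auto simp: ring_iso_def bij_betw_def)
  have hsum: "h (\<Oplus>i\<in>{..<m}. u i) = (\<Oplus>\<^bsub>A'\<^esub>i\<in>{..<m}. h (u i))"
    if "u \<in> {..<m} \<rightarrow> carrier A" for u
    using that by (intro additive_finsum) (auto intro: S.is_abelian_group A'.is_abelian_group simp: hom_def H)
  show ?thesis
  proof (intro frobenius_system.intro frobenius_system_axioms.intro)
    show "ring_hom_ring B' A' \<phi>'"
    proof (intro ring_hom_ring.intro ring_hom_ring_axioms.intro B'.ring_axioms A'.ring_axioms ring_hom_memI)
      fix b c assume "b \<in> carrier B'" "c \<in> carrier B'"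
      then obtain b' c' where "b' \<in> carrier B" "b = g b'" "c' \<in> carrier B" "c = g c'"
        using B' by auto
      then show "\<phi>' b \<in> carrier A'" "\<phi>' (b \<otimes>\<^bsub>B'\<^esub> c) = \<phi>' b \<otimes>\<^bsub>A'\<^esub> \<phi>' c"
        "\<phi>' (b \<oplus>\<^bsub>B'\<^esub> c) = \<phi>' b \<oplus>\<^bsub>A'\<^esub> \<phi>' c"
        using G(2)[of b' c', symmetric] G(3)[of b' c', symmetric]
        by (simp_all add: \<phi>' H phi_add)
    next
      show "\<phi>' \<one>\<^bsub>B'\<^esub> = \<one>\<^bsub>A'\<^esub>"
        using \<phi>'[of "\<one>\<^bsub>B\<^esub>"] by (simp add: G H)
    qed
    show "(\<lambda>a. g (E (?k a))) \<in> regular_hom B' B' A' \<phi>' \<phi>' B' id id"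
    proof (rule regular_homI)
      fix b a assume "b \<in> carrier B'" and a: "a \<in> carrier A'"
      then obtain b' where "b' \<in> carrier B" "b = g b'" using B' by auto
      then show "g (E (?k (\<phi>' b \<otimes>\<^bsub>A'\<^esub> a))) = id b \<otimes>\<^bsub>B'\<^esub> g (E (?k a))"
        "g (E (?k (a \<otimes>\<^bsub>A'\<^esub> \<phi>' b))) = g (E (?k a)) \<otimes>\<^bsub>B'\<^esub> id b"
        using a by (simp_all add: \<phi>' K H kh E_left E_right G)
    qed (simp_all add: K G E_add)
    show "h \<circ> x \<in> {..<m} \<rightarrow> carrier A'" "h \<circ> y \<in> {..<m} \<rightarrow> carrier A'"
      by (auto simp: H)
    fix a assume a: "a \<in> carrier A'"
    then obtain a' where a': "a' \<in> carrier A" "a = h a'" using A' by auto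
    have "(\<Oplus>\<^bsub>A'\<^esub>i\<in>{..<m}. \<phi>' (g (E (?k (a \<otimes>\<^bsub>A'\<^esub> (h \<circ> x) i)))) \<otimes>\<^bsub>A'\<^esub> (h \<circ> y) i) =
        (\<Oplus>\<^bsub>A'\<^esub>i\<in>{..<m}. h (\<phi> (E (a' \<otimes> x i)) \<otimes> y i))"
      using a' by (intro A'.finsum_cong') (auto simp: H \<phi>' K kh)
    also have "\<dots> = a"
      using a' by (subst hsum[symmetric]) (auto simp: expand_y)
    finally show "(\<Oplus>\<^bsub>A'\<^esub>i\<in>{..<m}. \<phi>' (g (E (?k (a \<otimes>\<^bsub>A'\<^esub> (h \<circ> x) i)))) \<otimes>\<^bsub>A'\<^esub> (h \<circ> y) i) = a" .
    have "(\<Oplus>\<^bsub>A'\<^esub>i\<in>{..<m}. (h \<circ> x) i \<otimes>\<^bsub>A'\<^esub> \<phi>' (g (E (?k ((h \<circ> y) i \<otimes>\<^bsub>A'\<^esub> a))))) =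
        (\<Oplus>\<^bsub>A'\<^esub>i\<in>{..<m}. h (x i \<otimes> \<phi> (E (y i \<otimes> a'))))"
      using a' by (intro A'.finsum_cong') (auto simp: H \<phi>' K kh)
    also have "\<dots> = a"
      using a' by (subst hsum[symmetric]) (auto simp: expand_x)
    finally show "(\<Oplus>\<^bsub>A'\<^esub>i\<in>{..<m}. (h \<circ> x) i \<otimes>\<^bsub>A'\<^esub> \<phi>' (g (E (?k ((h \<circ> y) i \<otimes>\<^bsub>A'\<^esub> a))))) = a" .
  qed
qed

section \<open>Products of bimodule maps\<close>

text \<open>The product formula for \<open>F\<close>. The factors map \<open>X\<close> to a ring \<open>Z\<close> that may be different from \<open>X\<close>: in
  the climb through the tower, \<open>Z\<close> stays the top ring while \<open>X\<close> grows. The two factors are bilinear over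
  \<open>B\<close> and \<open>C\<close> in opposite orders, as they stand to the left and to the right of the product.
  The number of products is positive because the depth conditions ask for a positive power.\<close>

definition splits_through where
  "splits_through B C X \<beta> \<delta> Z \<beta>' \<delta>' F \<longleftrightarrow> (\<exists>r>0. \<exists>f g.
     (\<forall>t<r::nat. f t \<in> regular_hom B C X \<beta> \<delta> Z \<beta>' \<delta>' \<and>
        g t \<in> regular_hom C B X \<delta> \<beta> Z \<delta>' \<beta>') \<and>
     (\<forall>a\<in>carrier X. \<forall>b\<in>carrier X.
        \<beta>' (F (a \<otimes>\<^bsub>X\<^esub> b)) = (\<Oplus>\<^bsub>Z\<^esub>t\<in>{..<r}. f t a \<otimes>\<^bsub>Z\<^esub> g t b)))"

lemma splits_throughI:
  assumes "r > 0"
    and "\<And>t. t < r \<Longrightarrow> f t \<in> regular_hom B C X \<beta> \<delta> Z \<beta>' \<delta>'"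
    and "\<And>t. t < r \<Longrightarrow> g t \<in> regular_hom C B X \<delta> \<beta> Z \<delta>' \<beta>'"
    and "\<And>a b. a \<in> carrier X \<Longrightarrow> b \<in> carrier X \<Longrightarrow>
        \<beta>' (F (a \<otimes>\<^bsub>X\<^esub> b)) = (\<Oplus>\<^bsub>Z\<^esub>t\<in>{..<r::nat}. f t a \<otimes>\<^bsub>Z\<^esub> g t b)"
  shows "splits_through B C X \<beta> \<delta> Z \<beta>' \<delta>' F"
  unfolding splits_through_def
  by (rule exI[of _ r], intro conjI, rule assms(1), rule exI[of _ f], rule exI[of _ g])
    (use assms in blast)

lemma splits_throughE:
  assumes "splits_through B C X \<beta> \<delta> Z \<beta>' \<delta>' F"
  obtains r :: nat and f g where "r > 0"
    and "\<forall>t<r. f t \<in> regular_hom B C X \<beta> \<delta> Z \<beta>' \<delta>'"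
    and "\<forall>t<r. g t \<in> regular_hom C B X \<delta> \<beta> Z \<delta>' \<beta>'"
    and "\<forall>a\<in>carrier X. \<forall>b\<in>carrier X.
        \<beta>' (F (a \<otimes>\<^bsub>X\<^esub> b)) = (\<Oplus>\<^bsub>Z\<^esub>t\<in>{..<r}. f t a \<otimes>\<^bsub>Z\<^esub> g t b)"
  using assms unfolding splits_through_def by blast

lemma splits_through_op_ring:
  assumes "splits_through (op_ring B) (op_ring C) (op_ring X) \<beta> \<delta> (op_ring Z) \<beta>' \<delta>' F"
  shows "splits_through B C X \<beta> \<delta> Z \<beta>' \<delta>' F"
proof -
  obtain r :: nat and f g where r: "r > 0"
    and f: "\<forall>t<r. f t \<in> regular_hom (op_ring B) (op_ring C) (op_ring X) \<beta> \<delta> (op_ring Z) \<beta>' \<delta>'"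
    and g: "\<forall>t<r. g t \<in> regular_hom (op_ring C) (op_ring B) (op_ring X) \<delta> \<beta> (op_ring Z) \<delta>' \<beta>'"
    and eq: "\<forall>a\<in>carrier (op_ring X). \<forall>b\<in>carrier (op_ring X).
        \<beta>' (F (a \<otimes>\<^bsub>op_ring X\<^esub> b)) = (\<Oplus>\<^bsub>op_ring Z\<^esub>t\<in>{..<r}. f t a \<otimes>\<^bsub>op_ring Z\<^esub> g t b)"
    by (rule splits_throughE[OF assms])
  show ?thesis
    by (rule splits_throughI[OF r, of g _ _ _ _ _ _ _ _ f])
      (use f g eq in \<open>simp_all add: regular_hom_op_ring\<close>)
qed

section \<open>Comparing a stage of the tower with its bottom\<close>

text \<open>The extension \<open>A | B\<close> is a stage of the tower over \<open>M | N\<close>, with structure maps \<open>\<theta>\<close> from \<open>M\<close> to \<open>A\<close> and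
  \<open>\<nu>\<close> from \<open>N\<close> to \<open>B\<close>. The elements \<open>v\<close> and \<open>w\<close> are the products \<open>e\<^sub>i \<dots> e\<^sub>1\<close> and \<open>e\<^sub>1 \<dots> e\<^sub>i\<close>. The
  last two assumptions express that \<open>b \<otimes> a \<mapsto> b v a\<close> and \<open>a \<otimes> b \<mapsto> a w b\<close> map the tensor
  products over \<open>N\<close> of \<open>B\<close> and \<open>M\<close>, and of \<open>M\<close> and \<open>B\<close>, onto \<open>A\<close>, with explicit preimages.\<close>

locale ladder = base: frobenius_system N M \<iota> E0 m x y + layer: frobenius_system B A \<phi> E k p q
  for N :: "('n, 'n1) ring_scheme" and M :: "('m, 'm1) ring_scheme" and \<iota> E0 and m :: nat and x y
    and B :: "('b, 'b1) ring_scheme" and A :: "('a, 'a1) ring_scheme" (structure) and \<phi> E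
    and k :: nat and p q +
  fixes \<nu> \<theta> v w
  assumes nu_hom: "\<nu> \<in> ring_hom N B" and th_hom: "\<theta> \<in> ring_hom M A"
    and compatible: "n \<in> carrier N \<Longrightarrow> \<theta> (\<iota> n) = \<phi> (\<nu> n)"
    and v_closed [simp]: "v \<in> carrier A" and w_closed [simp]: "w \<in> carrier A"
    and v_commutes: "n \<in> carrier N \<Longrightarrow> v \<otimes> \<phi> (\<nu> n) = \<phi> (\<nu> n) \<otimes> v"
    and w_commutes: "n \<in> carrier N \<Longrightarrow> w \<otimes> \<phi> (\<nu> n) = \<phi> (\<nu> n) \<otimes> w"
    and pairing: "b \<in> carrier M \<Longrightarrow> E (v \<otimes> \<theta> b \<otimes> w) = \<nu> (E0 b)"
    and expand_w: "a \<in> carrier A \<Longrightarrow>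
      (\<Oplus>i\<in>{..<m}. \<theta> (x i) \<otimes> w \<otimes> \<phi> (E (v \<otimes> \<theta> (y i) \<otimes> a))) = a"
    and expand_v: "a \<in> carrier A \<Longrightarrow>
      (\<Oplus>i\<in>{..<m}. \<phi> (E (a \<otimes> (\<theta> (x i) \<otimes> w))) \<otimes> (v \<otimes> \<theta> (y i))) = a"
begin

lemma nu_closed [simp]: "n \<in> carrier N \<Longrightarrow> \<nu> n \<in> carrier B"
  using nu_hom by (rule ring_hom_closed)

lemma th_closed [simp]: "a \<in> carrier M \<Longrightarrow> \<theta> a \<in> carrier A"
  using th_hom by (rule ring_hom_closed)

lemmas th_mult = ring_hom_mult[OF th_hom] and th_add = ring_hom_add[OF th_hom]

lemma th_finsum:
  "finite I \<Longrightarrow> u \<in> I \<rightarrow> carrier M \<Longrightarrow> \<theta> (\<Oplus>\<^bsub>M\<^esub>i\<in>I. u i) = (\<Oplus>i\<in>I. \<theta> (u i))"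
  by (rule additive_finsum)
    (auto intro: base.S.is_abelian_group layer.S.is_abelian_group simp: hom_def th_add)

text \<open>The coefficients of \<open>a\<close> in the expansion \<open>expand_v\<close> obey the same rule for moving an element of \<open>N\<close>
  through the dual bases as coefficients in \<open>M | N\<close>. This makes maps defined through the
  coefficients linear over \<open>N\<close> on the side where the coefficients themselves are not.\<close>

lemma slide_right:
  assumes a: "a \<in> carrier A" and n: "n \<in> carrier N" and i: "i < m"
  shows "E (a \<otimes> \<phi> (\<nu> n) \<otimes> (\<theta> (x i) \<otimes> w)) =
    (\<Oplus>\<^bsub>B\<^esub>j\<in>{..<m}. E (a \<otimes> (\<theta> (x j) \<otimes> w)) \<otimes>\<^bsub>B\<^esub> \<nu> (E0 (y j \<otimes>\<^bsub>M\<^esub> (\<iota> n \<otimes>\<^bsub>M\<^esub> x i))))"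
proof -
  let ?c = "\<lambda>j. E0 (y j \<otimes>\<^bsub>M\<^esub> (\<iota> n \<otimes>\<^bsub>M\<^esub> x i))"
  have "\<phi> (\<nu> n) \<otimes> \<theta> (x i) = \<theta> (\<Oplus>\<^bsub>M\<^esub>j\<in>{..<m}. x j \<otimes>\<^bsub>M\<^esub> \<iota> (?c j))"
    using n i by (simp add: base.expand_x th_mult compatible)
  also have "\<dots> = (\<Oplus>j\<in>{..<m}. \<theta> (x j) \<otimes> \<phi> (\<nu> (?c j)))"
    using n i by (subst th_finsum) (auto simp: th_mult compatible intro!: layer.S.finsum_cong')
  finally have s: "\<phi> (\<nu> n) \<otimes> \<theta> (x i) = (\<Oplus>j\<in>{..<m}. \<theta> (x j) \<otimes> \<phi> (\<nu> (?c j)))" .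
  have "a \<otimes> \<phi> (\<nu> n) \<otimes> (\<theta> (x i) \<otimes> w) = a \<otimes> ((\<phi> (\<nu> n) \<otimes> \<theta> (x i)) \<otimes> w)"
    using a n i by (simp add: layer.S.m_assoc)
  also have "\<dots> = a \<otimes> (\<Oplus>j\<in>{..<m}. \<theta> (x j) \<otimes> \<phi> (\<nu> (?c j)) \<otimes> w)"
    unfolding s using n i by (subst layer.S.finsum_ldistr) auto
  also have "\<dots> = (\<Oplus>j\<in>{..<m}. a \<otimes> (\<theta> (x j) \<otimes> \<phi> (\<nu> (?c j)) \<otimes> w))"
    using a n i by (intro layer.S.finsum_rdistr) auto
  also have "\<dots> = (\<Oplus>j\<in>{..<m}. a \<otimes> (\<theta> (x j) \<otimes> w) \<otimes> \<phi> (\<nu> (?c j)))"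
    using a n i by (intro layer.S.finsum_cong') (auto simp: layer.S.m_assoc w_commutes)
  finally show ?thesis
    using a n i by (simp, subst layer.E_finsum) (auto simp: layer.E_right intro!: layer.R.finsum_cong')
qed

text \<open>Expand \<open>a\<close> by \<open>expand_v\<close> and \<open>b\<close> by \<open>expand_w\<close>; the inner factors \<open>v y\<^sub>i x\<^sub>j w\<close> are then evaluated
  by \<open>pairing\<close>.\<close>

lemma E_mult_expand:
  assumes a: "a \<in> carrier A" and b: "b \<in> carrier A"
  shows "E (a \<otimes> b) = (\<Oplus>\<^bsub>B\<^esub>i\<in>{..<m}. \<Oplus>\<^bsub>B\<^esub>j\<in>{..<m}.
    E (a \<otimes> (\<theta> (x i) \<otimes> w)) \<otimes>\<^bsub>B\<^esub> \<nu> (E0 (y i \<otimes>\<^bsub>M\<^esub> x j)) \<otimes>\<^bsub>B\<^esub> E (v \<otimes> \<theta> (y j) \<otimes> b))"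
proof -
  let ?a = "\<lambda>i. E (a \<otimes> (\<theta> (x i) \<otimes> w))" and ?b = "\<lambda>j. E (v \<otimes> \<theta> (y j) \<otimes> b)"
  have "a \<otimes> b = (\<Oplus>i\<in>{..<m}. \<phi> (?a i) \<otimes> (v \<otimes> \<theta> (y i))) \<otimes>
      (\<Oplus>j\<in>{..<m}. \<theta> (x j) \<otimes> w \<otimes> \<phi> (?b j))"
    by (simp add: expand_v expand_w a b)
  also have "\<dots> = (\<Oplus>i\<in>{..<m}. \<Oplus>j\<in>{..<m}. \<phi> (?a i) \<otimes> (v \<otimes> \<theta> (y i)) \<otimes>
      (\<theta> (x j) \<otimes> w \<otimes> \<phi> (?b j)))"
    using a b by (intro layer.S.finsum_mult_finsum) auto
  finally have "E (a \<otimes> b) = E (\<Oplus>i\<in>{..<m}. \<Oplus>j\<in>{..<m}. \<phi> (?a i) \<otimes> (v \<otimes> \<theta> (y i)) \<otimes>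
      (\<theta> (x j) \<otimes> w \<otimes> \<phi> (?b j)))"
    by simp
  also have "\<dots> = (\<Oplus>\<^bsub>B\<^esub>i\<in>{..<m}. E (\<Oplus>j\<in>{..<m}. \<phi> (?a i) \<otimes> (v \<otimes> \<theta> (y i)) \<otimes>
      (\<theta> (x j) \<otimes> w \<otimes> \<phi> (?b j))))"
    using a b by (intro layer.E_finsum) (auto intro!: layer.S.finsum_closed)
  also have "\<dots> = (\<Oplus>\<^bsub>B\<^esub>i\<in>{..<m}. \<Oplus>\<^bsub>B\<^esub>j\<in>{..<m}. E (\<phi> (?a i) \<otimes> (v \<otimes> \<theta> (y i)) \<otimes>
      (\<theta> (x j) \<otimes> w \<otimes> \<phi> (?b j))))"
    using a b by (intro layer.R.finsum_cong' layer.E_finsum refl) (auto intro!: layer.R.finsum_closed)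
  also have "\<dots> = (\<Oplus>\<^bsub>B\<^esub>i\<in>{..<m}. \<Oplus>\<^bsub>B\<^esub>j\<in>{..<m}. ?a i \<otimes>\<^bsub>B\<^esub> \<nu> (E0 (y i \<otimes>\<^bsub>M\<^esub> x j)) \<otimes>\<^bsub>B\<^esub> ?b j)"
  proof (intro layer.R.finsum_cong' refl)
    fix i j assume ij: "i \<in> {..<m}" "j \<in> {..<m}"
    have "\<phi> (?a i) \<otimes> (v \<otimes> \<theta> (y i)) \<otimes> (\<theta> (x j) \<otimes> w \<otimes> \<phi> (?b j)) =
        \<phi> (?a i) \<otimes> (v \<otimes> \<theta> (y i \<otimes>\<^bsub>M\<^esub> x j) \<otimes> w \<otimes> \<phi> (?b j))"
      using a b ij by (simp add: layer.S.m_assoc th_mult)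
    then show "E (\<phi> (?a i) \<otimes> (v \<otimes> \<theta> (y i)) \<otimes> (\<theta> (x j) \<otimes> w \<otimes> \<phi> (?b j))) =
        ?a i \<otimes>\<^bsub>B\<^esub> \<nu> (E0 (y i \<otimes>\<^bsub>M\<^esub> x j)) \<otimes>\<^bsub>B\<^esub> ?b j"
      using a b ij by (simp add: layer.E_left layer.E_right pairing layer.R.m_assoc)
  qed (use a b in \<open>auto intro!: layer.R.finsum_closed\<close>)
  finally show ?thesis .
qed

text \<open>Since \<open>E (v a b w) = E\<^sub>0 (a b)\<close>, it suffices to substitute \<open>v a\<close> and \<open>b w\<close> into the product formula
  for \<open>E\<close>. The substitution preserves bilinearity over \<open>N\<close> because \<open>v\<close> and \<open>w\<close> commute with \<open>N\<close>.\<close>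

theorem splits_base:
  assumes "splits_through B N A \<phi> (\<phi> \<circ> \<nu>) A \<phi> (\<phi> \<circ> \<nu>) E"
  shows "splits_through N N M \<iota> \<iota> A (\<phi> \<circ> \<nu>) (\<phi> \<circ> \<nu>) E0"
proof -
  obtain r :: nat and f g where r: "r > 0"
    and f: "\<forall>t<r. f t \<in> regular_hom B N A \<phi> (\<phi> \<circ> \<nu>) A \<phi> (\<phi> \<circ> \<nu>)"
    and g: "\<forall>t<r. g t \<in> regular_hom N B A (\<phi> \<circ> \<nu>) \<phi> A (\<phi> \<circ> \<nu>) \<phi>"
    and s: "\<forall>a\<in>carrier A. \<forall>b\<in>carrier A.
        \<phi> (E (a \<otimes> b)) = (\<Oplus>t\<in>{..<r}. f t a \<otimes> g t b)"
    by (rule splits_throughE[OF assms])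
  note f = f[rule_format] and g = g[rule_format] and s = s[rule_format]
  note F = regular_homD[OF f] and G = regular_homD[OF g]
  show ?thesis
  proof (rule splits_throughI[where r = r and f = "\<lambda>t b. f t (v \<otimes> \<theta> b)" and g = "\<lambda>t b. g t (\<theta> b \<otimes> w)"])
    fix t assume t: "t < r"
    show "(\<lambda>b. f t (v \<otimes> \<theta> b)) \<in> regular_hom N N M \<iota> \<iota> A (\<phi> \<circ> \<nu>) (\<phi> \<circ> \<nu>)"
    proof (rule regular_homI)
      fix n b assume n: "n \<in> carrier N" and b: "b \<in> carrier M"
      have "v \<otimes> \<theta> (\<iota> n \<otimes>\<^bsub>M\<^esub> b) = \<phi> (\<nu> n) \<otimes> (v \<otimes> \<theta> b)"
        using n b by (simp add: th_mult compatible layer.S.m_assoc[symmetric] v_commutes)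
      then show "f t (v \<otimes> \<theta> (\<iota> n \<otimes>\<^bsub>M\<^esub> b)) = (\<phi> \<circ> \<nu>) n \<otimes> f t (v \<otimes> \<theta> b)"
        using n b F(3)[OF t, of "\<nu> n" "v \<otimes> \<theta> b"] by simp
      show "f t (v \<otimes> \<theta> (b \<otimes>\<^bsub>M\<^esub> \<iota> n)) = f t (v \<otimes> \<theta> b) \<otimes> (\<phi> \<circ> \<nu>) n"
        using n b F(4)[OF t, of n "v \<otimes> \<theta> b"] by (simp add: th_mult compatible layer.S.m_assoc)
    qed (use t in \<open>auto simp: F th_add layer.S.r_distr\<close>)
  next
    fix t assume t: "t < r"
    show "(\<lambda>b. g t (\<theta> b \<otimes> w)) \<in> regular_hom N N M \<iota> \<iota> A (\<phi> \<circ> \<nu>) (\<phi> \<circ> \<nu>)"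
    proof (rule regular_homI)
      fix n b assume n: "n \<in> carrier N" and b: "b \<in> carrier M"
      have "\<theta> (b \<otimes>\<^bsub>M\<^esub> \<iota> n) \<otimes> w = \<theta> b \<otimes> w \<otimes> \<phi> (\<nu> n)"
        using n b by (simp add: th_mult compatible layer.S.m_assoc w_commutes)
      then show "g t (\<theta> (b \<otimes>\<^bsub>M\<^esub> \<iota> n) \<otimes> w) = g t (\<theta> b \<otimes> w) \<otimes> (\<phi> \<circ> \<nu>) n"
        using n b G(4)[OF t, of "\<nu> n" "\<theta> b \<otimes> w"] by simp
      show "g t (\<theta> (\<iota> n \<otimes>\<^bsub>M\<^esub> b) \<otimes> w) = (\<phi> \<circ> \<nu>) n \<otimes> g t (\<theta> b \<otimes> w)"
        using n b G(3)[OF t, of n "\<theta> b \<otimes> w"] by (simp add: th_mult compatible layer.S.m_assoc)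
    qed (use t in \<open>auto simp: G th_add layer.S.l_distr\<close>)
  next
    fix a b assume ab: "a \<in> carrier M" "b \<in> carrier M"
    have "E (v \<otimes> \<theta> a \<otimes> (\<theta> b \<otimes> w)) = \<nu> (E0 (a \<otimes>\<^bsub>M\<^esub> b))"
      using ab pairing[of "a \<otimes>\<^bsub>M\<^esub> b"] by (simp add: th_mult layer.S.m_assoc)
    then show "(\<phi> \<circ> \<nu>) (E0 (a \<otimes>\<^bsub>M\<^esub> b)) = (\<Oplus>t\<in>{..<r}. f t (v \<otimes> \<theta> a) \<otimes> g t (\<theta> b \<otimes> w))"
      using ab s[of "v \<otimes> \<theta> a" "\<theta> b \<otimes> w"] by simp
  qed (rule r)
qed

text \<open>The two expansions exchange their roles, and so do \<open>v\<close> and \<open>w\<close>.\<close>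

lemma ladder_op_ring:
  "ladder (op_ring N) (op_ring M) \<iota> E0 m y x (op_ring B) (op_ring A) \<phi> E k q p \<nu> \<theta> w v"
proof (intro ladder.intro ladder_axioms.intro base.frobenius_op_ring layer.frobenius_op_ring)
  show "\<nu> \<in> ring_hom (op_ring N) (op_ring B)" "\<theta> \<in> ring_hom (op_ring M) (op_ring A)"
    using nu_hom th_hom by (auto simp: ring_hom_def)
  fix b assume "b \<in> carrier (op_ring M)"
  then show "E (w \<otimes>\<^bsub>op_ring A\<^esub> \<theta> b \<otimes>\<^bsub>op_ring A\<^esub> v) = \<nu> (E0 b)"
    using pairing[of b] by (simp add: layer.S.m_assoc)
qed (simp_all add: compatible v_commutes w_commutes expand_v expand_w)

end

text \<open>On the tensor product of \<open>B\<close> and \<open>M\<close>, this is the map \<open>b \<otimes> z \<mapsto> f b \<cdot> f' z\<close>. Linearity on the right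
  is not visible in the formula: an element of \<open>N\<close> on the right of \<open>a\<close> is moved through the dual bases by
  \<open>slide_right\<close> until it appears to the right of the \<open>y\<^sub>i\<close>.\<close>

lemma coefficient_map_bilinear:
  fixes Z :: "('z, 'z1) ring_scheme" (structure)
  assumes "ladder N M \<iota> E0 m x y B A \<phi> E k p q \<nu> \<theta> v w" and "ring_hom_ring N Z \<kappa>"
    and f: "f \<in> regular_hom N N B \<nu> \<nu> Z \<kappa> \<kappa>"
    and f': "f' \<in> regular_hom N N M \<iota> \<iota> Z \<kappa> \<kappa>"
  shows "(\<lambda>a. \<Oplus>i\<in>{..<m}. f (E (a \<otimes>\<^bsub>A\<^esub> (\<theta> (x i) \<otimes>\<^bsub>A\<^esub> w))) \<otimes> f' (y i)) \<in>
    regular_hom N N A (\<phi> \<circ> \<nu>) (\<phi> \<circ> \<nu>) Z \<kappa> \<kappa>"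
proof -
  interpret ladder N M \<iota> E0 m x y B A \<phi> E k p q \<nu> \<theta> v w by fact
  interpret Z: ring Z using \<open>ring_hom_ring N Z \<kappa>\<close> by (simp add: ring_hom_ring_def)
  interpret kappa: ring_hom_ring N Z \<kappa> by fact
  note f'D = regular_homD[OF f'] and fD = regular_homD[OF f]
  note fs = regular_hom_finsum[OF f layer.R.ring_axioms Z.ring_axioms]
  note f's = regular_hom_finsum[OF f' base.S.ring_axioms Z.ring_axioms]
  note cl = f'D(1) fD(1) kappa.hom_closed
  define a_co where "a_co a i = E (a \<otimes>\<^bsub>A\<^esub> (\<theta> (x i) \<otimes>\<^bsub>A\<^esub> w))" for a i
  have a_cl: "a_co a i \<in> carrier B" if "a \<in> carrier A" "i < m" for a i
    using that by (simp add: a_co_def)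
  let ?P = "\<lambda>a. \<Oplus>i\<in>{..<m}. f (a_co a i) \<otimes> f' (y i)"
  show ?thesis
    unfolding a_co_def[symmetric]
  proof (rule regular_homI)
    fix a assume a: "a \<in> carrier A"
    show "?P a \<in> carrier Z"
      using a by (intro Z.finsum_closed) (auto simp: cl a_cl)
    fix n assume n: "n \<in> carrier N"
    have "a_co ((\<phi> \<circ> \<nu>) n \<otimes>\<^bsub>A\<^esub> a) i = \<nu> n \<otimes>\<^bsub>B\<^esub> a_co a i" if "i < m" for i
      using a n that by (simp add: a_co_def layer.S.m_assoc layer.E_left)
    then have "?P ((\<phi> \<circ> \<nu>) n \<otimes>\<^bsub>A\<^esub> a) = (\<Oplus>i\<in>{..<m}. \<kappa> n \<otimes> (f (a_co a i) \<otimes> f' (y i)))"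
      using a n
      by (intro Z.finsum_cong') (auto simp: fD(3) cl a_cl Z.m_assoc)
    also have "\<dots> = \<kappa> n \<otimes> ?P a"
      using a n by (intro Z.finsum_rdistr[symmetric]) (auto simp: cl a_cl)
    finally show "?P ((\<phi> \<circ> \<nu>) n \<otimes>\<^bsub>A\<^esub> a) = \<kappa> n \<otimes> ?P a" .
    let ?c = "\<lambda>j i. E0 (y j \<otimes>\<^bsub>M\<^esub> (\<iota> n \<otimes>\<^bsub>M\<^esub> x i))"
    have "?P (a \<otimes>\<^bsub>A\<^esub> (\<phi> \<circ> \<nu>) n) =
        (\<Oplus>i\<in>{..<m}. \<Oplus>j\<in>{..<m}. f (a_co a j) \<otimes> (\<kappa> (?c j i) \<otimes> f' (y i)))"
    proof (intro Z.finsum_cong' refl)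
      fix i assume i: "i \<in> {..<m}"
      have "f (a_co (a \<otimes>\<^bsub>A\<^esub> (\<phi> \<circ> \<nu>) n) i) = f (\<Oplus>\<^bsub>B\<^esub>j\<in>{..<m}. a_co a j \<otimes>\<^bsub>B\<^esub> \<nu> (?c j i))"
        using a n i by (simp add: a_co_def slide_right)
      also have "\<dots> = (\<Oplus>j\<in>{..<m}. f (a_co a j) \<otimes> \<kappa> (?c j i))"
        using a n i by (subst fs) (auto simp: a_cl cl fD(4) intro!: Z.finsum_cong')
      also have "\<dots> \<otimes> f' (y i) = (\<Oplus>j\<in>{..<m}. f (a_co a j) \<otimes> \<kappa> (?c j i) \<otimes> f' (y i))"
        using a n i by (intro Z.finsum_ldistr) (auto simp: a_cl cl)
      also have "\<dots> = (\<Oplus>j\<in>{..<m}. f (a_co a j) \<otimes> (\<kappa> (?c j i) \<otimes> f' (y i)))"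
        using a n i by (intro Z.finsum_cong') (auto simp: a_cl cl Z.m_assoc)
      finally show "f (a_co (a \<otimes>\<^bsub>A\<^esub> (\<phi> \<circ> \<nu>) n) i) \<otimes> f' (y i) =
          (\<Oplus>j\<in>{..<m}. f (a_co a j) \<otimes> (\<kappa> (?c j i) \<otimes> f' (y i)))" .
    qed (use a n in \<open>auto simp: a_cl cl intro!: Z.finsum_closed\<close>)
    also have "\<dots> = (\<Oplus>j\<in>{..<m}. \<Oplus>i\<in>{..<m}. f (a_co a j) \<otimes> (\<kappa> (?c j i) \<otimes> f' (y i)))"
      using a n by (intro Z.finsum_swap) (auto simp: a_cl cl)
    also have "\<dots> = (\<Oplus>j\<in>{..<m}. f (a_co a j) \<otimes> f' (y j) \<otimes> \<kappa> n)"
    proof (intro Z.finsum_cong' refl)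
      fix j assume j: "j \<in> {..<m}"
      have "(\<Oplus>i\<in>{..<m}. \<kappa> (?c j i) \<otimes> f' (y i)) = f' (\<Oplus>\<^bsub>M\<^esub>i\<in>{..<m}. \<iota> (E0 (y j \<otimes>\<^bsub>M\<^esub> \<iota> n \<otimes>\<^bsub>M\<^esub> x i)) \<otimes>\<^bsub>M\<^esub> y i)"
        using n j by (subst f's) (auto simp: f'D(3) cl base.S.m_assoc intro!: Z.finsum_cong')
      also have "\<dots> = f' (y j \<otimes>\<^bsub>M\<^esub> \<iota> n)"
        using base.expand_y[of "y j \<otimes>\<^bsub>M\<^esub> \<iota> n"] n j by simp
      also have "\<dots> = f' (y j) \<otimes> \<kappa> n"
        using n j by (simp add: f'D(4))
      finally have e: "(\<Oplus>i\<in>{..<m}. \<kappa> (?c j i) \<otimes> f' (y i)) = f' (y j) \<otimes> \<kappa> n" .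
      have "(\<Oplus>i\<in>{..<m}. f (a_co a j) \<otimes> (\<kappa> (?c j i) \<otimes> f' (y i))) =
          f (a_co a j) \<otimes> (\<Oplus>i\<in>{..<m}. \<kappa> (?c j i) \<otimes> f' (y i))"
        using a n j by (intro Z.finsum_rdistr[symmetric]) (auto simp: a_cl cl)
      then show "(\<Oplus>i\<in>{..<m}. f (a_co a j) \<otimes> (\<kappa> (?c j i) \<otimes> f' (y i))) =
          f (a_co a j) \<otimes> f' (y j) \<otimes> \<kappa> n"
        unfolding e using a n j by (simp add: a_cl cl Z.m_assoc)
    qed (use a n in \<open>auto simp: a_cl cl\<close>)
    also have "\<dots> = ?P a \<otimes> \<kappa> n"
      using a n by (intro Z.finsum_ldistr[symmetric]) (auto simp: a_cl cl)
    finally show "?P (a \<otimes>\<^bsub>A\<^esub> (\<phi> \<circ> \<nu>) n) = ?P a \<otimes> \<kappa> n" .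
  next
    fix a b assume ab: "a \<in> carrier A" "b \<in> carrier A"
    have "a_co (a \<oplus>\<^bsub>A\<^esub> b) i = a_co a i \<oplus>\<^bsub>B\<^esub> a_co b i" if "i < m" for i
      using ab that by (simp add: a_co_def layer.S.l_distr layer.E_add)
    then have "?P (a \<oplus>\<^bsub>A\<^esub> b) = (\<Oplus>i\<in>{..<m}. f (a_co a i) \<otimes> f' (y i) \<oplus> f (a_co b i) \<otimes> f' (y i))"
      using ab
      by (intro Z.finsum_cong') (auto simp: fD(2) cl a_cl Z.l_distr)
    also have "\<dots> = ?P a \<oplus> ?P b"
      using ab by (intro Z.finsum_addf) (auto simp: cl a_cl)
    finally show "?P (a \<oplus>\<^bsub>A\<^esub> b) = ?P a \<oplus> ?P b" .
  qed
qed

text \<open>Apply \<open>F\<close> to the expansion \<open>\<Sum> a\<^sub>i E\<^sub>0(y\<^sub>i x\<^sub>j) b\<^sub>j\<close> of \<open>E (a b)\<close>. The formula for \<open>F\<close> turns it into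
  \<open>\<Sum> f\<^sub>t(a\<^sub>i) E\<^sub>0(y\<^sub>i x\<^sub>j) g\<^sub>t(b\<^sub>j)\<close>, and the formula for \<open>E\<^sub>0\<close> turns the middle factor into
  \<open>\<Sum> f'\<^sub>u(y\<^sub>i) g'\<^sub>u(x\<^sub>j)\<close>. Of the four factors of each term, the first two depend on \<open>a\<close> and \<open>i\<close> only,
  the last two on \<open>b\<close> and \<open>j\<close> only, so the sums over \<open>i\<close> and \<open>j\<close> can be carried out separately.\<close>

theorem splits_step:
  fixes Z :: "('z, 'z1) ring_scheme" (structure)
  assumes l: "ladder N M \<iota> E0 m x y B A \<phi> E k p q \<nu> \<theta> v w" and \<kappa>: "ring_hom_ring N Z \<kappa>"
    and "splits_through N N M \<iota> \<iota> Z \<kappa> \<kappa> E0"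
    and F: "F \<in> regular_hom N N B \<nu> \<nu> N id id"
    and "splits_through N N B \<nu> \<nu> Z \<kappa> \<kappa> F"
  shows "splits_through N N A (\<phi> \<circ> \<nu>) (\<phi> \<circ> \<nu>) Z \<kappa> \<kappa> (F \<circ> E)"
proof -
  interpret ladder N M \<iota> E0 m x y B A \<phi> E k p q \<nu> \<theta> v w by fact
  interpret Z: ring Z using \<open>ring_hom_ring N Z \<kappa>\<close> by (simp add: ring_hom_ring_def)
  interpret kappa: ring_hom_ring N Z \<kappa> by fact
  obtain s :: nat and f' g' where s: "s > 0"
    and f': "\<forall>t<s. f' t \<in> regular_hom N N M \<iota> \<iota> Z \<kappa> \<kappa>"
    and g': "\<forall>t<s. g' t \<in> regular_hom N N M \<iota> \<iota> Z \<kappa> \<kappa>"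
    and eq': "\<forall>a\<in>carrier M. \<forall>b\<in>carrier M.
        \<kappa> (E0 (a \<otimes>\<^bsub>M\<^esub> b)) = (\<Oplus>t\<in>{..<s}. f' t a \<otimes> g' t b)"
    by (rule splits_throughE[OF assms(3)])
  obtain r :: nat and f g where r: "r > 0"
    and f: "\<forall>t<r. f t \<in> regular_hom N N B \<nu> \<nu> Z \<kappa> \<kappa>"
    and g: "\<forall>t<r. g t \<in> regular_hom N N B \<nu> \<nu> Z \<kappa> \<kappa>"
    and eq: "\<forall>a\<in>carrier B. \<forall>b\<in>carrier B.
        \<kappa> (F (a \<otimes>\<^bsub>B\<^esub> b)) = (\<Oplus>t\<in>{..<r}. f t a \<otimes> g t b)"
    by (rule splits_throughE[OF assms(5)])
  note f = f[rule_format] and g = g[rule_format] and eq = eq[rule_format]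
    and f' = f'[rule_format] and g' = g'[rule_format] and eq' = eq'[rule_format]
  note f'D = regular_homD[OF f'] and g'D = regular_homD[OF g']
    and fD = regular_homD[OF f] and gD = regular_homD[OF g]
    and FD = regular_homD[OF F]
  have kc: "\<kappa> n \<in> carrier Z" if "n \<in> carrier N" for n using that by (rule kappa.hom_closed)
  have ka: "\<kappa> (\<Oplus>\<^bsub>N\<^esub>i\<in>I. u i) = (\<Oplus>i\<in>I. \<kappa> (u i))"
    if "finite I" "u \<in> I \<rightarrow> carrier N" for I :: "nat set" and u
    using that by (intro additive_finsum ring.is_abelian_group[OF base.R.ring_axioms] ring.is_abelian_group[OF Z.ring_axioms])
      (auto simp: hom_def kc ring_hom_add[OF kappa.homh])
  note Fs = regular_hom_finsum[OF F layer.R.ring_axioms base.R.ring_axioms]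
  note cl = f'D(1) g'D(1) fD(1) gD(1) FD(1) kc
  \<comment> \<open>the coefficients of \<open>expand_v\<close> and \<open>expand_w\<close>\<close>
  define a_co where "a_co a i = E (a \<otimes>\<^bsub>A\<^esub> (\<theta> (x i) \<otimes>\<^bsub>A\<^esub> w))" for a i
  define b_co where "b_co b i = E (v \<otimes>\<^bsub>A\<^esub> \<theta> (y i) \<otimes>\<^bsub>A\<^esub> b)" for b i
  have a_cl: "a_co a i \<in> carrier B" if "a \<in> carrier A" "i < m" for a i
    using that by (simp add: a_co_def)
  have b_cl: "b_co b i \<in> carrier B" if "b \<in> carrier A" "i < m" for b i
    using that by (simp add: b_co_def)
  define P where "P t u a = (\<Oplus>i\<in>{..<m}. f t (a_co a i) \<otimes> f' u (y i))" for t u a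
  define Q where "Q t u b = (\<Oplus>j\<in>{..<m}. g' u (x j) \<otimes> g t (b_co b j))" for t u b
  have P: "P t u \<in> regular_hom N N A (\<phi> \<circ> \<nu>) (\<phi> \<circ> \<nu>) Z \<kappa> \<kappa>"
    if "t < r" "u < s" for t u
    unfolding P_def a_co_def by (rule coefficient_map_bilinear[OF l \<kappa> f[OF that(1)] f'[OF that(2)]])
  have Q: "Q t u \<in> regular_hom N N A (\<phi> \<circ> \<nu>) (\<phi> \<circ> \<nu>) Z \<kappa> \<kappa>"
    if "t < r" "u < s" for t u
    using coefficient_map_bilinear[OF ladder_op_ring ring_hom_op_ring[OF \<kappa>], of "g t" "g' u"] g[OF that(1)] g'[OF that(2)]
    by (simp add: regular_hom_op_ring Q_def[abs_def] b_co_def)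
  have main: "\<kappa> (F (E (a \<otimes>\<^bsub>A\<^esub> b))) = (\<Oplus>t\<in>{..<r}. \<Oplus>u\<in>{..<s}. P t u a \<otimes> Q t u b)"
    if a: "a \<in> carrier A" and b: "b \<in> carrier A" for a b
  proof -
    let ?n = "\<lambda>i j. E0 (y i \<otimes>\<^bsub>M\<^esub> x j)"
    let ?e = "\<lambda>i j. a_co a i \<otimes>\<^bsub>B\<^esub> \<nu> (?n i j) \<otimes>\<^bsub>B\<^esub> b_co b j"
    let ?z = "\<lambda>t u i j. f t (a_co a i) \<otimes> f' u (y i) \<otimes> (g' u (x j) \<otimes> g t (b_co b j))"
    have zc: "?z t u i j \<in> carrier Z" if "t < r" "u < s" "i < m" "j < m" for t u i j
      using that a b by (simp add: cl a_cl b_cl)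
    have "\<kappa> (F (E (a \<otimes>\<^bsub>A\<^esub> b))) = \<kappa> (F (\<Oplus>\<^bsub>B\<^esub>i\<in>{..<m}. \<Oplus>\<^bsub>B\<^esub>j\<in>{..<m}. ?e i j))"
      by (simp add: E_mult_expand[OF a b] a_co_def b_co_def)
    also have "F (\<Oplus>\<^bsub>B\<^esub>i\<in>{..<m}. \<Oplus>\<^bsub>B\<^esub>j\<in>{..<m}. ?e i j) = (\<Oplus>\<^bsub>N\<^esub>i\<in>{..<m}. F (\<Oplus>\<^bsub>B\<^esub>j\<in>{..<m}. ?e i j))"
      using a b by (intro Fs) (auto simp: a_cl b_cl intro!: layer.R.finsum_closed)
    also have "\<dots> = (\<Oplus>\<^bsub>N\<^esub>i\<in>{..<m}. \<Oplus>\<^bsub>N\<^esub>j\<in>{..<m}. F (?e i j))"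
      using a b by (intro base.R.finsum_cong' Fs refl) (auto simp: a_cl b_cl cl intro!: base.R.finsum_closed)
    also have "\<kappa> \<dots> = (\<Oplus>i\<in>{..<m}. \<kappa> (\<Oplus>\<^bsub>N\<^esub>j\<in>{..<m}. F (?e i j)))"
      using a b by (intro ka) (auto simp: a_cl b_cl cl intro!: base.R.finsum_closed)
    also have "\<dots> = (\<Oplus>i\<in>{..<m}. \<Oplus>j\<in>{..<m}. \<kappa> (F (?e i j)))"
      using a b by (intro Z.finsum_cong' ka refl) (auto simp: a_cl b_cl cl intro!: Z.finsum_closed)
    also have "\<dots> = (\<Oplus>i\<in>{..<m}. \<Oplus>j\<in>{..<m}. \<Oplus>t\<in>{..<r}. \<Oplus>u\<in>{..<s}. ?z t u i j)"
    proof (intro Z.finsum_cong' refl)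
      fix i j assume ij: "i \<in> {..<m}" "j \<in> {..<m}"
      have "\<kappa> (F (?e i j)) = (\<Oplus>t\<in>{..<r}. f t (a_co a i \<otimes>\<^bsub>B\<^esub> \<nu> (?n i j)) \<otimes> g t (b_co b j))"
        using a b ij by (intro eq) (auto simp: a_cl b_cl)
      also have "\<dots> = (\<Oplus>t\<in>{..<r}. \<Oplus>u\<in>{..<s}. ?z t u i j)"
      proof (intro Z.finsum_cong' refl)
        fix t assume t: "t \<in> {..<r}"
        have "f t (a_co a i \<otimes>\<^bsub>B\<^esub> \<nu> (?n i j)) \<otimes> g t (b_co b j) =
            f t (a_co a i) \<otimes> ((\<Oplus>u\<in>{..<s}. f' u (y i) \<otimes> g' u (x j)) \<otimes> g t (b_co b j))"
          using a b ij t eq'[of "y i" "x j", symmetric]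
          by (simp add: fD(4) a_cl b_cl cl Z.m_assoc)
        also have "\<dots> = f t (a_co a i) \<otimes> (\<Oplus>u\<in>{..<s}. f' u (y i) \<otimes> g' u (x j) \<otimes> g t (b_co b j))"
          using a b ij t by (subst Z.finsum_ldistr) (auto simp: a_cl b_cl cl)
        also have "\<dots> = (\<Oplus>u\<in>{..<s}. f t (a_co a i) \<otimes> (f' u (y i) \<otimes> g' u (x j) \<otimes> g t (b_co b j)))"
          using a b ij t by (intro Z.finsum_rdistr) (auto simp: a_cl b_cl cl)
        also have "\<dots> = (\<Oplus>u\<in>{..<s}. ?z t u i j)"
          using a b ij t by (intro Z.finsum_cong') (auto simp: a_cl b_cl cl Z.m_assoc)
        finally show "f t (a_co a i \<otimes>\<^bsub>B\<^esub> \<nu> (?n i j)) \<otimes> g t (b_co b j) = (\<Oplus>u\<in>{..<s}. ?z t u i j)" .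
      qed (use a b ij zc in \<open>auto intro!: Z.finsum_closed\<close>)
      finally show "\<kappa> (F (?e i j)) = (\<Oplus>t\<in>{..<r}. \<Oplus>u\<in>{..<s}. ?z t u i j)" .
    qed (use zc in \<open>auto intro!: Z.finsum_closed\<close>)
    also have "\<dots> = (\<Oplus>i\<in>{..<m}. \<Oplus>t\<in>{..<r}. \<Oplus>u\<in>{..<s}. \<Oplus>j\<in>{..<m}. ?z t u i j)"
    proof (rule Z.finsum_cong'[OF refl])
      fix i assume i: "i \<in> {..<m}"
      have "(\<Oplus>j\<in>{..<m}. \<Oplus>t\<in>{..<r}. \<Oplus>u\<in>{..<s}. ?z t u i j) =
          (\<Oplus>t\<in>{..<r}. \<Oplus>j\<in>{..<m}. \<Oplus>u\<in>{..<s}. ?z t u i j)"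
        using i zc by (intro Z.finsum_swap) (auto intro!: Z.finsum_closed)
      also have "\<dots> = (\<Oplus>t\<in>{..<r}. \<Oplus>u\<in>{..<s}. \<Oplus>j\<in>{..<m}. ?z t u i j)"
        using i zc by (intro Z.finsum_cong' Z.finsum_swap refl) (auto intro!: Z.finsum_closed)
      finally show "(\<Oplus>j\<in>{..<m}. \<Oplus>t\<in>{..<r}. \<Oplus>u\<in>{..<s}. ?z t u i j) =
          (\<Oplus>t\<in>{..<r}. \<Oplus>u\<in>{..<s}. \<Oplus>j\<in>{..<m}. ?z t u i j)" .
    qed (use zc in \<open>auto intro!: Z.finsum_closed\<close>)
    also have "\<dots> = (\<Oplus>t\<in>{..<r}. \<Oplus>i\<in>{..<m}. \<Oplus>u\<in>{..<s}. \<Oplus>j\<in>{..<m}. ?z t u i j)"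
      using zc by (intro Z.finsum_swap) (auto intro!: Z.finsum_closed)
    also have "\<dots> = (\<Oplus>t\<in>{..<r}. \<Oplus>u\<in>{..<s}. \<Oplus>i\<in>{..<m}. \<Oplus>j\<in>{..<m}. ?z t u i j)"
      using zc by (intro Z.finsum_cong' Z.finsum_swap refl) (auto intro!: Z.finsum_closed)
    also have "\<dots> = (\<Oplus>t\<in>{..<r}. \<Oplus>u\<in>{..<s}. P t u a \<otimes> Q t u b)"
    proof (intro Z.finsum_cong' refl)
      fix t u assume tu: "t \<in> {..<r}" "u \<in> {..<s}"
      show "(\<Oplus>i\<in>{..<m}. \<Oplus>j\<in>{..<m}. ?z t u i j) = P t u a \<otimes> Q t u b"
        unfolding P_def Q_def using a b tu
        by (intro Z.finsum_mult_finsum[symmetric]) (auto simp: a_cl b_cl cl)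
    qed (use regular_homD(1)[OF P] regular_homD(1)[OF Q] a b in
        \<open>auto intro!: Z.finsum_closed\<close>)
    finally show ?thesis .
  qed
  have lt: "i div s < r" "i mod s < s" if "i < r * s" for i
    using that s by (auto simp: less_mult_imp_div_less)
  let ?P = "\<lambda>i. P (i div s) (i mod s)" and ?Q = "\<lambda>i. Q (i div s) (i mod s)"
  have sum: "\<kappa> ((F \<circ> E) (a \<otimes>\<^bsub>A\<^esub> b)) = (\<Oplus>i\<in>{..<r * s}. ?P i a \<otimes> ?Q i b)"
    if ab: "a \<in> carrier A" "b \<in> carrier A" for a b
  proof -
    have "(\<Oplus>i\<in>{..<r * s}. ?P i a \<otimes> ?Q i b) =
        (\<Oplus>t\<in>{..<r}. \<Oplus>u\<in>{..<s}. P t u a \<otimes> Q t u b)"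
      using ab regular_homD(1)[OF P] regular_homD(1)[OF Q]
      by (intro Z.finsum_div_mod[where u = "\<lambda>t u. P t u a \<otimes> Q t u b"]) auto
    then show ?thesis
      using main[OF ab] by simp
  qed
  show ?thesis
    by (rule splits_throughI[where r = "r * s" and f = ?P and g = ?Q]) (use r s lt P Q sum in auto)
qed

text \<open>At the bottom, \<open>v\<close> and \<open>w\<close> are empty products and the expansions are those of the dual bases. The
  ring \<open>B\<close> is a copy of \<open>N\<close>, since the tower starts with a renamed copy of the extension.\<close>

lemma ladder_base:
  assumes "frobenius_system N M \<iota> E0 m x y" and "frobenius_system B M \<phi> E k p q"
    and nu: "\<nu> \<in> ring_hom N B"
    and \<iota>: "\<And>n. n \<in> carrier N \<Longrightarrow> \<iota> n = \<phi> (\<nu> n)"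
    and E: "\<And>a. a \<in> carrier M \<Longrightarrow> E a = \<nu> (E0 a)"
  shows "ladder N M \<iota> E0 m x y B M \<phi> E k p q \<nu> id \<one>\<^bsub>M\<^esub> \<one>\<^bsub>M\<^esub>"
proof -
  interpret base: frobenius_system N M \<iota> E0 m x y by fact
  interpret layer: frobenius_system B M \<phi> E k p q by fact
  have nc: "\<nu> n \<in> carrier B" if "n \<in> carrier N" for n
    using nu that by (rule ring_hom_closed)
  show ?thesis
  proof (intro ladder.intro ladder_axioms.intro assms(1,2) nu)
    show "id \<in> ring_hom M M" by (rule ring_hom_memI) auto
    fix a assume a: "a \<in> carrier M"
    then show "E (\<one>\<^bsub>M\<^esub> \<otimes>\<^bsub>M\<^esub> id a \<otimes>\<^bsub>M\<^esub> \<one>\<^bsub>M\<^esub>) = \<nu> (E0 a)" by (simp add: E)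
    have "(\<Oplus>\<^bsub>M\<^esub>i\<in>{..<m}. id (x i) \<otimes>\<^bsub>M\<^esub> \<one>\<^bsub>M\<^esub> \<otimes>\<^bsub>M\<^esub> \<phi> (E (\<one>\<^bsub>M\<^esub> \<otimes>\<^bsub>M\<^esub> id (y i) \<otimes>\<^bsub>M\<^esub> a))) =
        (\<Oplus>\<^bsub>M\<^esub>i\<in>{..<m}. x i \<otimes>\<^bsub>M\<^esub> \<iota> (E0 (y i \<otimes>\<^bsub>M\<^esub> a)))"
      using a by (intro base.S.finsum_cong') (auto simp: E \<iota> nc)
    then show "(\<Oplus>\<^bsub>M\<^esub>i\<in>{..<m}. id (x i) \<otimes>\<^bsub>M\<^esub> \<one>\<^bsub>M\<^esub> \<otimes>\<^bsub>M\<^esub> \<phi> (E (\<one>\<^bsub>M\<^esub> \<otimes>\<^bsub>M\<^esub> id (y i) \<otimes>\<^bsub>M\<^esub> a))) = a"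
      using base.expand_x[OF a] by simp
    have "(\<Oplus>\<^bsub>M\<^esub>i\<in>{..<m}. \<phi> (E (a \<otimes>\<^bsub>M\<^esub> (id (x i) \<otimes>\<^bsub>M\<^esub> \<one>\<^bsub>M\<^esub>))) \<otimes>\<^bsub>M\<^esub> (\<one>\<^bsub>M\<^esub> \<otimes>\<^bsub>M\<^esub> id (y i))) =
        (\<Oplus>\<^bsub>M\<^esub>i\<in>{..<m}. \<iota> (E0 (a \<otimes>\<^bsub>M\<^esub> x i)) \<otimes>\<^bsub>M\<^esub> y i)"
      using a by (intro base.S.finsum_cong') (auto simp: E \<iota> nc)
    then show "(\<Oplus>\<^bsub>M\<^esub>i\<in>{..<m}. \<phi> (E (a \<otimes>\<^bsub>M\<^esub> (id (x i) \<otimes>\<^bsub>M\<^esub> \<one>\<^bsub>M\<^esub>))) \<otimes>\<^bsub>M\<^esub> (\<one>\<^bsub>M\<^esub> \<otimes>\<^bsub>M\<^esub> id (y i))) = a"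
      using base.expand_y[OF a] by simp
  qed (auto simp: \<iota> nc)
qed

text \<open>The new elements are \<open>e v\<close> and \<open>w e\<close>. The pairing is preserved by \<open>e a e = E(a) e\<close> and \<open>E' e = 1\<close>,
  and the expansions by \<open>expand_through_e\<close>.\<close>

lemma ladder_step:
  assumes "ladder N M \<iota> E0 m x y B A \<phi> E k p q \<nu> \<theta> v w"
    and "basic_construction B A \<phi> E k p q A' \<phi>' act"
  shows "\<exists>E' p' q' v' w'. ladder N M \<iota> E0 m x y A A' \<phi>' E' k p' q' (\<phi> \<circ> \<nu>) (\<phi>' \<circ> \<theta>) v' w'"
proof -
  interpret ladder N M \<iota> E0 m x y B A \<phi> E k p q \<nu> \<theta> v w by fact
  interpret basic_construction B A \<phi> E k p q A' \<phi>' act by fact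
  let ?v = "e \<otimes>\<^bsub>A'\<^esub> \<phi>' v" and ?w = "\<phi>' w \<otimes>\<^bsub>A'\<^esub> e"
  have "ladder N M \<iota> E0 m x y A A' \<phi>' E' k
      (\<lambda>i. \<phi>' (p i) \<otimes>\<^bsub>A'\<^esub> e) (\<lambda>i. e \<otimes>\<^bsub>A'\<^esub> \<phi>' (q i)) (\<phi> \<circ> \<nu>) (\<phi>' \<circ> \<theta>) ?v ?w"
  proof (intro ladder.intro ladder_axioms.intro frobenius_up base.frobenius_system_axioms)
    show "\<phi> \<circ> \<nu> \<in> ring_hom N A"
      by (rule ring_hom_trans[OF nu_hom layer.homh])
    show "\<phi>' \<circ> \<theta> \<in> ring_hom M A'"
      by (rule ring_hom_trans[OF th_hom ring_hom_ring.homh[OF phi'_hom]])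
    show "?v \<in> carrier A'" "?w \<in> carrier A'" by simp_all
  next
    fix n assume n: "n \<in> carrier N"
    show "(\<phi>' \<circ> \<theta>) (\<iota> n) = \<phi>' ((\<phi> \<circ> \<nu>) n)"
      using n by (simp add: compatible)
    have "?v \<otimes>\<^bsub>A'\<^esub> \<phi>' ((\<phi> \<circ> \<nu>) n) = e \<otimes>\<^bsub>A'\<^esub> \<phi>' (\<phi> (\<nu> n)) \<otimes>\<^bsub>A'\<^esub> \<phi>' v"
      using n by (simp add: T.m_assoc flip: phi'_mult) (simp add: v_commutes)
    then show "?v \<otimes>\<^bsub>A'\<^esub> \<phi>' ((\<phi> \<circ> \<nu>) n) = \<phi>' ((\<phi> \<circ> \<nu>) n) \<otimes>\<^bsub>A'\<^esub> ?v"
      using n by (simp add: e_commutes T.m_assoc)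
    have "?w \<otimes>\<^bsub>A'\<^esub> \<phi>' ((\<phi> \<circ> \<nu>) n) = \<phi>' (w \<otimes>\<^bsub>A\<^esub> \<phi> (\<nu> n)) \<otimes>\<^bsub>A'\<^esub> e"
      using n by (simp add: T.m_assoc e_commutes phi'_mult)
    then show "?w \<otimes>\<^bsub>A'\<^esub> \<phi>' ((\<phi> \<circ> \<nu>) n) = \<phi>' ((\<phi> \<circ> \<nu>) n) \<otimes>\<^bsub>A'\<^esub> ?w"
      using n by (simp add: w_commutes phi'_mult T.m_assoc)
  next
    fix b assume b: "b \<in> carrier M"
    have "?v \<otimes>\<^bsub>A'\<^esub> (\<phi>' \<circ> \<theta>) b \<otimes>\<^bsub>A'\<^esub> ?w = e \<otimes>\<^bsub>A'\<^esub> \<phi>' (v \<otimes>\<^bsub>A\<^esub> \<theta> b \<otimes>\<^bsub>A\<^esub> w) \<otimes>\<^bsub>A'\<^esub> e"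
      using b by (simp add: T.m_assoc phi'_mult)
    then show "E' (?v \<otimes>\<^bsub>A'\<^esub> (\<phi>' \<circ> \<theta>) b \<otimes>\<^bsub>A'\<^esub> ?w) = (\<phi> \<circ> \<nu>) (E0 b)"
      using b by (simp add: E'_e_phi'_e pairing)
  next
    fix f assume f: "f \<in> carrier A'"
    let ?p = "\<lambda>i. \<theta> (x i) \<otimes>\<^bsub>A\<^esub> w" and ?q = "\<lambda>i. v \<otimes>\<^bsub>A\<^esub> \<theta> (y i)"
    have pq: "?p \<in> {..<m} \<rightarrow> carrier A" "?q \<in> {..<m} \<rightarrow> carrier A" by auto
    note absorb = expand_through_e[OF pq expand_w f]
    have "(\<Oplus>\<^bsub>A'\<^esub>i\<in>{..<m}. (\<phi>' \<circ> \<theta>) (x i) \<otimes>\<^bsub>A'\<^esub> ?w \<otimes>\<^bsub>A'\<^esub> \<phi>' (E' (?v \<otimes>\<^bsub>A'\<^esub> (\<phi>' \<circ> \<theta>) (y i) \<otimes>\<^bsub>A'\<^esub> f))) =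
        (\<Oplus>\<^bsub>A'\<^esub>i\<in>{..<m}. \<phi>' (?p i) \<otimes>\<^bsub>A'\<^esub> e \<otimes>\<^bsub>A'\<^esub> \<phi>' (E' (e \<otimes>\<^bsub>A'\<^esub> \<phi>' (?q i) \<otimes>\<^bsub>A'\<^esub> f)))"
      using f by (intro T.finsum_cong') (auto simp: phi'_mult T.m_assoc)
    then show "(\<Oplus>\<^bsub>A'\<^esub>i\<in>{..<m}. (\<phi>' \<circ> \<theta>) (x i) \<otimes>\<^bsub>A'\<^esub> ?w \<otimes>\<^bsub>A'\<^esub> \<phi>' (E' (?v \<otimes>\<^bsub>A'\<^esub> (\<phi>' \<circ> \<theta>) (y i) \<otimes>\<^bsub>A'\<^esub> f))) = f"
      using absorb(1) by simp
    have "(\<Oplus>\<^bsub>A'\<^esub>i\<in>{..<m}. \<phi>' (E' (f \<otimes>\<^bsub>A'\<^esub> ((\<phi>' \<circ> \<theta>) (x i) \<otimes>\<^bsub>A'\<^esub> ?w))) \<otimes>\<^bsub>A'\<^esub> (?v \<otimes>\<^bsub>A'\<^esub> (\<phi>' \<circ> \<theta>) (y i))) =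
        (\<Oplus>\<^bsub>A'\<^esub>i\<in>{..<m}. \<phi>' (E' (f \<otimes>\<^bsub>A'\<^esub> (\<phi>' (?p i) \<otimes>\<^bsub>A'\<^esub> e))) \<otimes>\<^bsub>A'\<^esub> (e \<otimes>\<^bsub>A'\<^esub> \<phi>' (?q i)))"
      using f by (intro T.finsum_cong') (auto simp: phi'_mult T.m_assoc)
    then show "(\<Oplus>\<^bsub>A'\<^esub>i\<in>{..<m}. \<phi>' (E' (f \<otimes>\<^bsub>A'\<^esub> ((\<phi>' \<circ> \<theta>) (x i) \<otimes>\<^bsub>A'\<^esub> ?w))) \<otimes>\<^bsub>A'\<^esub> (?v \<otimes>\<^bsub>A'\<^esub> (\<phi>' \<circ> \<theta>) (y i))) = f"
      using absorb(2) by simp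
  qed
  then show ?thesis by blast
qed

section \<open>The tensor square of a ring\<close>

text \<open>The tensor product of \<open>A\<close> with itself over \<open>B\<close> with its outer actions, described by its universal
  property for balanced maps to \<open>A\<close>. Pure tensors generate it under addition alone, because the negative
  of a pure tensor is pure. The axiomatic description can be transported to opposite
  rings by exchanging the two sides, which the construction with cosets does not allow directly.\<close>

locale tensor_square = ring A for A :: "('a, 'c) ring_scheme" (structure) +
  fixes B :: "('b, 'b1) ring_scheme" and \<beta> :: "'b \<Rightarrow> 'a"
    and L :: "('l, 'l1) ring_scheme" and f :: "'l \<Rightarrow> 'a" and R :: "('r, 'r1) ring_scheme" and g :: "'r \<Rightarrow> 'a"
    and T :: "('l, 'r, 't) bimodule" and \<tau> :: "'a \<Rightarrow> 'a \<Rightarrow> 't"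
  assumes group: "abelian_group T"
    and \<beta>_closed [simp]: "b \<in> carrier B \<Longrightarrow> \<beta> b \<in> carrier A"
    and f_closed [simp]: "l \<in> carrier L \<Longrightarrow> f l \<in> carrier A"
    and g_closed [simp]: "r \<in> carrier R \<Longrightarrow> g r \<in> carrier A"
    and pure_closed [simp]: "x \<in> carrier A \<Longrightarrow> y \<in> carrier A \<Longrightarrow> \<tau> x y \<in> carrier T"
    and pure_add_left: "x \<in> carrier A \<Longrightarrow> x' \<in> carrier A \<Longrightarrow> y \<in> carrier A \<Longrightarrow>
      \<tau> (x \<oplus> x') y = \<tau> x y \<oplus>\<^bsub>T\<^esub> \<tau> x' y"
    and pure_add_right: "x \<in> carrier A \<Longrightarrow> y \<in> carrier A \<Longrightarrow> y' \<in> carrier A \<Longrightarrow>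
      \<tau> x (y \<oplus> y') = \<tau> x y \<oplus>\<^bsub>T\<^esub> \<tau> x y'"
    and pure_balanced: "x \<in> carrier A \<Longrightarrow> b \<in> carrier B \<Longrightarrow> y \<in> carrier A \<Longrightarrow>
      \<tau> (x \<otimes> \<beta> b) y = \<tau> x (\<beta> b \<otimes> y)"
    and lact_closed [simp]: "l \<in> carrier L \<Longrightarrow> u \<in> carrier T \<Longrightarrow> lact T l u \<in> carrier T"
    and lact_add: "l \<in> carrier L \<Longrightarrow> u \<in> carrier T \<Longrightarrow> u' \<in> carrier T \<Longrightarrow>
      lact T l (u \<oplus>\<^bsub>T\<^esub> u') = lact T l u \<oplus>\<^bsub>T\<^esub> lact T l u'"
    and lact_pure: "l \<in> carrier L \<Longrightarrow> x \<in> carrier A \<Longrightarrow> y \<in> carrier A \<Longrightarrow>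
      lact T l (\<tau> x y) = \<tau> (f l \<otimes> x) y"
    and ract_closed [simp]: "r \<in> carrier R \<Longrightarrow> u \<in> carrier T \<Longrightarrow> ract T u r \<in> carrier T"
    and ract_add: "r \<in> carrier R \<Longrightarrow> u \<in> carrier T \<Longrightarrow> u' \<in> carrier T \<Longrightarrow>
      ract T (u \<oplus>\<^bsub>T\<^esub> u') r = ract T u r \<oplus>\<^bsub>T\<^esub> ract T u' r"
    and ract_pure: "r \<in> carrier R \<Longrightarrow> x \<in> carrier A \<Longrightarrow> y \<in> carrier A \<Longrightarrow>
      ract T (\<tau> x y) r = \<tau> x (y \<otimes> g r)"
    and tensor_induct: "u \<in> carrier T \<Longrightarrow> P \<zero>\<^bsub>T\<^esub> \<Longrightarrow>
      (\<And>x y. x \<in> carrier A \<Longrightarrow> y \<in> carrier A \<Longrightarrow> P (\<tau> x y)) \<Longrightarrow>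
      (\<And>u v. u \<in> carrier T \<Longrightarrow> v \<in> carrier T \<Longrightarrow> P u \<Longrightarrow> P v \<Longrightarrow> P (u \<oplus>\<^bsub>T\<^esub> v)) \<Longrightarrow> P u"
    and tensor_universal:
      "(\<And>x y. x \<in> carrier A \<Longrightarrow> y \<in> carrier A \<Longrightarrow> h x y \<in> carrier A) \<Longrightarrow>
      (\<And>x x' y. x \<in> carrier A \<Longrightarrow> x' \<in> carrier A \<Longrightarrow> y \<in> carrier A \<Longrightarrow> h (x \<oplus> x') y = h x y \<oplus> h x' y) \<Longrightarrow>
      (\<And>x y y'. x \<in> carrier A \<Longrightarrow> y \<in> carrier A \<Longrightarrow> y' \<in> carrier A \<Longrightarrow> h x (y \<oplus> y') = h x y \<oplus> h x y') \<Longrightarrow>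
      (\<And>x b y. x \<in> carrier A \<Longrightarrow> b \<in> carrier B \<Longrightarrow> y \<in> carrier A \<Longrightarrow> h (x \<otimes> \<beta> b) y = h x (\<beta> b \<otimes> y)) \<Longrightarrow>
      \<exists>H\<in>hom (add_monoid T) (add_monoid A). \<forall>x\<in>carrier A. \<forall>y\<in>carrier A. H (\<tau> x y) = h x y"

text \<open>The actions on a tensor product are defined by adding the subgroup of relations to the image
  of a coset; when the map preserves the relations, this is the coset of the image.\<close>

lemma coset_image:
  fixes S :: "'z set"
  defines "F \<equiv> free_Abelian_group S"
  assumes K: "subgroup K F" and K_image: "frag_extend \<psi> ` K \<subseteq> K"
    and a: "Poly_Mapping.keys a \<subseteq> S"
  shows "K <#>\<^bsub>F\<^esub> frag_extend \<psi> ` (K #>\<^bsub>F\<^esub> a) =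
    K #>\<^bsub>F\<^esub> frag_extend \<psi> a"
proof -
  have F_ops [simp]: "a \<otimes>\<^bsub>F\<^esub> b = a + b" "\<one>\<^bsub>F\<^esub> = 0" for a b by (simp_all add: F_def)
  have 0: "0 \<in> K" using subgroup.one_closed[OF K] by simp
  have add: "k + k' \<in> K" if "k \<in> K" "k' \<in> K" for k k'
    using subgroup.m_closed[OF K that] by simp
  show ?thesis
  proof (intro equalityI subsetI)
    fix z assume "z \<in> K <#>\<^bsub>F\<^esub> frag_extend \<psi> ` (K #>\<^bsub>F\<^esub> a)"
    then obtain k k' where "k \<in> K" "k' \<in> K" and z: "z = k + frag_extend \<psi> (k' + a)"
      by (auto simp: set_mult_def r_coset_def)
    then have "k + frag_extend \<psi> k' \<in> K" using add K_image by auto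
    then show "z \<in> K #>\<^bsub>F\<^esub> frag_extend \<psi> a"
      unfolding z frag_extend_add r_coset_def by (auto simp flip: add.assoc)
  next
    fix z assume "z \<in> K #>\<^bsub>F\<^esub> frag_extend \<psi> a"
    then obtain k where "k \<in> K" "z = k + frag_extend \<psi> (0 + a)"
      by (auto simp: r_coset_def)
    moreover have "frag_extend \<psi> (0 + a) \<in> frag_extend \<psi> ` (K #>\<^bsub>F\<^esub> a)"
      unfolding r_coset_def using 0 by (intro imageI) (auto intro!: bexI[of _ 0])
    ultimately show "z \<in> K <#>\<^bsub>F\<^esub> frag_extend \<psi> ` (K #>\<^bsub>F\<^esub> a)"
      unfolding set_mult_def F_ops by blast
  qed
qed

theorem tensor_square_tensor:
  fixes A :: "('a, 'c) ring_scheme" (structure) and B :: "('b, 'b1) ring_scheme" and \<beta> :: "'b \<Rightarrow> 'a"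
    and L :: "('l, 'l1) ring_scheme" and f :: "'l \<Rightarrow> 'a" and R :: "('r, 'r1) ring_scheme" and g :: "'r \<Rightarrow> 'a"
  assumes "ring A" and \<beta>: "\<And>b. b \<in> carrier B \<Longrightarrow> \<beta> b \<in> carrier A"
    and f: "\<And>l. l \<in> carrier L \<Longrightarrow> f l \<in> carrier A" and g: "\<And>r. r \<in> carrier R \<Longrightarrow> g r \<in> carrier A"
  shows "\<exists>\<tau>. tensor_square A B \<beta> L f R g (tensor B (regular_bimodule A f \<beta>) (regular_bimodule A \<beta> g)) \<tau>"
proof -
  interpret A: ring A by fact
  define S where "S = carrier A \<times> carrier A"
  define F where "F = free_Abelian_group S"
  interpret F: comm_group F unfolding F_def by (rule abelian_free_Abelian_group)
  let ?X = "regular_bimodule A f \<beta>" and ?Y = "regular_bimodule A \<beta> g"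
  let ?T = "tensor B ?X ?Y"
  define rel where "rel =
     {frag_of (x \<oplus> x', y) - frag_of (x, y) - frag_of (x', y) | x x' y.
        x \<in> carrier A \<and> x' \<in> carrier A \<and> y \<in> carrier A} \<union>
     {frag_of (x, y \<oplus> y') - frag_of (x, y) - frag_of (x, y') | x y y'.
        x \<in> carrier A \<and> y \<in> carrier A \<and> y' \<in> carrier A} \<union>
     {frag_of (x \<otimes> \<beta> b, y) - frag_of (x, \<beta> b \<otimes> y) | x b y.
        x \<in> carrier A \<and> b \<in> carrier B \<and> y \<in> carrier A}"
  have rel_left: "frag_of (x \<oplus> x', y) - frag_of (x, y) - frag_of (x', y) \<in> rel"
    if "x \<in> carrier A" "x' \<in> carrier A" "y \<in> carrier A" for x x' y
    unfolding rel_def using that by blast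
  have rel_right: "frag_of (x, y \<oplus> y') - frag_of (x, y) - frag_of (x, y') \<in> rel"
    if "x \<in> carrier A" "y \<in> carrier A" "y' \<in> carrier A" for x y y'
    unfolding rel_def using that by blast
  have rel_balanced: "frag_of (x \<otimes> \<beta> b, y) - frag_of (x, \<beta> b \<otimes> y) \<in> rel"
    if "x \<in> carrier A" "b \<in> carrier B" "y \<in> carrier A" for x b y
    unfolding rel_def using that by blast
  have rel_cases: thesis
    if "c \<in> rel"
      and "\<And>x x' y. x \<in> carrier A \<Longrightarrow> x' \<in> carrier A \<Longrightarrow> y \<in> carrier A \<Longrightarrow>
        c = frag_of (x \<oplus> x', y) - frag_of (x, y) - frag_of (x', y) \<Longrightarrow> thesis"
      and "\<And>x y y'. x \<in> carrier A \<Longrightarrow> y \<in> carrier A \<Longrightarrow> y' \<in> carrier A \<Longrightarrow>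
        c = frag_of (x, y \<oplus> y') - frag_of (x, y) - frag_of (x, y') \<Longrightarrow> thesis"
      and "\<And>x b y. x \<in> carrier A \<Longrightarrow> b \<in> carrier B \<Longrightarrow> y \<in> carrier A \<Longrightarrow>
        c = frag_of (x \<otimes> \<beta> b, y) - frag_of (x, \<beta> b \<otimes> y) \<Longrightarrow> thesis"
    for c thesis
    using that(1) unfolding rel_def by (elim UnE CollectE exE conjE) (rule that(2-4); assumption)+
  define K where "K = generate F rel"
  have K_eq: "tensor_relations B ?X ?Y = K"
    by (simp add: tensor_relations_def K_def F_def S_def rel_def regular_bimodule_def)
  have regular: "carrier (regular_bimodule A p q) = carrier A"
    "lact (regular_bimodule A p q) l z = p l \<otimes> z" "ract (regular_bimodule A p q) z r = z \<otimes> q r"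
    for p :: "'i \<Rightarrow> 'a" and q :: "'j \<Rightarrow> 'a" and l r z
    by (simp_all add: regular_bimodule_def)
  have carF: "a \<in> carrier F \<longleftrightarrow> Poly_Mapping.keys a \<subseteq> S" for a by (simp add: F_def)
  have [simp]: "a \<otimes>\<^bsub>F\<^esub> b = a + b" "\<one>\<^bsub>F\<^esub> = 0" for a b by (simp_all add: F_def)
  have frag: "frag_of (x, y) \<in> carrier F" if "x \<in> carrier A" "y \<in> carrier A" for x y
    using that by (simp add: F_def S_def)
  have diff: "a - b \<in> carrier F" if "a \<in> carrier F" "b \<in> carrier F" for a b
    using that keys_diff[of a b] by (auto simp: carF)
  have rel: "rel \<subseteq> carrier F"
    unfolding rel_def by (auto intro!: diff frag \<beta>)
  have K: "subgroup K F" unfolding K_def by (rule F.generate_is_subgroup[OF rel])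
  then have KS: "subgroup K (free_Abelian_group S)" by (simp add: F_def)
  have K_norm: "K \<lhd> F" using K by (rule F.subgroup_imp_normal)
  have relK: "c \<in> rel \<Longrightarrow> c \<in> K" for c unfolding K_def by (rule generate.incl)
  define cls where "cls a = K #>\<^bsub>F\<^esub> a" for a
  have cls_eq: "cls a = cls b" if "a \<in> carrier F" "b \<in> carrier F" "a - b \<in> K" for a b
  proof -
    have "a \<in> K #>\<^bsub>F\<^esub> b"
      unfolding r_coset_def using that(3) by (auto intro!: bexI[of _ "a - b"])
    then show ?thesis
      unfolding cls_def using F.repr_independence[OF _ that(2) K] by simp
  qed
  have cls_add: "cls a <#>\<^bsub>F\<^esub> cls b = cls (a + b)" if "a \<in> carrier F" "b \<in> carrier F" for a b
    unfolding cls_def using normal.rcos_sum[OF K_norm that] by simp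
  have T_car: "carrier ?T = cls ` carrier F"
    and T_add: "u \<oplus>\<^bsub>?T\<^esub> v = u <#>\<^bsub>F\<^esub> v" and T_zero: "\<zero>\<^bsub>?T\<^esub> = K" for u v
    by (simp_all add: tensor_def Let_def K_eq F_def S_def cls_def carrier_FactGroup regular)
  have K_cls: "K = cls 0"
    unfolding cls_def using F.coset_mult_one[of K] subgroup.subset[OF K] by simp
  have plus: "a + b \<in> carrier F" if "a \<in> carrier F" "b \<in> carrier F" for a b
    using F.m_closed[OF that] by simp
  have zero: "0 \<in> carrier F" using F.one_closed by simp
  have T_group: "abelian_group ?T"
  proof (rule abelian_groupI)
    fix u v w assume "u \<in> carrier ?T" "v \<in> carrier ?T"
    then obtain a b where ab: "a \<in> carrier F" "u = cls a" "b \<in> carrier F" "v = cls b"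
      by (auto simp: T_car)
    show "u \<oplus>\<^bsub>?T\<^esub> v \<in> carrier ?T" "u \<oplus>\<^bsub>?T\<^esub> v = v \<oplus>\<^bsub>?T\<^esub> u"
      using ab by (auto simp: T_car T_add cls_add plus add.commute)
    assume "w \<in> carrier ?T"
    then obtain c where c: "c \<in> carrier F" "w = cls c" by (auto simp: T_car)
    show "u \<oplus>\<^bsub>?T\<^esub> v \<oplus>\<^bsub>?T\<^esub> w = u \<oplus>\<^bsub>?T\<^esub> (v \<oplus>\<^bsub>?T\<^esub> w)"
      using ab c by (simp add: T_add cls_add plus add.assoc)
  next
    show "\<zero>\<^bsub>?T\<^esub> \<in> carrier ?T" using zero by (auto simp: T_car T_zero K_cls)
  next
    fix u assume "u \<in> carrier ?T"
    then obtain a where a: "a \<in> carrier F" "u = cls a" by (auto simp: T_car)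
    show "\<zero>\<^bsub>?T\<^esub> \<oplus>\<^bsub>?T\<^esub> u = u" using a zero by (simp add: T_add T_zero K_cls cls_add)
    show "\<exists>v\<in>carrier ?T. v \<oplus>\<^bsub>?T\<^esub> u = \<zero>\<^bsub>?T\<^esub>"
      using a diff[OF zero a(1)]
      by (intro bexI[of _ "cls (0 - a)"]) (auto simp: T_add T_zero K_cls cls_add T_car)
  qed
  have hom_K: "frag_extend \<psi> ` K \<subseteq> K"
    if rel: "\<And>c. c \<in> rel \<Longrightarrow> frag_extend \<psi> c \<in> K" for \<psi>
  proof -
    have "frag_extend \<psi> c \<in> K" if "c \<in> K" for c
      using that unfolding K_def
    proof (induction rule: generate.induct)
      case one
      then show ?case using generate.one[of F rel] by simp
    next
      case (incl h)
      then show ?case using \<open>\<And>c. c \<in> rel \<Longrightarrow> frag_extend \<psi> c \<in> K\<close> by (simp add: K_def)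
    next
      case (inv h)
      have hF: "Poly_Mapping.keys h \<subseteq> S"
        using inv \<open>rel \<subseteq> carrier F\<close> carF by auto
      have k: "frag_extend \<psi> h \<in> K" using inv rel by simp
      then have "Poly_Mapping.keys (frag_extend \<psi> h) \<subseteq> S"
        using subgroup.subset[OF K] carF by auto
      then have "- frag_extend \<psi> h \<in> K"
        using subgroup.m_inv_closed[OF K k] by (simp add: F_def)
      then show ?case using hF by (simp add: F_def frag_extend_minus K_def[unfolded F_def])
    next
      case (eng a b)
      then show ?case using subgroup.m_closed[OF K] by (simp add: K_def frag_extend_add)
    qed
    then show ?thesis by blast
  qed
  have map_K: "frag_extend (\<lambda>(x, y). frag_of (p x, q y)) ` K \<subseteq> K"
    if p: "p \<in> carrier A \<rightarrow> carrier A" "\<And>x x'. x \<in> carrier A \<Longrightarrow> x' \<in> carrier A \<Longrightarrow> p (x \<oplus> x') = p x \<oplus> p x'"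
        "\<And>x b. x \<in> carrier A \<Longrightarrow> b \<in> carrier B \<Longrightarrow> p (x \<otimes> \<beta> b) = p x \<otimes> \<beta> b"
      and q: "q \<in> carrier A \<rightarrow> carrier A" "\<And>y y'. y \<in> carrier A \<Longrightarrow> y' \<in> carrier A \<Longrightarrow> q (y \<oplus> y') = q y \<oplus> q y'"
        "\<And>y b. y \<in> carrier A \<Longrightarrow> b \<in> carrier B \<Longrightarrow> q (\<beta> b \<otimes> y) = \<beta> b \<otimes> q y"
    for p q
  proof (rule hom_K)
    fix c assume "c \<in> rel"
    then have "frag_extend (\<lambda>(x, y). frag_of (p x, q y)) c \<in> rel"
    proof (rule rel_cases)
      fix x x' y assume "x \<in> carrier A" "x' \<in> carrier A" "y \<in> carrier A"
        "c = frag_of (x \<oplus> x', y) - frag_of (x, y) - frag_of (x', y)"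
      then show ?thesis
        using p q rel_left[of "p x" "p x'" "q y"] by (simp add: frag_extend_diff Pi_iff)
    next
      fix x y y' assume "x \<in> carrier A" "y \<in> carrier A" "y' \<in> carrier A"
        "c = frag_of (x, y \<oplus> y') - frag_of (x, y) - frag_of (x, y')"
      then show ?thesis
        using p q rel_right[of "p x" "q y" "q y'"] by (simp add: frag_extend_diff Pi_iff)
    next
      fix x b y assume "x \<in> carrier A" "b \<in> carrier B" "y \<in> carrier A"
        "c = frag_of (x \<otimes> \<beta> b, y) - frag_of (x, \<beta> b \<otimes> y)"
      then show ?thesis
        using p q rel_balanced[of "p x" b "q y"] by (simp add: frag_extend_diff Pi_iff)
    qed
    then show "frag_extend (\<lambda>(x, y). frag_of (p x, q y)) c \<in> K" by (rule relK)
  qed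
  have lact_cls: "lact ?T l (cls a) = cls (frag_extend (\<lambda>(x, y). frag_of (f l \<otimes> x, y)) a)"
    if l: "l \<in> carrier L" and a: "a \<in> carrier F" for l a
  proof -
    have "frag_extend (\<lambda>(x, y). frag_of (f l \<otimes> x, y)) ` K \<subseteq> K"
      using f[OF l] \<beta> by (intro map_K) (auto simp: A.r_distr A.m_assoc)
    from coset_image[OF KS this, of a] a show ?thesis
      by (simp add: tensor_def Let_def K_eq cls_def F_def S_def regular)
  qed
  have ract_cls: "ract ?T (cls a) r = cls (frag_extend (\<lambda>(x, y). frag_of (x, y \<otimes> g r)) a)"
    if r: "r \<in> carrier R" and a: "a \<in> carrier F" for r a
  proof -
    have "frag_extend (\<lambda>(x, y). frag_of (x, y \<otimes> g r)) ` K \<subseteq> K"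
      using g[OF r] \<beta> by (intro map_K) (auto simp: A.l_distr A.m_assoc)
    from coset_image[OF KS this, of a] a show ?thesis
      by (simp add: tensor_def Let_def K_eq cls_def F_def S_def regular)
  qed
  have ext_closed: "frag_extend \<psi> a \<in> carrier F"
    if "a \<in> carrier F" "\<And>s. s \<in> S \<Longrightarrow> \<psi> s \<in> carrier F" for a and \<psi> :: "'a \<times> 'a \<Rightarrow> 'a \<times> 'a \<Rightarrow>\<^sub>0 int"
    using that keys_frag_extend[of \<psi> a] unfolding carF by blast
  have l_closed: "frag_extend (\<lambda>(x, y). frag_of (f l \<otimes> x, y)) a \<in> carrier F"
    if "l \<in> carrier L" "a \<in> carrier F" for l a
    using that f by (intro ext_closed) (auto simp: S_def intro!: frag)
  have r_closed: "frag_extend (\<lambda>(x, y). frag_of (x, y \<otimes> g r)) a \<in> carrier F"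
    if "r \<in> carrier R" "a \<in> carrier F" for r a
    using that g by (intro ext_closed) (auto simp: S_def intro!: frag)
  define \<tau> where "\<tau> x y = cls (frag_of (x, y))" for x y
  have "tensor_square A B \<beta> L f R g ?T \<tau>"
  proof (intro tensor_square.intro tensor_square_axioms.intro \<open>ring A\<close> T_group \<beta> f g)
    fix x x' y assume x: "x \<in> carrier A" "x' \<in> carrier A" "y \<in> carrier A"
    show "\<tau> x y \<in> carrier ?T" unfolding \<tau>_def T_car using frag x by blast
    have "frag_of (x \<oplus> x', y) - (frag_of (x, y) + frag_of (x', y)) \<in> rel"
      unfolding diff_diff_eq[symmetric] using x by (intro rel_left rel_right)
    then show "\<tau> (x \<oplus> x') y = \<tau> x y \<oplus>\<^bsub>?T\<^esub> \<tau> x' y"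
      unfolding \<tau>_def T_add using x by (simp add: cls_add frag, intro cls_eq) (simp_all add: frag plus relK)
  next
    fix x y y' assume x: "x \<in> carrier A" "y \<in> carrier A" "y' \<in> carrier A"
    have "frag_of (x, y \<oplus> y') - (frag_of (x, y) + frag_of (x, y')) \<in> rel"
      unfolding diff_diff_eq[symmetric] using x by (intro rel_left rel_right)
    then show "\<tau> x (y \<oplus> y') = \<tau> x y \<oplus>\<^bsub>?T\<^esub> \<tau> x y'"
      unfolding \<tau>_def T_add using x by (simp add: cls_add frag, intro cls_eq) (simp_all add: frag plus relK)
  next
    fix x b y assume x: "x \<in> carrier A" "b \<in> carrier B" "y \<in> carrier A"
    have "frag_of (x \<otimes> \<beta> b, y) - frag_of (x, \<beta> b \<otimes> y) \<in> rel"
      using x by (rule rel_balanced)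
    then show "\<tau> (x \<otimes> \<beta> b) y = \<tau> x (\<beta> b \<otimes> y)"
      unfolding \<tau>_def using x \<beta> by (intro cls_eq) (simp_all add: frag relK)
  next
    fix l u u' assume l: "l \<in> carrier L" and "u \<in> carrier ?T" "u' \<in> carrier ?T"
    then obtain a b where ab: "a \<in> carrier F" "u = cls a" "b \<in> carrier F" "u' = cls b"
      by (auto simp: T_car)
    show "lact ?T l u \<in> carrier ?T"
      using ab l by (auto simp: lact_cls T_car intro!: l_closed)
    show "lact ?T l (u \<oplus>\<^bsub>?T\<^esub> u') = lact ?T l u \<oplus>\<^bsub>?T\<^esub> lact ?T l u'"
      using ab l by (simp add: T_add cls_add lact_cls plus l_closed frag_extend_add)
  next
    fix l x y assume "l \<in> carrier L" "x \<in> carrier A" "y \<in> carrier A"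
    then show "lact ?T l (\<tau> x y) = \<tau> (f l \<otimes> x) y"
      by (simp add: \<tau>_def lact_cls frag)
  next
    fix r u u' assume r: "r \<in> carrier R" and "u \<in> carrier ?T" "u' \<in> carrier ?T"
    then obtain a b where ab: "a \<in> carrier F" "u = cls a" "b \<in> carrier F" "u' = cls b"
      by (auto simp: T_car)
    show "ract ?T u r \<in> carrier ?T"
      using ab r by (auto simp: ract_cls T_car intro!: r_closed)
    show "ract ?T (u \<oplus>\<^bsub>?T\<^esub> u') r = ract ?T u r \<oplus>\<^bsub>?T\<^esub> ract ?T u' r"
      using ab r by (simp add: T_add cls_add ract_cls plus r_closed frag_extend_add)
  next
    fix r x y assume "r \<in> carrier R" "x \<in> carrier A" "y \<in> carrier A"
    then show "ract ?T (\<tau> x y) r = \<tau> x (y \<otimes> g r)"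
      by (simp add: \<tau>_def ract_cls frag)
  next
    fix u P
    assume u: "u \<in> carrier ?T" and 0: "P \<zero>\<^bsub>?T\<^esub>"
      and pure: "\<And>x y. x \<in> carrier A \<Longrightarrow> y \<in> carrier A \<Longrightarrow> P (\<tau> x y)"
      and add: "\<And>u v. u \<in> carrier ?T \<Longrightarrow> v \<in> carrier ?T \<Longrightarrow> P u \<Longrightarrow> P v \<Longrightarrow> P (u \<oplus>\<^bsub>?T\<^esub> v)"
    have plusP: "P (cls (a + b))" if "a \<in> carrier F" "b \<in> carrier F" "P (cls a)" "P (cls b)" for a b
      using add[of "cls a" "cls b"] that by (simp add: T_car T_add cls_add)
    \<comment> \<open>The free group is generated under differences, but \<open>- (x \<otimes> y) = (- x) \<otimes> y\<close> is again pure.\<close>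
    have neg: "P (cls (- frag_of (x, y)))" if x: "x \<in> carrier A" "y \<in> carrier A" for x y
    proof -
      have "frag_of (\<ominus> x \<oplus> x, y) - frag_of (\<ominus> x, y) - frag_of (x, y) \<in> K"
        using x by (intro relK rel_left) auto
      moreover have "frag_of (\<zero> \<oplus> \<zero>, y) - frag_of (\<zero>, y) - frag_of (\<zero>, y) \<in> K"
        using x by (intro relK rel_left) auto
      ultimately have "- frag_of (\<ominus> x, y) - frag_of (x, y) \<in> K"
        using x subgroup.m_closed[OF K, of "frag_of (\<zero>, y) - frag_of (\<ominus> x, y) - frag_of (x, y)" "- frag_of (\<zero>, y)"]
        by (simp add: A.l_neg)
      moreover have "- frag_of (x, y) - frag_of (\<ominus> x, y) = - frag_of (\<ominus> x, y) - frag_of (x, y)"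
        by (metis diff_conv_add_uminus add.commute)
      ultimately have "- frag_of (x, y) - frag_of (\<ominus> x, y) \<in> K" by (simp only:)
      moreover have "- frag_of (x, y) \<in> carrier F" using frag[OF x] by (simp add: carF)
      ultimately have "cls (- frag_of (x, y)) = cls (frag_of (\<ominus> x, y))"
        using x by (intro cls_eq) (simp_all add: frag)
      then show ?thesis using pure[of "\<ominus> x" y] x by (simp add: \<tau>_def)
    qed
    have "a \<in> carrier F \<and> P (cls a) \<and> - a \<in> carrier F \<and> P (cls (- a))" if "Poly_Mapping.keys a \<subseteq> S" for a
      using that
    proof (induction a rule: free_Abelian_group_induct[consumes 1])
      case 1
      then show ?case using 0 zero by (simp add: T_zero K_cls)
    next
      case (2 a b)
      then show ?case using plusP[of a "- b"] plusP[of b "- a"] plus[of a "- b"] plus[of b "- a"] by simp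
    next
      case (3 s)
      then obtain x y where s: "s = (x, y)" "x \<in> carrier A" "y \<in> carrier A" by (auto simp: S_def)
      then show ?case using pure[of x y] neg[of x y] frag[of x y] by (simp add: \<tau>_def carF)
    qed
    then show "P u" using u by (auto simp: T_car carF)
  next
    fix h
    assume h: "\<And>x y. x \<in> carrier A \<Longrightarrow> y \<in> carrier A \<Longrightarrow> h x y \<in> carrier A"
      and hl: "\<And>x x' y. x \<in> carrier A \<Longrightarrow> x' \<in> carrier A \<Longrightarrow> y \<in> carrier A \<Longrightarrow>
        h (x \<oplus> x') y = h x y \<oplus> h x' y"
      and hr: "\<And>x y y'. x \<in> carrier A \<Longrightarrow> y \<in> carrier A \<Longrightarrow> y' \<in> carrier A \<Longrightarrow>
        h x (y \<oplus> y') = h x y \<oplus> h x y'"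
      and hb: "\<And>x b y. x \<in> carrier A \<Longrightarrow> b \<in> carrier B \<Longrightarrow> y \<in> carrier A \<Longrightarrow>
        h (x \<otimes> \<beta> b) y = h x (\<beta> b \<otimes> y)"
    have "(\<lambda>(x, y). h x y) ` S \<subseteq> carrier (add_monoid A)"
      using h by (auto simp: S_def)
    then obtain H0 where H0: "H0 \<in> hom F (add_monoid A)"
      and H0_frag: "\<And>s. s \<in> S \<Longrightarrow> H0 (frag_of s) = (\<lambda>(x, y). h x y) s"
      unfolding F_def by (rule comm_group.free_Abelian_group_universal[OF A.a_comm_group]) blast
    interpret H0: group_hom F "add_monoid A" H0
      using H0 by (simp add: group_hom_def group_hom_axioms_def F.is_group A.a_group)
    have H0f: "H0 (frag_of (x, y)) = h x y" if "x \<in> carrier A" "y \<in> carrier A" for x y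
      using H0_frag[of "(x, y)"] that by (simp add: S_def)
    have H0d: "H0 (a - b) = H0 a \<ominus> H0 b" if "a \<in> carrier F" "b \<in> carrier F" for a b
    proof -
      have "H0 (a - b) \<oplus> H0 b = H0 a"
        using H0.hom_mult[OF diff[OF that] that(2)] by simp
      moreover have "H0 (a - b) \<in> carrier A" "H0 b \<in> carrier A"
        using H0.hom_closed[OF diff[OF that]] H0.hom_closed[OF that(2)] by auto
      ultimately show ?thesis
        using A.a_assoc[of "H0 (a - b)" "H0 b" "\<ominus> H0 b"] by (simp add: A.minus_eq A.r_neg)
    qed
    have "rel \<subseteq> kernel F (add_monoid A) H0"
    proof
      fix c assume c: "c \<in> rel"
      have "H0 c = \<zero>"
        using c
      proof (rule rel_cases)
        fix x x' y assume "x \<in> carrier A" "x' \<in> carrier A" "y \<in> carrier A"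
          "c = frag_of (x \<oplus> x', y) - frag_of (x, y) - frag_of (x', y)"
        then show ?thesis
          using h[of x y] h[of x' y] by (simp add: H0d H0f frag diff hl A.minus_eq A.a_assoc A.r_neg A.r_neg1 A.a_lcomm)
      next
        fix x y y' assume "x \<in> carrier A" "y \<in> carrier A" "y' \<in> carrier A"
          "c = frag_of (x, y \<oplus> y') - frag_of (x, y) - frag_of (x, y')"
        then show ?thesis
          using h[of x y] h[of x y'] by (simp add: H0d H0f frag diff hr A.minus_eq A.a_assoc A.r_neg A.r_neg1 A.a_lcomm)
      next
        fix x b y assume "x \<in> carrier A" "b \<in> carrier B" "y \<in> carrier A"
          "c = frag_of (x \<otimes> \<beta> b, y) - frag_of (x, \<beta> b \<otimes> y)"
        then show ?thesis
          using \<beta>[of b] h[of x "\<beta> b \<otimes> y"] by (simp add: H0d H0f frag hb A.minus_eq A.r_neg)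
      qed
      then show "c \<in> kernel F (add_monoid A) H0"
        using c \<open>rel \<subseteq> carrier F\<close> by (auto simp: kernel_def)
    qed
    then have K_ker: "K \<subseteq> kernel F (add_monoid A) H0"
      unfolding K_def by (rule F.generate_subgroup_incl[OF _ H0.subgroup_kernel])
    obtain H where H: "H \<in> hom (F Mod K) (add_monoid A)"
      and H_cls: "\<And>a. a \<in> carrier F \<Longrightarrow> H (K #>\<^bsub>F\<^esub> a) = H0 a"
    proof (rule FactGroup_universal[OF H0 K_norm])
      fix a b assume ab: "a \<in> carrier F" "b \<in> carrier F" "K #>\<^bsub>F\<^esub> a = K #>\<^bsub>F\<^esub> b"
      have "a \<in> K #>\<^bsub>F\<^esub> b" using F.rcos_self[OF ab(1) K] ab(3) by simp
      then obtain c where "c \<in> K" "a = c + b" by (auto simp: r_coset_def)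
      moreover have "c \<in> carrier F" "H0 c = \<zero>"
        using \<open>c \<in> K\<close> K_ker by (auto simp: kernel_def)
      ultimately show "H0 a = H0 b"
        using H0.hom_mult[of c b] H0.hom_closed[OF ab(2)] ab(2) by simp
    qed blast
    have "H \<in> hom (add_monoid ?T) (add_monoid A)"
      using H by (simp add: hom_def T_add T_car carrier_FactGroup cls_def[abs_def])
    moreover have "H (\<tau> x y) = h x y" if "x \<in> carrier A" "y \<in> carrier A" for x y
      using that by (simp add: \<tau>_def cls_def H_cls frag H0f)
    ultimately show "\<exists>H\<in>hom (add_monoid ?T) (add_monoid A).
        \<forall>x\<in>carrier A. \<forall>y\<in>carrier A. H (\<tau> x y) = h x y"
      by blast
  qed
  then show ?thesis by blast
qed

section \<open>Direct summands and retractions\<close>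

text \<open>Additivity of the two actions makes the projection to a summand and the kernel of a bimodule map
  compatible with them.\<close>

locale biaction = abelian_group X
  for L :: "('l, 'l1) ring_scheme" and R :: "('r, 'r1) ring_scheme" and X :: "('l, 'r, 'm) bimodule" (structure) +
  assumes lact_closed [simp]: "l \<in> carrier L \<Longrightarrow> x \<in> carrier X \<Longrightarrow> lact X l x \<in> carrier X"
    and lact_add: "l \<in> carrier L \<Longrightarrow> x \<in> carrier X \<Longrightarrow> y \<in> carrier X \<Longrightarrow>
      lact X l (x \<oplus> y) = lact X l x \<oplus> lact X l y"
    and ract_closed [simp]: "r \<in> carrier R \<Longrightarrow> x \<in> carrier X \<Longrightarrow> ract X x r \<in> carrier X"
    and ract_add: "r \<in> carrier R \<Longrightarrow> x \<in> carrier X \<Longrightarrow> y \<in> carrier X \<Longrightarrow>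
      ract X (x \<oplus> y) r = ract X x r \<oplus> ract X y r"
begin

lemma lact_zero: "l \<in> carrier L \<Longrightarrow> lact X l \<zero> = \<zero>"
  using lact_add[of l \<zero> \<zero>] add.r_cancel_one'[of "lact X l \<zero>" "lact X l \<zero>"] by simp

lemma ract_zero: "r \<in> carrier R \<Longrightarrow> ract X \<zero> r = \<zero>"
  using ract_add[of r \<zero> \<zero>] add.r_cancel_one'[of "ract X \<zero> r" "ract X \<zero> r"] by simp

end

lemma additive_zero:
  assumes "abelian_group G" "abelian_group H" "h \<in> hom (add_monoid G) (add_monoid H)"
  shows "h \<zero>\<^bsub>G\<^esub> = \<zero>\<^bsub>H\<^esub>"
  using additive_finsum[OF assms, of "{}"] assms
  by (simp add: abelian_monoid.finsum_empty abelian_group_def)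

lemma bimodule_homD:
  assumes "h \<in> bimodule_hom L R X Y"
  shows "h \<in> hom (add_monoid X) (add_monoid Y)"
    and "x \<in> carrier X \<Longrightarrow> h x \<in> carrier Y"
    and "x \<in> carrier X \<Longrightarrow> y \<in> carrier X \<Longrightarrow> h (x \<oplus>\<^bsub>X\<^esub> y) = h x \<oplus>\<^bsub>Y\<^esub> h y"
    and "l \<in> carrier L \<Longrightarrow> x \<in> carrier X \<Longrightarrow> h (lact X l x) = lact Y l (h x)"
    and "r \<in> carrier R \<Longrightarrow> x \<in> carrier X \<Longrightarrow> h (ract X x r) = ract Y (h x) r"
  using assms by (auto simp: bimodule_hom_def hom_def)

lemma retraction_of_summand:
  assumes "biaction L R X" "biaction L R Y" and "iso_to_direct_summand L R X Y"
  obtains h q where "h \<in> bimodule_hom L R X Y" "q \<in> bimodule_hom L R Y X"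
    "\<forall>x\<in>carrier X. q (h x) = x"
proof -
  interpret X: biaction L R X by fact
  interpret Y: biaction L R Y by fact
  obtain P Q h where Q: "subbimodule L R Q Y" and PQ: "P \<inter> Q = {\<zero>\<^bsub>Y\<^esub>}" "P <+>\<^bsub>Y\<^esub> Q = carrier Y"
    and P: "subbimodule L R P Y"
    and h: "h \<in> bimodule_hom L R X Y" and bij: "bij_betw h (carrier X) P"
    using assms(3) unfolding iso_to_direct_summand_def direct_summand_def by blast
  note H = bimodule_homD[OF h]
  have Qg: "subgroup Q (add_monoid Y)" and Pg: "subgroup P (add_monoid Y)"
    using P Q by (auto simp: subbimodule_def)
  have Qc: "c \<in> carrier Y" if "c \<in> Q" for c using subgroup.subset[OF Qg] that by auto
  have Qadd: "c \<oplus>\<^bsub>Y\<^esub> d \<in> Q" if "c \<in> Q" "d \<in> Q" for c d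
    using subgroup.m_closed[OF Qg] that by simp
  have Q0: "\<zero>\<^bsub>Y\<^esub> \<in> Q" using subgroup.one_closed[OF Qg] by simp
  have diff: "a \<ominus>\<^bsub>Y\<^esub> b \<in> S" if "a \<in> S" "b \<in> S" "subgroup S (add_monoid Y)" for a b S
    using subgroup.m_closed[OF that(3) that(1) subgroup.m_inv_closed[OF that(3) that(2)]]
    by (simp add: a_minus_def a_inv_def)
  have decomp: "\<exists>x\<in>carrier X. \<exists>c\<in>Q. y = h x \<oplus>\<^bsub>Y\<^esub> c" if "y \<in> carrier Y" for y
  proof -
    have "y \<in> P <+>\<^bsub>Y\<^esub> Q" using that PQ(2) by simp
    then obtain p c where "p \<in> P" "c \<in> Q" "y = p \<oplus>\<^bsub>Y\<^esub> c"
      by (auto simp: set_add_def set_mult_def)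
    moreover obtain x where "x \<in> carrier X" "p = h x"
      using \<open>p \<in> P\<close> bij by (auto simp: bij_betw_def)
    ultimately show ?thesis by blast
  qed
  have unique: "x = x'"
    if x: "x \<in> carrier X" "x' \<in> carrier X" and c: "c \<in> Q" "c' \<in> Q" and eq: "h x \<oplus>\<^bsub>Y\<^esub> c = h x' \<oplus>\<^bsub>Y\<^esub> c'"
    for x x' c c'
  proof -
    have hx: "h x \<in> P" "h x' \<in> P" "h x \<in> carrier Y" "h x' \<in> carrier Y"
      using x bij H by (auto simp: bij_betw_def)
    have "h x = h x' \<oplus>\<^bsub>Y\<^esub> c' \<ominus>\<^bsub>Y\<^esub> c"
      using eq hx c Qc Y.a_assoc[of "h x" c "\<ominus>\<^bsub>Y\<^esub> c"] by (simp add: Y.minus_eq Y.r_neg)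
    also have "\<dots> = c' \<ominus>\<^bsub>Y\<^esub> c \<oplus>\<^bsub>Y\<^esub> h x'"
      using hx c Qc by (simp add: Y.minus_eq Y.a_ac)
    finally have "h x \<ominus>\<^bsub>Y\<^esub> h x' = c' \<ominus>\<^bsub>Y\<^esub> c \<oplus>\<^bsub>Y\<^esub> h x' \<ominus>\<^bsub>Y\<^esub> h x'" by simp
    also have "\<dots> = c' \<ominus>\<^bsub>Y\<^esub> c"
      using hx c Qc by (simp add: Y.minus_eq Y.a_assoc Y.r_neg)
    finally have "h x \<ominus>\<^bsub>Y\<^esub> h x' = c' \<ominus>\<^bsub>Y\<^esub> c" .
    then have "h x \<ominus>\<^bsub>Y\<^esub> h x' \<in> P \<inter> Q"
      using diff[OF hx(1,2) Pg] diff[OF c(2,1) Qg] by simp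
    then have "h x \<ominus>\<^bsub>Y\<^esub> h x' = \<zero>\<^bsub>Y\<^esub>" using PQ by blast
    then have "h x \<oplus>\<^bsub>Y\<^esub> (\<ominus>\<^bsub>Y\<^esub> h x' \<oplus>\<^bsub>Y\<^esub> h x') = h x'"
      using hx(3,4) Y.a_assoc[of "h x" "\<ominus>\<^bsub>Y\<^esub> h x'" "h x'"] by (simp add: Y.minus_eq)
    then have "h x = h x'" using hx(3,4) by (simp add: Y.l_neg)
    then show ?thesis using bij x by (auto simp: bij_betw_def inj_on_def)
  qed
  obtain q where q: "\<forall>y\<in>carrier Y. q y \<in> carrier X \<and> (\<exists>c\<in>Q. y = h (q y) \<oplus>\<^bsub>Y\<^esub> c)"
    using bchoice[of "carrier Y" "\<lambda>y x. x \<in> carrier X \<and> (\<exists>c\<in>Q. y = h x \<oplus>\<^bsub>Y\<^esub> c)"] decomp by blast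
  have qI: "q y = x" if "x \<in> carrier X" "c \<in> Q" "y = h x \<oplus>\<^bsub>Y\<^esub> c" for y x c
  proof -
    have "y \<in> carrier Y" using that H Qc by simp
    then obtain c' where "c' \<in> Q" "q y \<in> carrier X" "y = h (q y) \<oplus>\<^bsub>Y\<^esub> c'" using q by blast
    then show ?thesis using unique[of "q y" x c' c] that by simp
  qed
  have "q \<in> bimodule_hom L R Y X"
  proof -
    have "q (y \<oplus>\<^bsub>Y\<^esub> z) = q y \<oplus>\<^bsub>X\<^esub> q z" if "y \<in> carrier Y" "z \<in> carrier Y" for y z
    proof -
      obtain c d where cd: "c \<in> Q" "y = h (q y) \<oplus>\<^bsub>Y\<^esub> c" "d \<in> Q" "z = h (q z) \<oplus>\<^bsub>Y\<^esub> d"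
        and qq: "q y \<in> carrier X" "q z \<in> carrier X"
        using q \<open>y \<in> carrier Y\<close> \<open>z \<in> carrier Y\<close> by blast
      have "y \<oplus>\<^bsub>Y\<^esub> z = (h (q y) \<oplus>\<^bsub>Y\<^esub> c) \<oplus>\<^bsub>Y\<^esub> (h (q z) \<oplus>\<^bsub>Y\<^esub> d)" using cd by simp
      also have "\<dots> = h (q y \<oplus>\<^bsub>X\<^esub> q z) \<oplus>\<^bsub>Y\<^esub> (c \<oplus>\<^bsub>Y\<^esub> d)"
        using qq H Qc cd(1,3) by (simp add: Y.a_ac)
      finally show ?thesis
        using qI[OF X.a_closed[OF qq] Qadd[OF cd(1,3)]] by blast
    qed
    moreover have "q (lact Y l y) = lact X l (q y)" if l: "l \<in> carrier L" and y: "y \<in> carrier Y" for l y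
    proof -
      obtain c where c: "c \<in> Q" "y = h (q y) \<oplus>\<^bsub>Y\<^esub> c" and qq: "q y \<in> carrier X" using q y by blast
      have "lact Y l y = lact Y l (h (q y) \<oplus>\<^bsub>Y\<^esub> c)" using c by simp
      also have "\<dots> = h (lact X l (q y)) \<oplus>\<^bsub>Y\<^esub> lact Y l c"
        using l qq c(1) Qc H by (simp add: Y.lact_add)
      finally show ?thesis
        using qI[of "lact X l (q y)" "lact Y l c" "lact Y l y"] l c(1) Q qq by (simp add: subbimodule_def)
    qed
    moreover have "q (ract Y y r) = ract X (q y) r" if r: "r \<in> carrier R" and y: "y \<in> carrier Y" for r y
    proof -
      obtain c where c: "c \<in> Q" "y = h (q y) \<oplus>\<^bsub>Y\<^esub> c" and qq: "q y \<in> carrier X" using q y by blast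
      have "ract Y y r = ract Y (h (q y) \<oplus>\<^bsub>Y\<^esub> c) r" using c by simp
      also have "\<dots> = h (ract X (q y) r) \<oplus>\<^bsub>Y\<^esub> ract Y c r"
        using r qq c(1) Qc H by (simp add: Y.ract_add)
      finally show ?thesis
        using qI[of "ract X (q y) r" "ract Y c r" "ract Y y r"] r c(1) Q qq by (simp add: subbimodule_def)
    qed
    ultimately show ?thesis
      using q by (auto simp: bimodule_hom_def hom_def)
  qed
  moreover have "\<forall>x\<in>carrier X. q (h x) = x"
    using qI[OF _ Q0] H by simp
  ultimately show thesis using that h by blast
qed

lemma summand_of_retraction:
  assumes "biaction L R X" "biaction L R Y"
    and h: "h \<in> bimodule_hom L R X Y" and q: "q \<in> bimodule_hom L R Y X"
    and qh: "\<And>x. x \<in> carrier X \<Longrightarrow> q (h x) = x"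
  shows "iso_to_direct_summand L R X Y"
proof -
  interpret X: biaction L R X by fact
  interpret Y: biaction L R Y by fact
  note H = bimodule_homD[OF h] and Q = bimodule_homD[OF q]
  interpret h: group_hom "add_monoid X" "add_monoid Y" h
    using H(1) by (simp add: group_hom_def group_hom_axioms_def X.a_group Y.a_group)
  interpret q: group_hom "add_monoid Y" "add_monoid X" q
    using Q(1) by (simp add: group_hom_def group_hom_axioms_def X.a_group Y.a_group)
  have h0: "h \<zero>\<^bsub>X\<^esub> = \<zero>\<^bsub>Y\<^esub>" using h.hom_one by simp
  have q0: "q \<zero>\<^bsub>Y\<^esub> = \<zero>\<^bsub>X\<^esub>" using q.hom_one by simp
  define P where "P = h ` carrier X"
  define K where "K = {y \<in> carrier Y. q y = \<zero>\<^bsub>X\<^esub>}"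
  have "subgroup P (add_monoid Y)"
    using h.img_is_subgroup by (simp add: P_def)
  moreover have "lact Y l y \<in> P" if "l \<in> carrier L" "y \<in> P" for l y
    using that H(4)[of l, symmetric] by (auto simp: P_def)
  moreover have "ract Y y r \<in> P" if "r \<in> carrier R" "y \<in> P" for r y
    using that H(5)[of r, symmetric] by (auto simp: P_def)
  ultimately have P: "subbimodule L R P Y"
    unfolding subbimodule_def by blast
  have "subgroup K (add_monoid Y)"
    using q.subgroup_kernel by (simp add: K_def kernel_def)
  then have K: "subbimodule L R K Y"
    unfolding subbimodule_def K_def using Q by (auto simp: X.lact_zero X.ract_zero)
  have "y \<in> P <+>\<^bsub>Y\<^esub> K" if y: "y \<in> carrier Y" for y
  proof -
    let ?p = "h (q y)"
    have p: "?p \<in> carrier Y" "?p \<in> P" using y H Q by (auto simp: P_def)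
    have "q (y \<ominus>\<^bsub>Y\<^esub> ?p) = q y \<oplus>\<^bsub>X\<^esub> q (\<ominus>\<^bsub>Y\<^esub> ?p)"
      using y p Q by (simp add: Y.minus_eq)
    also have "q (\<ominus>\<^bsub>Y\<^esub> ?p) = \<ominus>\<^bsub>X\<^esub> q ?p"
      using q.hom_inv[of ?p] p by (simp add: a_inv_def)
    finally have "y \<ominus>\<^bsub>Y\<^esub> ?p \<in> K"
      using y p Q qh[of "q y"] by (simp add: K_def X.r_neg Y.minus_eq)
    moreover have "y = ?p \<oplus>\<^bsub>Y\<^esub> (y \<ominus>\<^bsub>Y\<^esub> ?p)"
      using y p by (simp add: Y.minus_eq Y.a_ac Y.r_neg1 Y.r_neg)
    ultimately show ?thesis
      using p unfolding set_add_def set_mult_def by auto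
  qed
  then have "P <+>\<^bsub>Y\<^esub> K = carrier Y"
    using H by (auto simp: set_add_def set_mult_def P_def K_def)
  moreover have "P \<inter> K = {\<zero>\<^bsub>Y\<^esub>}"
  proof
    show "P \<inter> K \<subseteq> {\<zero>\<^bsub>Y\<^esub>}"
      using qh h0 by (auto simp: P_def K_def)
    show "{\<zero>\<^bsub>Y\<^esub>} \<subseteq> P \<inter> K"
      using h0 q0 by (auto simp: P_def K_def intro: image_eqI[of _ _ "\<zero>\<^bsub>X\<^esub>"])
  qed
  ultimately have "direct_summand L R P Y"
    using P K unfolding direct_summand_def by blast
  moreover have "bij_betw h (carrier X) P"
    unfolding P_def by (intro inj_on_imp_bij_betw inj_on_inverseI[of _ q] qh)
  ultimately show ?thesis
    using h unfolding iso_to_direct_summand_def by blast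
qed

lemma biaction_regular:
  assumes "ring A" "\<And>l. l \<in> carrier L \<Longrightarrow> f l \<in> carrier A" "\<And>r. r \<in> carrier R \<Longrightarrow> g r \<in> carrier A"
  shows "biaction L R (regular_bimodule A f g)"
proof -
  interpret ring A by fact
  have "abelian_group (regular_bimodule A f g)"
    by (rule abelian_groupI) (auto simp: regular_bimodule_def a_ac intro: bexI[of _ "\<ominus>\<^bsub>A\<^esub> _"] l_neg)
  then show ?thesis
    by (rule biaction.intro, intro biaction_axioms.intro)
      (auto simp: regular_bimodule_def assms l_distr r_distr)
qed

lemma biaction_power:
  assumes "biaction L R X"
  shows "biaction L R (bimodule_power n X)"
proof -
  interpret biaction L R X by fact
  have "abelian_group (bimodule_power n X)"
  proof (rule abelian_groupI)
    fix u assume u: "u \<in> carrier (bimodule_power n X)"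
    show "\<zero>\<^bsub>bimodule_power n X\<^esub> \<oplus>\<^bsub>bimodule_power n X\<^esub> u = u"
      using u by (auto simp: bimodule_power_def fun_eq_iff PiE_iff extensional_def)
    show "\<exists>w\<in>carrier (bimodule_power n X). w \<oplus>\<^bsub>bimodule_power n X\<^esub> u = \<zero>\<^bsub>bimodule_power n X\<^esub>"
      using u by (intro bexI[of _ "\<lambda>i\<in>{..<n}. \<ominus>\<^bsub>X\<^esub> u i"])
        (auto simp: bimodule_power_def fun_eq_iff PiE_iff extensional_def l_neg)
  qed (auto simp: bimodule_power_def fun_eq_iff PiE_iff extensional_def a_ac)
  then show ?thesis
    by (rule biaction.intro, intro biaction_axioms.intro)
      (auto simp: bimodule_power_def fun_eq_iff PiE_iff extensional_def lact_add ract_add)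
qed

section \<open>Depth conditions as product formulas\<close>

lemma (in tensor_square) biaction: "biaction L R T"
  using group by (intro biaction.intro biaction_axioms.intro) (simp_all add: lact_add ract_add)

lemma carrier_power: "carrier (bimodule_power n (regular_bimodule A p q)) = {..<n} \<rightarrow>\<^sub>E carrier A"
  and add_power: "y \<oplus>\<^bsub>bimodule_power n (regular_bimodule A p q)\<^esub> z = (\<lambda>i\<in>{..<n}. y i \<oplus>\<^bsub>A\<^esub> z i)"
  and lact_power: "lact (bimodule_power n (regular_bimodule A p q)) l y = (\<lambda>i\<in>{..<n}. p l \<otimes>\<^bsub>A\<^esub> y i)"
  and ract_power: "ract (bimodule_power n (regular_bimodule A p q)) y r = (\<lambda>i\<in>{..<n}. y i \<otimes>\<^bsub>A\<^esub> q r)"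
  by (simp_all add: bimodule_power_def regular_bimodule_def)

text \<open>A left linear map on a free module is determined by its values on the standard basis.\<close>

lemma power_expand:
  fixes A :: "('a, 'c) ring_scheme" (structure) and C :: "('r, 'r1) ring_scheme"
  assumes "ring A" and \<delta>: "\<And>c. c \<in> carrier C \<Longrightarrow> \<delta> c \<in> carrier A"
    and G: "G \<in> hom (add_monoid (bimodule_power n (regular_bimodule A id \<delta>))) (add_monoid A)"
    and lin: "\<And>a y. a \<in> carrier A \<Longrightarrow> y \<in> {..<n} \<rightarrow>\<^sub>E carrier A \<Longrightarrow>
      G (\<lambda>i\<in>{..<n}. a \<otimes> y i) = a \<otimes> G y"
    and y: "y \<in> {..<n} \<rightarrow>\<^sub>E carrier A"
  shows "G y = (\<Oplus>t\<in>{..<n}. y t \<otimes> G (\<lambda>i\<in>{..<n}. if i = t then \<one> else \<zero>))"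
proof -
  interpret A: ring A by fact
  let ?Y = "bimodule_power n (regular_bimodule A id \<delta>)"
  let ?e = "\<lambda>t. \<lambda>i\<in>{..<n}. if i = t then \<one> else \<zero>"
  let ?u = "\<lambda>t. \<lambda>i\<in>{..<n}. y t \<otimes> ?e t i"
  have "biaction A C ?Y"
    by (intro biaction_power biaction_regular \<open>ring A\<close>) (auto simp: \<delta>)
  then interpret Y: biaction A C ?Y .
  have carY: "carrier ?Y = {..<n} \<rightarrow>\<^sub>E carrier A"
    by (simp add: bimodule_power_def regular_bimodule_def)
  have yc: "y t \<in> carrier A" if "t < n" for t using y that by auto
  have e: "?e t \<in> {..<n} \<rightarrow>\<^sub>E carrier A" for t by auto
  have u: "?u \<in> {..<n} \<rightarrow> carrier ?Y" unfolding carY using yc by auto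
  have eval: "(\<lambda>z. z i) \<in> hom (add_monoid ?Y) (add_monoid A)" if "i < n" for i
    using that by (auto simp: hom_def bimodule_power_def regular_bimodule_def)
  have "(\<Oplus>\<^bsub>?Y\<^esub>t\<in>{..<n}. ?u t) = y"
  proof (rule PiE_ext)
    show "(\<Oplus>\<^bsub>?Y\<^esub>t\<in>{..<n}. ?u t) \<in> {..<n} \<rightarrow>\<^sub>E carrier A"
      using Y.finsum_closed[OF u] by (simp add: carY)
    show "y \<in> {..<n} \<rightarrow>\<^sub>E carrier A" by (rule y)
    fix i assume i: "i \<in> {..<n}"
    have "(\<Oplus>\<^bsub>?Y\<^esub>t\<in>{..<n}. ?u t) i = (\<Oplus>t\<in>{..<n}. ?u t i)"
      using i by (intro additive_finsum[where h = "\<lambda>z. z i"] Y.abelian_group_axioms A.is_abelian_group eval u) auto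
    also have "\<dots> = (\<Oplus>t\<in>{..<n}. if i = t then y t else \<zero>)"
      using i yc by (intro A.finsum_cong') auto
    also have "\<dots> = y i"
      using i yc by (intro A.finsum_singleton) auto
    finally show "(\<Oplus>\<^bsub>?Y\<^esub>t\<in>{..<n}. ?u t) i = y i" .
  qed
  then have "G y = G (\<Oplus>\<^bsub>?Y\<^esub>t\<in>{..<n}. ?u t)" by simp
  also have "\<dots> = (\<Oplus>t\<in>{..<n}. G (?u t))"
    by (rule additive_finsum[OF Y.abelian_group_axioms A.is_abelian_group G finite_lessThan u])
  also have "\<dots> = (\<Oplus>t\<in>{..<n}. y t \<otimes> G (?e t))"
  proof (intro A.finsum_cong' refl)
    fix t assume t: "t \<in> {..<n}"
    show "G (?u t) = y t \<otimes> G (?e t)"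
      using t yc by (intro lin e) auto
  next
    have "G z \<in> carrier A" if "z \<in> {..<n} \<rightarrow>\<^sub>E carrier A" for z
      using G that by (auto simp: hom_def carY)
    then have "G (?e t) \<in> carrier A" for t using e by blast
    then show "(\<lambda>t. y t \<otimes> G (?e t)) \<in> {..<n} \<rightarrow> carrier A" using yc by auto
  qed
  finally show ?thesis .
qed

text \<open>Let \<open>h\<close> embed the tensor square into \<open>A\<^sup>r\<close> with retraction \<open>q\<close>. For each \<open>c\<close> there is a left
  \<open>A\<close>-linear map \<open>\<Phi> c\<close> sending \<open>x \<otimes> y\<close> to \<open>x E(y c)\<close>. Evaluating it at \<open>1 \<otimes> x = q (h (1 \<otimes> x))\<close>, with
  \<open>h (1 \<otimes> x)\<close> written in the standard basis, yields the product formula for \<open>E (x c)\<close>. The maps \<open>f\<close>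
  are the coordinates of \<open>h\<close>; the maps \<open>g\<close> are bilinear because \<open>q\<close> sends the standard basis, which is
  central over \<open>C\<close>, to central tensors.\<close>

theorem splits_of_depth_three:
  fixes A :: "('a, 'c) ring_scheme" (structure)
  assumes tensor: "tensor_square A B \<beta> A id C \<delta> T \<tau>" and hom: "ring_hom_ring B A \<beta>"
    and E: "E \<in> regular_hom B B A \<beta> \<beta> B id id"
    and r: "r > 0"
    and summand: "iso_to_direct_summand A C T (bimodule_power r (regular_bimodule A id \<delta>))"
  shows "splits_through B C A \<beta> \<delta> A \<beta> \<delta> E"
proof -
  interpret tensor_square A B \<beta> A id C \<delta> T \<tau> by fact
  interpret hom: ring_hom_ring B A \<beta> by fact
  note ED = regular_homD[OF E, simplified]
  let ?Y = "bimodule_power r (regular_bimodule A id \<delta>)"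
  note carY = carrier_power and lactY = lact_power[where p = id, simplified] and ractY = ract_power and addY = add_power
  have Y: "biaction A C ?Y"
    by (intro biaction_power biaction_regular ring_axioms) auto
  interpret T: biaction A C T by (rule biaction)
  obtain h q where h: "h \<in> bimodule_hom A C T ?Y" and q: "q \<in> bimodule_hom A C ?Y T"
    and qh: "\<forall>u\<in>carrier T. q (h u) = u"
    by (rule retraction_of_summand[OF biaction Y summand])
  note H = bimodule_homD[OF h] and Q = bimodule_homD[OF q]
  have \<beta>E: "\<beta> (E a) \<in> carrier A" if "a \<in> carrier A" for a using that ED by simp
  have \<beta>E_add: "\<beta> (E (a \<oplus> b)) = \<beta> (E a) \<oplus> \<beta> (E b)" if "a \<in> carrier A" "b \<in> carrier A" for a b
    using that ED ring_hom_add[OF hom.homh] by simp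
  have \<beta>E_left: "\<beta> (E (\<beta> b \<otimes> a)) = \<beta> b \<otimes> \<beta> (E a)" if "a \<in> carrier A" "b \<in> carrier B" for a b
    using that ED by simp
  have \<beta>E_right: "\<beta> (E (a \<otimes> \<beta> b)) = \<beta> (E a) \<otimes> \<beta> b" if "a \<in> carrier A" "b \<in> carrier B" for a b
    using that ED by simp
  have "\<exists>\<Phi>. \<forall>c\<in>carrier A. \<Phi> c \<in> hom (add_monoid T) (add_monoid A) \<and>
      (\<forall>x\<in>carrier A. \<forall>y\<in>carrier A. \<Phi> c (\<tau> x y) = x \<otimes> \<beta> (E (y \<otimes> c)))"
  proof (intro bchoice ballI)
    fix c assume c: "c \<in> carrier A"
    have "\<exists>H\<in>hom (add_monoid T) (add_monoid A).
        \<forall>x\<in>carrier A. \<forall>y\<in>carrier A. H (\<tau> x y) = x \<otimes> \<beta> (E (y \<otimes> c))"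
      by (rule tensor_universal)
        (use c in \<open>simp_all add: \<beta>E \<beta>E_add \<beta>E_left l_distr r_distr m_assoc\<close>)
    then show "\<exists>H. H \<in> hom (add_monoid T) (add_monoid A) \<and>
        (\<forall>x\<in>carrier A. \<forall>y\<in>carrier A. H (\<tau> x y) = x \<otimes> \<beta> (E (y \<otimes> c)))"
      by blast
  qed
  then obtain \<Phi> where \<Phi>: "\<And>c. c \<in> carrier A \<Longrightarrow> \<Phi> c \<in> hom (add_monoid T) (add_monoid A)"
    and \<Phi>_pure: "\<And>c x y. c \<in> carrier A \<Longrightarrow> x \<in> carrier A \<Longrightarrow> y \<in> carrier A \<Longrightarrow>
      \<Phi> c (\<tau> x y) = x \<otimes> \<beta> (E (y \<otimes> c))"
    by blast
  have \<Phi>_closed: "\<Phi> c u \<in> carrier A" if "c \<in> carrier A" "u \<in> carrier T" for c u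
    using \<Phi>[OF that(1)] that(2) by (auto simp: hom_def)
  have \<Phi>_add: "\<Phi> c (u \<oplus>\<^bsub>T\<^esub> v) = \<Phi> c u \<oplus> \<Phi> c v"
    if "c \<in> carrier A" "u \<in> carrier T" "v \<in> carrier T" for c u v
    using \<Phi>[OF that(1)] that(2,3) by (auto simp: hom_def)
  have \<Phi>_zero: "\<Phi> c \<zero>\<^bsub>T\<^esub> = \<zero>" if "c \<in> carrier A" for c
    by (rule additive_zero[OF group is_abelian_group \<Phi>[OF that]])
  have \<Phi>_lact: "\<Phi> c (lact T a u) = a \<otimes> \<Phi> c u"
    if c: "c \<in> carrier A" and a: "a \<in> carrier A" and u: "u \<in> carrier T" for c a u
    using u by (rule tensor_induct)
      (use c a in \<open>simp_all add: \<Phi>_zero \<Phi>_add \<Phi>_pure \<Phi>_closed T.lact_zero lact_add lact_pure r_distr m_assoc \<beta>E\<close>)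
  have \<Phi>_ract: "\<Phi> c (ract T u n) = \<Phi> (\<delta> n \<otimes> c) u"
    if c: "c \<in> carrier A" and n: "n \<in> carrier C" and u: "u \<in> carrier T" for c n u
    using u by (rule tensor_induct)
      (use c n in \<open>simp_all add: \<Phi>_zero \<Phi>_add \<Phi>_pure T.ract_zero ract_add ract_pure m_assoc\<close>)
  have \<Phi>_index_add: "\<Phi> (c \<oplus> d) u = \<Phi> c u \<oplus> \<Phi> d u"
    if c: "c \<in> carrier A" "d \<in> carrier A" and u: "u \<in> carrier T" for c d u
    using u by (rule tensor_induct)
      (use c in \<open>simp_all add: \<Phi>_zero \<Phi>_add \<Phi>_pure \<Phi>_closed r_distr \<beta>E \<beta>E_add a_ac\<close>)
  have \<Phi>_index_right: "\<Phi> (c \<otimes> \<beta> b) u = \<Phi> c u \<otimes> \<beta> b"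
    if c: "c \<in> carrier A" and b: "b \<in> carrier B" and u: "u \<in> carrier T" for c b u
    using u
  proof (rule tensor_induct)
    fix x y assume "x \<in> carrier A" "y \<in> carrier A"
    then show "\<Phi> (c \<otimes> \<beta> b) (\<tau> x y) = \<Phi> c (\<tau> x y) \<otimes> \<beta> b"
      using c b \<beta>E_right[of "y \<otimes> c" b] by (simp add: \<Phi>_pure \<beta>E m_assoc)
  qed (use c b in \<open>simp_all add: \<Phi>_zero \<Phi>_add \<Phi>_closed l_distr\<close>)
  let ?e = "\<lambda>t. \<lambda>i\<in>{..<r}. if i = t then \<one> else \<zero>"
  have eY: "?e t \<in> carrier ?Y" for t unfolding carY by auto
  have qe: "q (?e t) \<in> carrier T" for t by (rule Q(2)[OF eY])
  have e_central: "ract ?Y (?e t) n = lact ?Y (\<delta> n) (?e t)" if "n \<in> carrier C" for t n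
    unfolding ractY lactY using that by (intro restrict_ext) auto
  define f where "f t x = h (\<tau> \<one> x) t" for t x
  define g where "g t c = \<Phi> c (q (?e t))" for t c
  have hc: "h (\<tau> \<one> x) \<in> {..<r} \<rightarrow>\<^sub>E carrier A" if "x \<in> carrier A" for x
    using H(2)[of "\<tau> \<one> x"] that by (simp add: carY)
  show ?thesis
  proof (rule splits_throughI[where f = f and g = g, OF r])
    fix t assume t: "t < r"
    show "f t \<in> regular_hom B C A \<beta> \<delta> A \<beta> \<delta>"
    proof (rule regular_homI)
      fix x assume x: "x \<in> carrier A"
      show "f t x \<in> carrier A" using hc[OF x] t by (auto simp: f_def)
      fix b assume b: "b \<in> carrier B"
      have "\<tau> \<one> (\<beta> b \<otimes> x) = lact T (\<beta> b) (\<tau> \<one> x)"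
        using b x pure_balanced[of "\<one>" b x] by (simp add: lact_pure)
      then show "f t (\<beta> b \<otimes> x) = \<beta> b \<otimes> f t x"
        using b x t by (simp add: f_def H(4) lactY)
    next
      fix n x assume n: "n \<in> carrier C" and x: "x \<in> carrier A"
      have "\<tau> \<one> (x \<otimes> \<delta> n) = ract T (\<tau> \<one> x) n"
        using n x by (simp add: ract_pure)
      then show "f t (x \<otimes> \<delta> n) = f t x \<otimes> \<delta> n"
        using n x t by (simp add: f_def H(5) ractY)
    next
      fix x y assume "x \<in> carrier A" "y \<in> carrier A"
      then show "f t (x \<oplus> y) = f t x \<oplus> f t y"
        using t by (simp add: f_def pure_add_right H(3) addY)
    qed
  next
    fix t assume t: "t < r"
    show "g t \<in> regular_hom C B A \<delta> \<beta> A \<delta> \<beta>"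
    proof (rule regular_homI)
      fix n c assume n: "n \<in> carrier C" and c: "c \<in> carrier A"
      have "g t (\<delta> n \<otimes> c) = \<Phi> c (q (ract ?Y (?e t) n))"
        using n c qe eY by (simp add: g_def \<Phi>_ract[symmetric] Q(5))
      also have "\<dots> = \<delta> n \<otimes> g t c"
        unfolding e_central[OF n] using n c qe eY by (simp add: g_def Q(4) \<Phi>_lact)
      finally show "g t (\<delta> n \<otimes> c) = \<delta> n \<otimes> g t c" .
    qed (simp_all add: g_def qe \<Phi>_closed \<Phi>_index_add \<Phi>_index_right)
  next
    fix x c assume x: "x \<in> carrier A" and c: "c \<in> carrier A"
    let ?G = "\<lambda>y. \<Phi> c (q y)"
    have G: "?G \<in> hom (add_monoid ?Y) (add_monoid A)"
      using c by (auto simp: hom_def Q(2,3) \<Phi>_closed \<Phi>_add)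
    have lin: "?G (\<lambda>i\<in>{..<r}. a \<otimes> y i) = a \<otimes> ?G y"
      if "a \<in> carrier A" "y \<in> {..<r} \<rightarrow>\<^sub>E carrier A" for a y
      using that c Q(4)[of a y] Q(2)[of y] by (simp add: \<Phi>_lact lactY carY)
    have "\<beta> (E (x \<otimes> c)) = \<Phi> c (\<tau> \<one> x)"
      using x c by (simp add: \<Phi>_pure \<beta>E)
    also have "\<dots> = ?G (h (\<tau> \<one> x))"
      using qh x by simp
    also have "\<dots> = (\<Oplus>t\<in>{..<r}. h (\<tau> \<one> x) t \<otimes> ?G (?e t))"
      by (rule power_expand[OF ring_axioms g_closed G lin hc[OF x]])
    finally show "\<beta> (E (x \<otimes> c)) = (\<Oplus>t\<in>{..<r}. f t x \<otimes> g t c)"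
      by (simp add: f_def g_def)
  qed
qed

text \<open>The embedding \<open>h\<close> has the coordinates \<open>a \<otimes> b \<mapsto> a f\<^sub>t(b)\<close>, and the retraction \<open>q\<close> sends the \<open>t\<close>-th vector of
  the standard basis to \<open>\<Sum> g\<^sub>t(x\<^sub>k) \<otimes> y\<^sub>k\<close>. These tensors are central over \<open>N\<close> because \<open>\<Sum> x\<^sub>k \<otimes> y\<^sub>k\<close> is,
  and \<open>q (h (a \<otimes> b)) = \<Sum> a E(b x\<^sub>k) \<otimes> y\<^sub>k = a \<otimes> b\<close> by the product formula.\<close>

theorem summand_of_splits:
  fixes A :: "('a, 'c) ring_scheme" (structure)
  assumes tensor: "tensor_square A N \<alpha> A id N \<alpha> T \<tau>" and "frobenius_system N A \<alpha> E m x y"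
    and f: "\<forall>t<r. f t \<in> regular_hom N N A \<alpha> \<alpha> A \<alpha> \<alpha>"
    and g: "\<forall>t<r. g t \<in> regular_hom N N A \<alpha> \<alpha> A \<alpha> \<alpha>"
    and split: "\<forall>a\<in>carrier A. \<forall>b\<in>carrier A.
      \<alpha> (E (a \<otimes> b)) = (\<Oplus>t\<in>{..<r::nat}. f t a \<otimes> g t b)"
  shows "iso_to_direct_summand A N T (bimodule_power r (regular_bimodule A id \<alpha>))"
proof -
  interpret tensor_square A N \<alpha> A id N \<alpha> T \<tau> by fact
  interpret E: frobenius_system N A \<alpha> E m x y by fact
  interpret T: biaction A N T by (rule biaction)
  note F = regular_homD[OF f[rule_format]] and G = regular_homD[OF g[rule_format]]
  note split = split[rule_format]
  let ?Y = "bimodule_power r (regular_bimodule A id \<alpha>)"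
  note carY = carrier_power and lactY = lact_power[where p = id, simplified] and ractY = ract_power and addY = add_power
  have Y: "biaction A N ?Y"
    by (intro biaction_power biaction_regular ring_axioms) auto
  have pure_sum_left: "\<tau> (\<Oplus>i\<in>I. u i) b = (\<Oplus>\<^bsub>T\<^esub>i\<in>I. \<tau> (u i) b)"
    if "finite I" "u \<in> I \<rightarrow> carrier A" "b \<in> carrier A" for I :: "nat set" and u b
    using that by (intro additive_finsum[where h = "\<lambda>a. \<tau> a b"] is_abelian_group group)
      (auto simp: hom_def pure_add_left)
  have pure_sum_right: "\<tau> a (\<Oplus>i\<in>I. u i) = (\<Oplus>\<^bsub>T\<^esub>i\<in>I. \<tau> a (u i))"
    if "finite I" "u \<in> I \<rightarrow> carrier A" "a \<in> carrier A" for I :: "nat set" and u a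
    using that by (intro additive_finsum is_abelian_group group)
      (auto simp: hom_def pure_add_right)
  have "\<exists>p. \<forall>t\<in>{..<r}. p t \<in> hom (add_monoid T) (add_monoid A) \<and>
      (\<forall>a\<in>carrier A. \<forall>b\<in>carrier A. p t (\<tau> a b) = a \<otimes> f t b)"
  proof (intro bchoice ballI)
    fix t assume t: "t \<in> {..<r}"
    have "\<exists>H\<in>hom (add_monoid T) (add_monoid A).
        \<forall>a\<in>carrier A. \<forall>b\<in>carrier A. H (\<tau> a b) = a \<otimes> f t b"
      by (rule tensor_universal) (use t in \<open>simp_all add: F l_distr r_distr m_assoc\<close>)
    then show "\<exists>H. H \<in> hom (add_monoid T) (add_monoid A) \<and>
        (\<forall>a\<in>carrier A. \<forall>b\<in>carrier A. H (\<tau> a b) = a \<otimes> f t b)"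
      by blast
  qed
  then obtain p where p: "\<And>t. t < r \<Longrightarrow> p t \<in> hom (add_monoid T) (add_monoid A)"
    and p_pure: "\<And>t a b. t < r \<Longrightarrow> a \<in> carrier A \<Longrightarrow> b \<in> carrier A \<Longrightarrow> p t (\<tau> a b) = a \<otimes> f t b"
    by auto
  have p_closed: "p t u \<in> carrier A" if "t < r" "u \<in> carrier T" for t u
    using p[OF that(1)] that(2) by (auto simp: hom_def)
  have p_add: "p t (u \<oplus>\<^bsub>T\<^esub> v) = p t u \<oplus> p t v"
    if "t < r" "u \<in> carrier T" "v \<in> carrier T" for t u v
    using p[OF that(1)] that(2,3) by (auto simp: hom_def)
  have p_zero: "p t \<zero>\<^bsub>T\<^esub> = \<zero>" if "t < r" for t
    by (rule additive_zero[OF group is_abelian_group p[OF that]])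
  have p_lact: "p t (lact T a u) = a \<otimes> p t u"
    if t: "t < r" and a: "a \<in> carrier A" and u: "u \<in> carrier T" for t a u
    using u by (rule tensor_induct)
      (use t a in \<open>simp_all add: p_zero p_add p_pure p_closed T.lact_zero lact_add lact_pure r_distr m_assoc F\<close>)
  have p_ract: "p t (ract T u n) = p t u \<otimes> \<alpha> n"
    if t: "t < r" and n: "n \<in> carrier N" and u: "u \<in> carrier T" for t n u
    using u by (rule tensor_induct)
      (use t n in \<open>simp_all add: p_zero p_add p_pure p_closed T.ract_zero ract_add ract_pure l_distr m_assoc F\<close>)
  define h where "h u = (\<lambda>t\<in>{..<r}. p t u)" for u
  define s where "s a t = (\<Oplus>\<^bsub>T\<^esub>k\<in>{..<m}. \<tau> (a \<otimes> g t (x k)) (y k))" for a t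
  define q where "q z = (\<Oplus>\<^bsub>T\<^esub>t\<in>{..<r}. s (z t) t)" for z
  have s_closed: "s a t \<in> carrier T" if "a \<in> carrier A" "t < r" for a t
    unfolding s_def using that by (intro T.finsum_closed) (auto simp: G)
  have s_add: "s (a \<oplus> b) t = s a t \<oplus>\<^bsub>T\<^esub> s b t" if "a \<in> carrier A" "b \<in> carrier A" "t < r" for a b t
  proof -
    have "s (a \<oplus> b) t = (\<Oplus>\<^bsub>T\<^esub>k\<in>{..<m}. \<tau> (a \<otimes> g t (x k)) (y k) \<oplus>\<^bsub>T\<^esub> \<tau> (b \<otimes> g t (x k)) (y k))"
      unfolding s_def using that by (intro T.finsum_cong') (auto simp: G l_distr pure_add_left)
    also have "\<dots> = s a t \<oplus>\<^bsub>T\<^esub> s b t"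
      unfolding s_def using that by (intro T.finsum_addf) (auto simp: G)
    finally show ?thesis .
  qed
  have lact_hom: "lact T a \<in> hom (add_monoid T) (add_monoid T)" if "a \<in> carrier A" for a
    using that by (auto simp: hom_def lact_add)
  have ract_hom: "(\<lambda>u. ract T u n) \<in> hom (add_monoid T) (add_monoid T)" if "n \<in> carrier N" for n
    using that by (auto simp: hom_def ract_add)
  have s_lact: "s (a \<otimes> b) t = lact T a (s b t)" if "a \<in> carrier A" "b \<in> carrier A" "t < r" for a b t
    unfolding s_def using that
    by (subst additive_finsum[OF group group lact_hom])
      (auto simp: G lact_pure m_assoc intro!: T.finsum_cong')
  have s_ract: "s (a \<otimes> \<alpha> n) t = ract T (s a t) n"
    if a: "a \<in> carrier A" and n: "n \<in> carrier N" and t: "t < r" for a n t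
  proof -
    let ?c = "\<lambda>l k. E (y l \<otimes> \<alpha> n \<otimes> x k)"
    have "s (a \<otimes> \<alpha> n) t =
        (\<Oplus>\<^bsub>T\<^esub>k\<in>{..<m}. \<Oplus>\<^bsub>T\<^esub>l\<in>{..<m}. \<tau> (a \<otimes> g t (x l)) (\<alpha> (?c l k) \<otimes> y k))"
      unfolding s_def
    proof (intro T.finsum_cong' refl)
      fix k assume k: "k \<in> {..<m}"
      have "a \<otimes> \<alpha> n \<otimes> g t (x k) = a \<otimes> g t (\<alpha> n \<otimes> x k)"
        using a n t k by (simp add: G m_assoc)
      also have "\<alpha> n \<otimes> x k = (\<Oplus>l\<in>{..<m}. x l \<otimes> \<alpha> (E (y l \<otimes> (\<alpha> n \<otimes> x k))))"
        using n k by (intro E.expand_x[symmetric]) auto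
      also have "g t \<dots> = (\<Oplus>l\<in>{..<m}. g t (x l) \<otimes> \<alpha> (?c l k))"
        using n t k by (subst regular_hom_finsum[OF g[rule_format, OF t] ring_axioms ring_axioms])
          (auto simp: G m_assoc intro!: finsum_cong')
      also have "a \<otimes> \<dots> = (\<Oplus>l\<in>{..<m}. a \<otimes> g t (x l) \<otimes> \<alpha> (?c l k))"
        using a n t k by (subst finsum_rdistr) (auto simp: G m_assoc intro!: finsum_cong')
      finally have "a \<otimes> \<alpha> n \<otimes> g t (x k) = (\<Oplus>l\<in>{..<m}. a \<otimes> g t (x l) \<otimes> \<alpha> (?c l k))" .
      then show "\<tau> (a \<otimes> \<alpha> n \<otimes> g t (x k)) (y k) =
          (\<Oplus>\<^bsub>T\<^esub>l\<in>{..<m}. \<tau> (a \<otimes> g t (x l)) (\<alpha> (?c l k) \<otimes> y k))"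
        using a n t k by (simp, subst pure_sum_left) (auto simp: G pure_balanced intro!: T.finsum_cong')
    qed (use a n t in \<open>auto simp: G intro!: T.finsum_closed\<close>)
    also have "\<dots> = (\<Oplus>\<^bsub>T\<^esub>l\<in>{..<m}. \<Oplus>\<^bsub>T\<^esub>k\<in>{..<m}. \<tau> (a \<otimes> g t (x l)) (\<alpha> (?c l k) \<otimes> y k))"
      using a n t by (intro T.finsum_swap) (auto simp: G)
    also have "\<dots> = (\<Oplus>\<^bsub>T\<^esub>l\<in>{..<m}. \<tau> (a \<otimes> g t (x l)) (y l \<otimes> \<alpha> n))"
    proof (intro T.finsum_cong' refl)
      fix l assume l: "l \<in> {..<m}"
      have "(\<Oplus>\<^bsub>T\<^esub>k\<in>{..<m}. \<tau> (a \<otimes> g t (x l)) (\<alpha> (?c l k) \<otimes> y k)) =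
          \<tau> (a \<otimes> g t (x l)) (\<Oplus>k\<in>{..<m}. \<alpha> (?c l k) \<otimes> y k)"
        using a n t l by (intro pure_sum_right[symmetric]) (auto simp: G)
      then show "(\<Oplus>\<^bsub>T\<^esub>k\<in>{..<m}. \<tau> (a \<otimes> g t (x l)) (\<alpha> (?c l k) \<otimes> y k)) =
          \<tau> (a \<otimes> g t (x l)) (y l \<otimes> \<alpha> n)"
        using n l E.expand_y[of "y l \<otimes> \<alpha> n"] by simp
    qed (use a n t in \<open>auto simp: G\<close>)
    also have "\<dots> = ract T (s a t) n"
      unfolding s_def using a n t
      by (subst additive_finsum[OF group group ract_hom])
        (auto simp: G ract_pure intro!: T.finsum_cong')
    finally show ?thesis .
  qed
  have q_closed: "q z \<in> carrier T" if "z \<in> {..<r} \<rightarrow>\<^sub>E carrier A" for z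
    unfolding q_def using that by (intro T.finsum_closed) (auto intro: s_closed)
  have h: "h \<in> bimodule_hom A N T ?Y"
  proof -
    have "h u \<in> {..<r} \<rightarrow>\<^sub>E carrier A" if "u \<in> carrier T" for u
      using that by (auto simp: h_def p_closed)
    moreover have "h (u \<oplus>\<^bsub>T\<^esub> v) = h u \<oplus>\<^bsub>?Y\<^esub> h v" if "u \<in> carrier T" "v \<in> carrier T" for u v
      unfolding addY h_def using that by (intro restrict_ext) (simp add: p_add)
    moreover have "h (lact T a u) = lact ?Y a (h u)" if "a \<in> carrier A" "u \<in> carrier T" for a u
      unfolding lactY h_def using that by (intro restrict_ext) (simp add: p_lact)
    moreover have "h (ract T u n) = ract ?Y (h u) n" if "n \<in> carrier N" "u \<in> carrier T" for n u
      unfolding ractY h_def using that by (intro restrict_ext) (simp add: p_ract)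
    ultimately show ?thesis
      by (simp add: bimodule_hom_def hom_def carY)
  qed
  have q: "q \<in> bimodule_hom A N ?Y T"
  proof -
    have "q (z \<oplus>\<^bsub>?Y\<^esub> z') = q z \<oplus>\<^bsub>T\<^esub> q z'"
      if "z \<in> {..<r} \<rightarrow>\<^sub>E carrier A" "z' \<in> {..<r} \<rightarrow>\<^sub>E carrier A" for z z'
    proof -
      have mem: "z t \<in> carrier A" "z' t \<in> carrier A" if "t < r" for t
        using that \<open>z \<in> _\<close> \<open>z' \<in> _\<close> by auto
      have "q (z \<oplus>\<^bsub>?Y\<^esub> z') = (\<Oplus>\<^bsub>T\<^esub>t\<in>{..<r}. s (z t) t \<oplus>\<^bsub>T\<^esub> s (z' t) t)"
        unfolding q_def addY by (intro T.finsum_cong') (auto simp: mem s_add s_closed)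
      also have "\<dots> = q z \<oplus>\<^bsub>T\<^esub> q z'"
        unfolding q_def by (intro T.finsum_addf) (auto simp: mem s_closed)
      finally show ?thesis .
    qed
    moreover have "q (lact ?Y a z) = lact T a (q z)" if "a \<in> carrier A" "z \<in> {..<r} \<rightarrow>\<^sub>E carrier A" for a z
    proof -
      have mem: "z t \<in> carrier A" if "t < r" for t
        using that \<open>z \<in> _\<close> by auto
      show ?thesis
        unfolding q_def lactY using \<open>a \<in> _\<close>
        by (subst additive_finsum[OF group group lact_hom])
          (auto simp: mem s_lact s_closed intro!: T.finsum_cong')
    qed
    moreover have "q (ract ?Y z n) = ract T (q z) n" if "n \<in> carrier N" "z \<in> {..<r} \<rightarrow>\<^sub>E carrier A" for n z
    proof -
      have mem: "z t \<in> carrier A" if "t < r" for t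
        using that \<open>z \<in> _\<close> by auto
      show ?thesis
        unfolding q_def ractY using \<open>n \<in> _\<close>
        by (subst additive_finsum[OF group group ract_hom])
          (auto simp: mem s_ract s_closed intro!: T.finsum_cong')
    qed
    ultimately show ?thesis
      using q_closed by (simp add: bimodule_hom_def hom_def carY)
  qed
  have qh: "q (h u) = u" if u: "u \<in> carrier T" for u
    using u
  proof (rule tensor_induct)
    have "h \<zero>\<^bsub>T\<^esub> = \<zero>\<^bsub>?Y\<^esub>"
      using additive_zero[OF group _ bimodule_homD(1)[OF h]] Y by (simp add: biaction_def)
    moreover have "q \<zero>\<^bsub>?Y\<^esub> = \<zero>\<^bsub>T\<^esub>"
      using additive_zero[OF _ group bimodule_homD(1)[OF q]] Y by (simp add: biaction_def)
    ultimately show "q (h \<zero>\<^bsub>T\<^esub>) = \<zero>\<^bsub>T\<^esub>" by simp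
  next
    fix u v assume "u \<in> carrier T" "v \<in> carrier T" "q (h u) = u" "q (h v) = v"
    then show "q (h (u \<oplus>\<^bsub>T\<^esub> v)) = u \<oplus>\<^bsub>T\<^esub> v"
      using bimodule_homD[OF h] bimodule_homD[OF q] by simp
  next
    fix a b assume a: "a \<in> carrier A" and b: "b \<in> carrier A"
    have "q (h (\<tau> a b)) = (\<Oplus>\<^bsub>T\<^esub>t\<in>{..<r}. \<Oplus>\<^bsub>T\<^esub>k\<in>{..<m}. \<tau> (a \<otimes> (f t b \<otimes> g t (x k))) (y k))"
      unfolding q_def s_def h_def using a b
      by (intro T.finsum_cong') (auto simp: p_pure F G m_assoc intro!: T.finsum_closed T.finsum_cong')
    also have "\<dots> = (\<Oplus>\<^bsub>T\<^esub>k\<in>{..<m}. \<Oplus>\<^bsub>T\<^esub>t\<in>{..<r}. \<tau> (a \<otimes> (f t b \<otimes> g t (x k))) (y k))"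
      using a b by (intro T.finsum_swap) (auto simp: F G)
    also have "\<dots> = (\<Oplus>\<^bsub>T\<^esub>k\<in>{..<m}. \<tau> a (\<alpha> (E (b \<otimes> x k)) \<otimes> y k))"
    proof (intro T.finsum_cong' refl)
      fix k assume k: "k \<in> {..<m}"
      have "(\<Oplus>\<^bsub>T\<^esub>t\<in>{..<r}. \<tau> (a \<otimes> (f t b \<otimes> g t (x k))) (y k)) =
          \<tau> (\<Oplus>t\<in>{..<r}. a \<otimes> (f t b \<otimes> g t (x k))) (y k)"
        using a b k by (intro pure_sum_left[symmetric]) (auto simp: F G)
      also have "(\<Oplus>t\<in>{..<r}. a \<otimes> (f t b \<otimes> g t (x k))) = a \<otimes> \<alpha> (E (b \<otimes> x k))"
        using a b k split[of b "x k"] by (subst finsum_rdistr[symmetric]) (auto simp: F G)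
      finally show "(\<Oplus>\<^bsub>T\<^esub>t\<in>{..<r}. \<tau> (a \<otimes> (f t b \<otimes> g t (x k))) (y k)) =
          \<tau> a (\<alpha> (E (b \<otimes> x k)) \<otimes> y k)"
        using a b k by (simp add: pure_balanced)
    qed (use a b in auto)
    also have "\<dots> = \<tau> a (\<Oplus>k\<in>{..<m}. \<alpha> (E (b \<otimes> x k)) \<otimes> y k)"
      using a b by (intro pure_sum_right[symmetric]) auto
    also have "\<dots> = \<tau> a b" using b by (simp add: E.expand_y)
    finally show "q (h (\<tau> a b)) = \<tau> a b" .
  qed
  show ?thesis
    by (rule summand_of_retraction[OF biaction Y h q]) (rule qh)
qed

section \<open>Exchanging left and right\<close>

definition flip :: "('l, 'r, 'm) bimodule \<Rightarrow> ('r, 'l, 'm) bimodule" where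
  "flip X = \<lparr>carrier = carrier X, monoid.mult = monoid.mult X, one = \<one>\<^bsub>X\<^esub>, zero = \<zero>\<^bsub>X\<^esub>, add = add X,
    lact = (\<lambda>r x. ract X x r), ract = (\<lambda>x l. lact X l x)\<rparr>"

lemma flip_simps [simp]:
  "carrier (flip X) = carrier X" "\<zero>\<^bsub>flip X\<^esub> = \<zero>\<^bsub>X\<^esub>" "add (flip X) = add X"
  "lact (flip X) r x = ract X x r" "ract (flip X) x l = lact X l x"
  by (simp_all add: flip_def)

lemma subgroup_flip: "subgroup P (add_monoid (flip X)) \<longleftrightarrow> subgroup P (add_monoid X)"
  by (simp add: subgroup_def m_inv_def)

lemma abelian_group_flip:
  assumes "abelian_group X"
  shows "abelian_group (flip X)"
proof -
  interpret abelian_group X by fact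
  show ?thesis
    by (rule abelian_groupI) (auto simp: a_ac intro: bexI[of _ "\<ominus>\<^bsub>X\<^esub> _"] l_neg)
qed

lemma flip_power_regular:
  "flip (bimodule_power n (regular_bimodule A f g)) = bimodule_power n (regular_bimodule (op_ring A) g f)"
  by (simp add: flip_def bimodule_power_def regular_bimodule_def op_ring_def)

lemma subbimodule_flip: "subbimodule (op_ring R) (op_ring L) P (flip X) \<longleftrightarrow> subbimodule L R P X"
  unfolding subbimodule_def subgroup_flip by auto

lemma direct_summand_flip: "direct_summand (op_ring R) (op_ring L) P (flip X) \<longleftrightarrow> direct_summand L R P X"
  by (simp add: direct_summand_def subbimodule_flip set_add_def set_mult_def)

lemma iso_to_direct_summand_flip:
  "iso_to_direct_summand (op_ring R) (op_ring L) (flip X) (flip Y) \<longleftrightarrow> iso_to_direct_summand L R X Y"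
proof -
  have "bimodule_hom (op_ring R) (op_ring L) (flip X) (flip Y) = bimodule_hom L R X Y"
    by (auto simp: bimodule_hom_def hom_def)
  then show ?thesis
    by (simp add: iso_to_direct_summand_def direct_summand_flip)
qed

lemma (in tensor_square) tensor_square_flip:
  "tensor_square (op_ring A) (op_ring B) \<beta> (op_ring R) g (op_ring L) f (flip T) (\<lambda>x y. \<tau> y x)"
proof (intro tensor_square.intro tensor_square_axioms.intro ring_op_ring ring_axioms)
  show "abelian_group (flip T)"
    by (rule abelian_group_flip[OF group])
next
  fix u P
  assume "u \<in> carrier (flip T)" "P \<zero>\<^bsub>flip T\<^esub>"
    "\<And>x y. x \<in> carrier (op_ring A) \<Longrightarrow> y \<in> carrier (op_ring A) \<Longrightarrow> P (\<tau> y x)"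
    "\<And>u v. u \<in> carrier (flip T) \<Longrightarrow> v \<in> carrier (flip T) \<Longrightarrow> P u \<Longrightarrow> P v \<Longrightarrow> P (u \<oplus>\<^bsub>flip T\<^esub> v)"
  then show "P u" using tensor_induct[of u P] by simp
next
  fix h
  assume *: "\<And>x y. x \<in> carrier (op_ring A) \<Longrightarrow> y \<in> carrier (op_ring A) \<Longrightarrow> h x y \<in> carrier (op_ring A)"
    "\<And>x x' y. x \<in> carrier (op_ring A) \<Longrightarrow> x' \<in> carrier (op_ring A) \<Longrightarrow> y \<in> carrier (op_ring A) \<Longrightarrow>
      h (x \<oplus>\<^bsub>op_ring A\<^esub> x') y = h x y \<oplus>\<^bsub>op_ring A\<^esub> h x' y"
    "\<And>x y y'. x \<in> carrier (op_ring A) \<Longrightarrow> y \<in> carrier (op_ring A) \<Longrightarrow> y' \<in> carrier (op_ring A) \<Longrightarrow>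
      h x (y \<oplus>\<^bsub>op_ring A\<^esub> y') = h x y \<oplus>\<^bsub>op_ring A\<^esub> h x y'"
    "\<And>x b y. x \<in> carrier (op_ring A) \<Longrightarrow> b \<in> carrier (op_ring B) \<Longrightarrow> y \<in> carrier (op_ring A) \<Longrightarrow>
      h (x \<otimes>\<^bsub>op_ring A\<^esub> \<beta> b) y = h x (\<beta> b \<otimes>\<^bsub>op_ring A\<^esub> y)"
  have "\<exists>H\<in>hom (add_monoid T) (add_monoid A). \<forall>x\<in>carrier A. \<forall>y\<in>carrier A. H (\<tau> x y) = h y x"
    by (rule tensor_universal) (use * in \<open>simp_all\<close>)
  then show "\<exists>H\<in>hom (add_monoid (flip T)) (add_monoid (op_ring A)).
      \<forall>x\<in>carrier (op_ring A). \<forall>y\<in>carrier (op_ring A). H (\<tau> y x) = h x y"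
    by (auto simp: hom_def)
qed (simp_all add: pure_add_left pure_add_right pure_balanced lact_add lact_pure ract_add ract_pure)

theorem splits_of_left_depth_three:
  assumes "tensor_square A B \<beta> C \<delta> A id T \<tau>" and "ring_hom_ring B A \<beta>"
    and E: "E \<in> regular_hom B B A \<beta> \<beta> B id id"
    and r: "r > 0"
    and summand: "iso_to_direct_summand C A T (bimodule_power r (regular_bimodule A \<delta> id))"
  shows "splits_through B C A \<beta> \<delta> A \<beta> \<delta> E"
proof (rule splits_through_op_ring, rule splits_of_depth_three[OF _ _ _ r])
  show "tensor_square (op_ring A) (op_ring B) \<beta> (op_ring A) id (op_ring C) \<delta> (flip T) (\<lambda>x y. \<tau> y x)"
    by (rule tensor_square.tensor_square_flip[OF assms(1)])
  show "ring_hom_ring (op_ring B) (op_ring A) \<beta>"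
    by (rule ring_hom_op_ring[OF assms(2)])
  show "E \<in> regular_hom (op_ring B) (op_ring B) (op_ring A) \<beta> \<beta> (op_ring B) id id"
    using E by (simp add: regular_hom_op_ring)
  show "iso_to_direct_summand (op_ring A) (op_ring C) (flip T) (bimodule_power r (regular_bimodule (op_ring A) id \<delta>))"
    using summand by (simp add: iso_to_direct_summand_flip flip: flip_power_regular)
qed

text \<open>The left condition is the right one for the opposite rings. There the dual bases change places, and so
  do the two families of factors.\<close>

theorem depth_two_of_splits:
  assumes "frobenius_system N A \<alpha> E m x y" and "splits_through N N A \<alpha> \<alpha> A \<alpha> \<alpha> E"
  shows "depth_two A N \<alpha>"
proof -
  interpret frobenius_system N A \<alpha> E m x y by fact
  interpret op: frobenius_system "op_ring N" "op_ring A" \<alpha> E m y x by (rule frobenius_op_ring)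
  obtain r :: nat and f g where r: "r > 0"
    and f: "\<forall>t<r. f t \<in> regular_hom N N A \<alpha> \<alpha> A \<alpha> \<alpha>"
    and g: "\<forall>t<r. g t \<in> regular_hom N N A \<alpha> \<alpha> A \<alpha> \<alpha>"
    and eq: "\<forall>a\<in>carrier A. \<forall>b\<in>carrier A.
        \<alpha> (E (a \<otimes>\<^bsub>A\<^esub> b)) = (\<Oplus>\<^bsub>A\<^esub>t\<in>{..<r}. f t a \<otimes>\<^bsub>A\<^esub> g t b)"
    by (rule splits_throughE[OF assms(2)])
  let ?T = "tensor N (regular_bimodule A id \<alpha>) (regular_bimodule A \<alpha> \<alpha>)"
  let ?T' = "tensor N (regular_bimodule A \<alpha> \<alpha>) (regular_bimodule A \<alpha> id)"
  obtain \<tau> where "tensor_square A N \<alpha> A id N \<alpha> ?T \<tau>"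
    using tensor_square_tensor[of A N \<alpha> A id N \<alpha>] S.ring_axioms by auto
  then have right: "iso_to_direct_summand A N ?T (bimodule_power r (regular_bimodule A id \<alpha>))"
    by (rule summand_of_splits[OF _ assms(1) f g eq])
  obtain \<tau>' where "tensor_square A N \<alpha> N \<alpha> A id ?T' \<tau>'"
    using tensor_square_tensor[of A N \<alpha> N \<alpha> A id] S.ring_axioms by auto
  then have "tensor_square (op_ring A) (op_ring N) \<alpha> (op_ring A) id (op_ring N) \<alpha> (flip ?T') (\<lambda>x y. \<tau>' y x)"
    by (rule tensor_square.tensor_square_flip)
  then have "iso_to_direct_summand (op_ring A) (op_ring N) (flip ?T')
      (bimodule_power r (regular_bimodule (op_ring A) id \<alpha>))"
    by (rule summand_of_splits[OF _ op.frobenius_system_axioms, of _ _ r g f])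
      (use f g eq in \<open>simp_all add: regular_hom_op_ring\<close>)
  then have "iso_to_direct_summand N A ?T' (bimodule_power r (regular_bimodule A \<alpha> id))"
    by (simp add: iso_to_direct_summand_flip flip: flip_power_regular)
  with right r show ?thesis
    unfolding depth_two_def by blast
qed

section \<open>The Jones tower\<close>

lemma jones_stage_eq:
  "jones_stage N M \<iota> j = (jones_ring N M \<iota> j, jones_ring N M \<iota> (Suc j), jones_map N M \<iota> j)"
  by (cases "jones_stage N M \<iota> j") (auto simp: jones_ring_def jones_map_def)

lemma jones_0:
  "jones_ring N M \<iota> 0 = image_ring Base N" "jones_ring N M \<iota> (Suc 0) = image_ring Ext M"
  "jones_map N M \<iota> 0 = (\<lambda>u. Ext (\<iota> (inv_into UNIV Base u)))"
  by (simp_all add: jones_ring_def jones_map_def)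

lemma jones_Suc:
  "jones_ring N M \<iota> (Suc (Suc j)) =
    image_ring (endo_code (jones_ring N M \<iota> j) (jones_ring N M \<iota> (Suc j)) (jones_map N M \<iota> j))
      (right_End (jones_ring N M \<iota> j) (jones_ring N M \<iota> (Suc j)) (jones_map N M \<iota> j))"
  "jones_map N M \<iota> (Suc j) =
    (\<lambda>x. endo_code (jones_ring N M \<iota> j) (jones_ring N M \<iota> (Suc j)) (jones_map N M \<iota> j)
      (left_regular (jones_ring N M \<iota> (Suc j)) x))"
  using jones_stage_eq[of N M \<iota> j] jones_stage_eq[of N M \<iota> "Suc j"] by simp_all

lemma frobenius_extension_system:
  assumes "frobenius_extension N M \<iota>"
  obtains E m x y where "frobenius_system N M \<iota> E m x y"
proof -
  obtain E and m :: nat and x y where "ring_hom_ring N M \<iota>"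
    and "E \<in> regular_hom N N M \<iota> \<iota> N id id"
    and "x \<in> {..<m} \<rightarrow> carrier M" "y \<in> {..<m} \<rightarrow> carrier M"
    and "\<forall>a\<in>carrier M. (\<Oplus>\<^bsub>M\<^esub>i\<in>{..<m}. \<iota> (E (a \<otimes>\<^bsub>M\<^esub> x i)) \<otimes>\<^bsub>M\<^esub> y i) = a \<and>
        (\<Oplus>\<^bsub>M\<^esub>i\<in>{..<m}. x i \<otimes>\<^bsub>M\<^esub> \<iota> (E (y i \<otimes>\<^bsub>M\<^esub> a))) = a"
    using assms unfolding frobenius_extension_def by blast
  then have "frobenius_system N M \<iota> E m x y"
    by (intro frobenius_system.intro frobenius_system_axioms.intro) auto
  then show thesis by (rule that)
qed

text \<open>Renaming loses nothing because the dual basis generates each ring of the tower as a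
  right module over the previous one.\<close>

lemma jones_basic_construction:
  fixes N :: "'a ring" and M :: "'b ring" and \<iota> :: "'a \<Rightarrow> 'b"
  defines "R \<equiv> jones_ring N M \<iota>" and "\<phi> \<equiv> jones_map N M \<iota>"
  assumes "frobenius_system (R j) (R (Suc j)) (\<phi> j) E m x y"
  shows "\<exists>act. basic_construction (R j) (R (Suc j)) (\<phi> j) E m x y (R (Suc (Suc j))) (\<phi> (Suc j)) act"
proof -
  interpret frobenius_system "R j" "R (Suc j)" "\<phi> j" E m x y by fact
  have "inj_on (endo_code (R j) (R (Suc j)) (\<phi> j)) (carrier (right_End (R j) (R (Suc j)) (\<phi> j)))"
  proof (rule endo_code_inj[OF is_ring_hom_ring x_closed])
    fix b assume b: "b \<in> carrier (R (Suc j))"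
    show "\<exists>a\<in>{..<m} \<rightarrow> carrier (R j). b = (\<Oplus>\<^bsub>R (Suc j)\<^esub>i\<in>{..<m}. x i \<otimes>\<^bsub>R (Suc j)\<^esub> \<phi> j (a i))"
      using b by (intro bexI[of _ "\<lambda>i. E (y i \<otimes>\<^bsub>R (Suc j)\<^esub> b)"]) (auto simp: expand_x)
  qed
  from basic_construction_right_End[OF this] show ?thesis
    unfolding R_def \<phi>_def jones_Suc by blast
qed

theorem corollary8p6:
  fixes N :: "'a ring" and M :: "'b ring" and \<iota> :: "'a \<Rightarrow> 'b"
  assumes "frobenius_extension N M \<iota>"
    and "\<exists>k>1. has_depth N M \<iota> k"
  shows "\<exists>n. depth_two (jones_ring N M \<iota> (n + 1)) N (jones_embed N M \<iota> (n + 1))"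
proof -
  obtain E m x y where "frobenius_system N M \<iota> E m x y"
    using assms(1) by (rule frobenius_extension_system)
  then interpret frobenius_system N M \<iota> E m x y .
  let ?R = "jones_ring N M \<iota>" and ?\<phi> = "jones_map N M \<iota>" and ?\<eta> = "jones_embed N M \<iota>"
  let ?E = "\<lambda>a. E (inv_into (carrier M) Ext a)" and ?x = "Ext \<circ> x" and ?y = "Ext \<circ> y"
  have iso: "Base \<in> ring_iso N (?R 0)" "Ext \<in> ring_iso M (?R (Suc 0))"
    unfolding jones_0 by (intro inj_imp_image_ring_iso inj_onI; simp)+
  have rings: "ring (?R 0)" "ring (?R (Suc 0))"
    unfolding jones_0
    by (intro R.inj_imp_image_ring_is_ring S.inj_imp_image_ring_is_ring inj_onI; simp)+
  have Base_inv: "inv_into UNIV Base (Base n) = n" for n :: 'a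
    by (rule inv_into_f_f) (auto intro: injI)
  have map0: "?\<phi> 0 (Base n) = Ext (\<iota> n)" for n
    by (simp add: jones_0 Base_inv)
  have layer: "frobenius_system (?R 0) (?R (Suc 0)) (?\<phi> 0) (\<lambda>a. Base (?E a)) m ?x ?y"
    by (rule frobenius_transport[OF rings iso map0])
  \<comment> \<open>The tower starts with a copy of \<open>N\<close>, but depth refers to \<open>N\<close> itself. So the bottom extension
    occurs twice: as a stage of the tower over the copy, and as an extension of \<open>N\<close>.\<close>
  have id_iso: "id \<in> ring_iso N N"
    by (simp add: ring_iso_def ring_hom_def)
  have base: "frobenius_system N (?R (Suc 0)) (?\<eta> (Suc 0)) ?E m ?x ?y"
    using frobenius_transport[OF R.ring_axioms rings(2) id_iso iso(2), of "?\<eta> (Suc 0)"]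
    by (simp add: map0)
  have ladder: "\<exists>E' l p q \<theta> v w. ladder N (?R (Suc 0)) (?\<eta> (Suc 0)) ?E m ?x ?y
      (?R i) (?R (Suc i)) (?\<phi> i) E' l p q (?\<eta> i) \<theta> v w" for i
  proof (induction i)
    case 0
    have "Base \<in> ring_hom N (?R 0)" using iso(1) by (simp add: ring_iso_def)
    then have "ladder N (?R (Suc 0)) (?\<eta> (Suc 0)) ?E m ?x ?y
        (?R 0) (?R (Suc 0)) (?\<phi> 0) (\<lambda>a. Base (?E a)) m ?x ?y Base id \<one>\<^bsub>?R (Suc 0)\<^esub> \<one>\<^bsub>?R (Suc 0)\<^esub>"
      by (rule ladder_base[OF base layer]) simp_all
    then show ?case unfolding jones_embed.simps(1) by blast
  next
    case (Suc i)
    then obtain E' l p q \<theta> v w where l: "ladder N (?R (Suc 0)) (?\<eta> (Suc 0)) ?E m ?x ?y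
        (?R i) (?R (Suc i)) (?\<phi> i) E' l p q (?\<eta> i) \<theta> v w"
      by blast
    then interpret ladder N "?R (Suc 0)" "?\<eta> (Suc 0)" ?E m ?x ?y
      "?R i" "?R (Suc i)" "?\<phi> i" E' l p q "?\<eta> i" \<theta> v w .
    obtain act where "basic_construction (?R i) (?R (Suc i)) (?\<phi> i) E' l p q
        (?R (Suc (Suc i))) (?\<phi> (Suc i)) act"
      using jones_basic_construction[OF layer.frobenius_system_axioms] by blast
    from ladder_step[OF l this] show ?case
      unfolding jones_embed.simps(2)[of N M \<iota> i] by blast
  qed
  obtain k where k: "k > 1" and depth: "has_depth N M \<iota> k" using assms(2) by blast
  define d where "d = k - 2"
  have kd: "k - 1 = Suc d" "k - 2 = d" using k by (auto simp: d_def)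
  obtain E' l p q \<theta> v w where "ladder N (?R (Suc 0)) (?\<eta> (Suc 0)) ?E m ?x ?y
      (?R d) (?R (Suc d)) (?\<phi> d) E' l p q (?\<eta> d) \<theta> v w"
    using ladder by blast
  then interpret top: ladder N "?R (Suc 0)" "?\<eta> (Suc 0)" ?E m ?x ?y
    "?R d" "?R (Suc d)" "?\<phi> d" E' l p q "?\<eta> d" \<theta> v w .
  let ?\<delta> = "?\<phi> d \<circ> ?\<eta> d"
  let ?T = "tensor (?R d) (regular_bimodule (?R (Suc d)) id (?\<phi> d)) (regular_bimodule (?R (Suc d)) (?\<phi> d) ?\<delta>)"
  let ?T' = "tensor (?R d) (regular_bimodule (?R (Suc d)) ?\<delta> (?\<phi> d)) (regular_bimodule (?R (Suc d)) (?\<phi> d) id)"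
  have hom: "ring_hom_ring (?R d) (?R (Suc d)) (?\<phi> d)"
    by (rule top.layer.is_ring_hom_ring)
  have "splits_through (?R d) N (?R (Suc d)) (?\<phi> d) ?\<delta> (?R (Suc d)) (?\<phi> d) ?\<delta> E'"
    using depth unfolding has_depth_def kd
  proof (elim conjE disjE)
    assume "right_depth_three (?R (Suc d)) (?R d) N (?\<phi> d) (?\<eta> d)"
    then obtain r :: nat where r: "r > 0" and summand: "iso_to_direct_summand (?R (Suc d)) N ?T
        (bimodule_power r (regular_bimodule (?R (Suc d)) id ?\<delta>))"
      unfolding right_depth_three_def by blast
    obtain \<tau> where "tensor_square (?R (Suc d)) (?R d) (?\<phi> d) (?R (Suc d)) id N ?\<delta> ?T \<tau>"
      using tensor_square_tensor[of "?R (Suc d)" "?R d" "?\<phi> d" "?R (Suc d)" id N ?\<delta>]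
        top.layer.S.ring_axioms by auto
    then show ?thesis
      by (rule splits_of_depth_three[OF _ hom top.layer.E_hom r summand])
  next
    assume "left_depth_three (?R (Suc d)) (?R d) N (?\<phi> d) (?\<eta> d)"
    then obtain r :: nat where r: "r > 0" and summand: "iso_to_direct_summand N (?R (Suc d)) ?T'
        (bimodule_power r (regular_bimodule (?R (Suc d)) ?\<delta> id))"
      unfolding left_depth_three_def by blast
    obtain \<tau> where "tensor_square (?R (Suc d)) (?R d) (?\<phi> d) N ?\<delta> (?R (Suc d)) id ?T' \<tau>"
      using tensor_square_tensor[of "?R (Suc d)" "?R d" "?\<phi> d" N ?\<delta> "?R (Suc d)" id]
        top.layer.S.ring_axioms by auto
    then show ?thesis
      by (rule splits_of_left_depth_three[OF _ hom top.layer.E_hom r summand])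
  qed
  then have split0: "splits_through N N (?R (Suc 0)) (?\<eta> (Suc 0)) (?\<eta> (Suc 0)) (?R (Suc d)) ?\<delta> ?\<delta> ?E"
    by (rule top.splits_base)
  have delta: "ring_hom_ring N (?R (Suc d)) ?\<delta>"
    by (intro ring_hom_ring.intro ring_hom_ring_axioms.intro R.ring_axioms top.layer.S.ring_axioms
        ring_hom_trans[OF top.nu_hom top.layer.homh])
  \<comment> \<open>The climb: \<open>F\<close> is the composite \<open>E\<^sub>0 \<circ> \<dots> \<circ> E\<^sub>i\<close>, and the target ring of the factors stays fixed.\<close>
  have "\<exists>F l u w. frobenius_system N (?R (Suc i)) (?\<eta> (Suc i)) F l u w \<and>
      splits_through N N (?R (Suc i)) (?\<eta> (Suc i)) (?\<eta> (Suc i)) (?R (Suc d)) ?\<delta> ?\<delta> F" for i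
  proof (induction i)
    case 0
    show ?case using base split0 by blast
  next
    case (Suc i)
    then obtain F l u w where F: "frobenius_system N (?R (Suc i)) (?\<eta> (Suc i)) F l u w"
      and split: "splits_through N N (?R (Suc i)) (?\<eta> (Suc i)) (?\<eta> (Suc i)) (?R (Suc d)) ?\<delta> ?\<delta> F"
      by blast
    obtain E' l' p q \<theta> v w' where "ladder N (?R (Suc 0)) (?\<eta> (Suc 0)) ?E m ?x ?y
        (?R (Suc i)) (?R (Suc (Suc i))) (?\<phi> (Suc i)) E' l' p q (?\<eta> (Suc i)) \<theta> v w'"
      using ladder by blast
    then interpret step: ladder N "?R (Suc 0)" "?\<eta> (Suc 0)" ?E m ?x ?y
      "?R (Suc i)" "?R (Suc (Suc i))" "?\<phi> (Suc i)" E' l' p q "?\<eta> (Suc i)" \<theta> v w' .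
    have embed: "?\<eta> (Suc (Suc i)) = ?\<phi> (Suc i) \<circ> ?\<eta> (Suc i)" by (rule jones_embed.simps)
    show ?case
      unfolding embed
      using frobenius_comp[OF step.layer.frobenius_system_axioms F]
        splits_step[OF step.ladder_axioms delta split0 frobenius_system.E_hom[OF F] split]
      by blast
  qed
  from this[of d] obtain F l u w
    where "frobenius_system N (?R (Suc d)) (?\<eta> (Suc d)) F l u w"
      and "splits_through N N (?R (Suc d)) (?\<eta> (Suc d)) (?\<eta> (Suc d)) (?R (Suc d)) ?\<delta> ?\<delta> F"
    by blast
  then have "depth_two (?R (Suc d)) N (?\<eta> (Suc d))"
    by (intro depth_two_of_splits) simp_all
  then show ?thesis
    by (intro exI[of _ d]) simp
qed

end
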